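(* Let $L>0$, let $P\in H^2(0,L)$ be real-valued with $P(x)\ge P^0>0$ on $[0,L]$, and let $\theta_1,\dots,\theta_4\in\mathbb R$. Suppose there are constants $a,b>0$ with $(a+b-1)^2<4ab$ such that $\theta_1=\theta_3/b-a$, $\theta_2=\theta_4/b$, and suppose $\theta_1,\theta_3<0$, $\theta_2,\theta_4>0$. Let $\mathcal H=\{(w,v,\xi,\psi): w\in H^2(0,L),\ v\in H^1(0,L),\ \xi=v(L),\ \psi=v(0)\}$ with the norm $\|\cdot\|$ of $H^2\times H^1\times\mathbb C\times\mathbb C$, $F[w,v]=\theta_1v(0)+\theta_2v'(0)+\theta_3w(0)+\theta_4w'(0)$, and $A(w,v,\xi,\psi)=(v,(Pw')',-w'(L),F[w,v])$ with domain $$D(A)=\{(w,v,\xi,\psi): w\in H^3(0,L),\ v\in H^2(0,L),\ \xi=v(L),\ \psi=v(0),\ (Pw')'(L)=-w'(L),\ (Pw')'(0)=F[w,v]\}.$$ Then the $C_0$-semigroup $\{T(t)\}_{t\ge0}$ generated by $A$ is exponentially stable: there exist constants $M\ge1$ and $\omega>0$ such that $\|T(t)\|\le Me^{-\omega t}$ for all $t\ge0$.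
   Context: Prime denotes $d/dx$; functions are complex-valued; $\|T(t)\|$ is the operator norm on $\mathcal H$. *)

theory Defs
  imports "HOL-Analysis.Analysis"
begin

text \<open>Functions on the interval [0,L] are complex valued, type real => complex.
  Sobolev spaces are described through their continuous (absolutely continuous)
  representatives on [0,L].\<close>

type_synonym cfun = "real \<Rightarrow> complex"
type_synonym state = "cfun \<times> cfun \<times> complex \<times> complex"

definition L2 :: "real \<Rightarrow> cfun \<Rightarrow> bool" where
  "L2 L g \<longleftrightarrow> g absolutely_integrable_on {0..L} \<and>
      (\<lambda>x. (cmod (g x))\<^sup>2) integrable_on {0..L}"

definition H1 :: "real \<Rightarrow> cfun \<Rightarrow> bool" where
  "H1 L f \<longleftrightarrow> (\<exists>g. L2 L g \<and> (\<forall>x\<in>{0..L}. f x = f 0 + integral {0..x} g))"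

definition dv :: "real \<Rightarrow> cfun \<Rightarrow> cfun" where
  "dv L f = (\<lambda>x. if x \<in> {0..L} then vector_derivative f (at x within {0..L}) else 0)"

definition H2 :: "real \<Rightarrow> cfun \<Rightarrow> bool" where
  "H2 L f \<longleftrightarrow> H1 L f \<and> H1 L (dv L f)"

definition H3 :: "real \<Rightarrow> cfun \<Rightarrow> bool" where
  "H3 L f \<longleftrightarrow> H2 L f \<and> H2 L (dv L f)"

definition h1norm :: "real \<Rightarrow> cfun \<Rightarrow> real" where
  "h1norm L f = sqrt (integral {0..L} (\<lambda>x. (cmod (f x))\<^sup>2)
                    + integral {0..L} (\<lambda>x. (cmod (dv L f x))\<^sup>2))"

definition h2norm :: "real \<Rightarrow> cfun \<Rightarrow> real" where
  "h2norm L f = sqrt (integral {0..L} (\<lambda>x. (cmod (f x))\<^sup>2)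
                    + integral {0..L} (\<lambda>x. (cmod (dv L f x))\<^sup>2)
                    + integral {0..L} (\<lambda>x. (cmod (dv L (dv L f) x))\<^sup>2))"

definition HH :: "real \<Rightarrow> state \<Rightarrow> bool" where
  "HH L s = (case s of (w, v, \<xi>, \<psi>) \<Rightarrow>
      H2 L w \<and> H1 L v \<and> \<xi> = v L \<and> \<psi> = v 0 \<and>
      (\<forall>x. x \<notin> {0..L} \<longrightarrow> w x = 0 \<and> v x = 0))"

definition stnorm :: "real \<Rightarrow> state \<Rightarrow> real" where
  "stnorm L s = (case s of (w, v, \<xi>, \<psi>) \<Rightarrow>
      sqrt ((h2norm L w)\<^sup>2 + (h1norm L v)\<^sup>2 + (cmod \<xi>)\<^sup>2 + (cmod \<psi>)\<^sup>2))"

definition st_add :: "state \<Rightarrow> state \<Rightarrow> state" where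
  "st_add s1 s2 = (case s1 of (w1, v1, a1, b1) \<Rightarrow> case s2 of (w2, v2, a2, b2) \<Rightarrow>
      (\<lambda>x. w1 x + w2 x, \<lambda>x. v1 x + v2 x, a1 + a2, b1 + b2))"

definition st_scale :: "complex \<Rightarrow> state \<Rightarrow> state" where
  "st_scale c s = (case s of (w, v, a, b) \<Rightarrow>
      (\<lambda>x. c * w x, \<lambda>x. c * v x, c * a, c * b))"

definition st_diff :: "state \<Rightarrow> state \<Rightarrow> state" where
  "st_diff s1 s2 = st_add s1 (st_scale (-1) s2)"

definition c0_semigroup :: "real \<Rightarrow> (real \<Rightarrow> state \<Rightarrow> state) \<Rightarrow> bool" where
  "c0_semigroup L T \<longleftrightarrow>
     (\<forall>t\<ge>0. \<forall>x. HH L x \<longrightarrow> HH L (T t x)) \<and>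
     (\<forall>t\<ge>0. \<forall>x y c. HH L x \<longrightarrow> HH L y \<longrightarrow>
         T t (st_add x (st_scale c y)) = st_add (T t x) (st_scale c (T t y))) \<and>
     (\<forall>t\<ge>0. \<exists>C. \<forall>x. HH L x \<longrightarrow> stnorm L (T t x) \<le> C * stnorm L x) \<and>
     (\<forall>x. HH L x \<longrightarrow> T 0 x = x) \<and>
     (\<forall>s t x. s \<ge> 0 \<longrightarrow> t \<ge> 0 \<longrightarrow> HH L x \<longrightarrow> T (s + t) x = T s (T t x)) \<and>
     (\<forall>x. HH L x \<longrightarrow> ((\<lambda>t. stnorm L (st_diff (T t x) x)) \<longlongrightarrow> 0) (at_right 0))"

definition generates :: "real \<Rightarrow> (state \<Rightarrow> state) \<Rightarrow> state set \<Rightarrow> (real \<Rightarrow> state \<Rightarrow> state) \<Rightarrow> bool" where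
  "generates L A D T \<longleftrightarrow> c0_semigroup L T \<and>
     (\<forall>x. x \<in> D \<longleftrightarrow> HH L x \<and> (\<exists>y. HH L y \<and>
         ((\<lambda>h. stnorm L (st_diff (st_scale (complex_of_real (1 / h)) (st_diff (T h x) x)) y))
            \<longlongrightarrow> 0) (at_right 0))) \<and>
     (\<forall>x\<in>D. HH L (A x) \<and>
         ((\<lambda>h. stnorm L (st_diff (st_scale (complex_of_real (1 / h)) (st_diff (T h x) x)) (A x)))
            \<longlongrightarrow> 0) (at_right 0))"

definition Fb :: "real \<Rightarrow> real \<Rightarrow> real \<Rightarrow> real \<Rightarrow> real \<Rightarrow> cfun \<Rightarrow> cfun \<Rightarrow> complex" where
  "Fb L \<theta>1 \<theta>2 \<theta>3 \<theta>4 w v = of_real \<theta>1 * v 0 + of_real \<theta>2 * dv L v 0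
                          + of_real \<theta>3 * w 0 + of_real \<theta>4 * dv L w 0"

definition Aop :: "real \<Rightarrow> (real \<Rightarrow> real) \<Rightarrow> real \<Rightarrow> real \<Rightarrow> real \<Rightarrow> real \<Rightarrow> state \<Rightarrow> state" where
  "Aop L P \<theta>1 \<theta>2 \<theta>3 \<theta>4 s = (case s of (w, v, \<xi>, \<psi>) \<Rightarrow>
      (v, dv L (\<lambda>x. of_real (P x) * dv L w x), - dv L w L, Fb L \<theta>1 \<theta>2 \<theta>3 \<theta>4 w v))"

definition DA :: "real \<Rightarrow> (real \<Rightarrow> real) \<Rightarrow> real \<Rightarrow> real \<Rightarrow> real \<Rightarrow> real \<Rightarrow> state set" where
  "DA L P \<theta>1 \<theta>2 \<theta>3 \<theta>4 = {s. HH L s \<and> (case s of (w, v, \<xi>, \<psi>) \<Rightarrow>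
      H3 L w \<and> H2 L v \<and>
      dv L (\<lambda>x. of_real (P x) * dv L w x) L = - dv L w L \<and>
      dv L (\<lambda>x. of_real (P x) * dv L w x) 0 = Fb L \<theta>1 \<theta>2 \<theta>3 \<theta>4 w v)}"

end

theory Submission
  imports Defs
begin

text \<open>Writing \<open>u = (P w')'\<close>, the energy of the time derivative of a solution,
  \<open>\<integral> \<bar>u\<bar>\<^sup>2 + P \<bar>v'\<bar>\<^sup>2\<close> plus boundary terms, is equivalent to the square of the state norm; the boundary terms
  are chosen such that along the flow it dissipates a multiple of \<open>\<bar>u(0)\<bar>\<^sup>2 + \<bar>\<theta>3 v(0) + \<theta>4 v'(0)\<bar>\<^sup>2\<close>, and
  \<open>(a + b - 1)\<^sup>2 < 4 a b\<close> is exactly the definiteness of this boundary form. Adding small multiples of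
  \<open>\<integral> \<psi> P Re (u cnj v')\<close> with the multiplier \<open>\<psi> = - exp (\<mu> (L - x))\<close>, which moves the dissipation into the interior
  and to the tip mass, and of \<open>- Re (w'(0) cnj (v(0)))\<close>, which recovers the static mode \<open>v(0)\<close>, yields a quadratic
  form \<open>V\<close> equivalent to the squared norm with \<open>V' \<le> - \<kappa> V\<close> on the domain of the generator. The estimate passes to all states
  because the generator is onto, hence its domain is dense.\<close>

subsection \<open>Square integrable functions\<close>

text \<open>The norm of H^2 x H^1 lies one order above the mechanical energy, hence the energy of
  (w_t, v_t) = (v, u). Put eta = \<theta>3 w(0) + \<theta>4 w'(0), with time derivative e =
  \<theta>3 v(0) + \<theta>4 v'(0). The relations for \<theta>1 and \<theta>2 turn the condition at
  0 into b (a v(0) - eta) = e - b u(0). So a multiple of |a v(0) - eta|^2 in the energy produces -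
  |e|^2 - a b |u(0)|^2 + (a + b) e . u(0), and the flux through 0 lowers the coefficient a + b by 1.
  This dissipation sees v(0) and v'(0) only through e. Since \<theta>3 < 0 < \<theta>4, the
  derivative of - w'(0) . v(0) contains - v'(0) . v(0) = - (|\<theta>3| / \<theta>4) |v(0)|^2 - e .
  v(0) / \<theta>4, which supplies the missing negative term. The obstacle on the abstract side is
  regularity in time: the semigroup axioms give right limits and a separate bound for each time, so
  only right derivatives of V are at hand, and left continuity must be won before the differential
  inequality can be integrated.\<close>

lemma L2_iff:
  "L2 L g \<longleftrightarrow> g \<in> borel_measurable (lebesgue_on {0..L}) \<and> (\<lambda>x. (cmod (g x))\<^sup>2) integrable_on {0..L}"
proof
  assume "L2 L g"
  then show "g \<in> borel_measurable (lebesgue_on {0..L}) \<and> (\<lambda>x. (cmod (g x))\<^sup>2) integrable_on {0..L}"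
    by (simp add: L2_def absolutely_integrable_imp_borel_measurable)
next
  assume *: "g \<in> borel_measurable (lebesgue_on {0..L}) \<and> (\<lambda>x. (cmod (g x))\<^sup>2) integrable_on {0..L}"
  have "g absolutely_integrable_on {0..L}"
  proof (rule measurable_bounded_by_integrable_imp_absolutely_integrable)
    show "(\<lambda>x. 1 + (cmod (g x))\<^sup>2) integrable_on {0..L}"
      using * by (intro integrable_add integrable_const_ivl) auto
    show "cmod (g x) \<le> 1 + (cmod (g x))\<^sup>2" for x
      using sum_squares_bound[of 1 "cmod (g x)"] norm_ge_zero[of "g x"]
      unfolding power_one by linarith
  qed (use * in auto)
  with * show "L2 L g" by (simp add: L2_def)
qed

lemma L2_measurable: "L2 L g \<Longrightarrow> g \<in> borel_measurable (lebesgue_on {0..L})"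
  by (simp add: L2_iff)

lemma L2_sq_integrable: "L2 L g \<Longrightarrow> (\<lambda>x. (cmod (g x))\<^sup>2) integrable_on {0..L}"
  by (simp add: L2_iff)

lemma L2_integrable: "L2 L g \<Longrightarrow> g integrable_on {0..L}"
  by (simp add: L2_def absolutely_integrable_on_def)

lemma L2_norm_integrable: "L2 L g \<Longrightarrow> (\<lambda>x. cmod (g x)) integrable_on {0..L}"
  by (simp add: L2_def absolutely_integrable_on_def)

lemma L2_boundedI:
  assumes "g \<in> borel_measurable (lebesgue_on {0..L})" "h integrable_on {0..L}"
    and "\<And>x. x \<in> {0..L} \<Longrightarrow> (cmod (g x))\<^sup>2 \<le> h x"
  shows "L2 L g"
  unfolding L2_iff
proof
  show "(\<lambda>x. (cmod (g x))\<^sup>2) integrable_on {0..L}"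
    by (rule measurable_bounded_by_integrable_imp_integrable_real[OF _ assms(2)])
      (use assms in auto)
qed (use assms in auto)

lemma cmod_add_sq_le: "(cmod (x + y))\<^sup>2 \<le> 2 * (cmod x)\<^sup>2 + 2 * (cmod y)\<^sup>2"
proof -
  have "(cmod (x + y))\<^sup>2 \<le> (cmod x + cmod y)\<^sup>2"
    by (simp add: norm_triangle_ineq power_mono)
  also have "\<dots> \<le> 2 * (cmod x)\<^sup>2 + 2 * (cmod y)\<^sup>2"
    using zero_le_power2[of "cmod x - cmod y"] by (simp add: power2_eq_square algebra_simps)
  finally show ?thesis .
qed

lemma L2_add: assumes "L2 L g" "L2 L h" shows "L2 L (\<lambda>x. g x + h x)"
proof (rule L2_boundedI)
  show "(\<lambda>x. 2 * (cmod (g x))\<^sup>2 + 2 * (cmod (h x))\<^sup>2) integrable_on {0..L}"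
    by (intro integrable_add integrable_on_mult_right L2_sq_integrable assms)
qed (use assms L2_measurable cmod_add_sq_le in auto)

lemma continuous_lebesgue_measurable:
  "continuous_on {0..L::real} k \<Longrightarrow> k \<in> borel_measurable (lebesgue_on {0..L})"
  by (rule continuous_imp_measurable_on_sets_lebesgue) auto

lemma L2_cont_mult:
  assumes "L2 L g" "continuous_on {0..L} k"
  shows "L2 L (\<lambda>x. k x * g x)"
proof -
  have "compact (k ` {0..L})"
    using assms(2) compact_continuous_image compact_Icc by blast
  then obtain C where C: "\<And>x. x \<in> {0..L} \<Longrightarrow> cmod (k x) \<le> C"
    using compact_imp_bounded bounded_iff by (metis image_eqI)
  show ?thesis
  proof (rule L2_boundedI)
    show "(\<lambda>x. C\<^sup>2 * (cmod (g x))\<^sup>2) integrable_on {0..L}"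
      by (intro integrable_on_mult_right L2_sq_integrable assms)
    show "(cmod (k x * g x))\<^sup>2 \<le> C\<^sup>2 * (cmod (g x))\<^sup>2" if "x \<in> {0..L}" for x
      using C[OF that] by (simp add: norm_mult power_mult_distrib mult_right_mono power_mono)
  qed (use L2_measurable[OF assms(1)] continuous_lebesgue_measurable[OF assms(2)] in auto)
qed

lemma L2_cmult: "L2 L g \<Longrightarrow> L2 L (\<lambda>x. c * g x)"
  by (rule L2_cont_mult) auto

lemma L2_cnj: "L2 L g \<Longrightarrow> L2 L (\<lambda>x. cnj (g x))"
proof -
  assume *: "L2 L g"
  have "(\<lambda>x. cnj (g x)) \<in> borel_measurable (lebesgue_on {0..L})"
    using measurable_compose[OF L2_measurable[OF *] borel_measurable_continuous_onI[of cnj]]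
    by (simp add: continuous_on_cnj)
  then show ?thesis
    using * by (simp add: L2_iff)
qed

lemma L2_continuous: "continuous_on {0..L} g \<Longrightarrow> L2 L g"
  unfolding L2_iff
  by (auto intro!: continuous_lebesgue_measurable integrable_continuous_real continuous_intros)

lemma L2_mult_integrable:
  assumes "L2 L g" "L2 L h"
  shows "(\<lambda>x. g x * h x) integrable_on {0..L}"
proof (rule measurable_bounded_by_integrable_imp_integrable)
  show "(\<lambda>x. (cmod (g x))\<^sup>2 + (cmod (h x))\<^sup>2) integrable_on {0..L}"
    by (intro integrable_add L2_sq_integrable assms)
  show "cmod (g x * h x) \<le> (cmod (g x))\<^sup>2 + (cmod (h x))\<^sup>2" for x
    using sum_squares_bound[of "cmod (g x)" "cmod (h x)"]
      mult_nonneg_nonneg[OF norm_ge_zero[of "g x"] norm_ge_zero[of "h x"]]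
    unfolding norm_mult by linarith
qed (use assms L2_measurable in auto)

lemma L2_spike:
  assumes "L2 L g" "negligible N" "\<And>x. x \<in> {0..L} - N \<Longrightarrow> h x = g x"
  shows "L2 L h"
proof -
  have "h absolutely_integrable_on {0..L}"
    by (rule absolutely_integrable_spike[OF _ assms(2,3)]) (use assms(1) in \<open>auto simp: L2_def\<close>)
  moreover have "(\<lambda>x. (cmod (h x))\<^sup>2) integrable_on {0..L}"
    by (rule integrable_spike[OF L2_sq_integrable[OF assms(1)] assms(2)]) (simp add: assms(3))
  ultimately show ?thesis
    by (simp add: L2_def)
qed

subsection \<open>Absolutely continuous functions\<close>

text \<open>A relation instead of an operator: the weak derivative \<open>g\<close> is determined
  only up to a null set, so sums and products can be formed here without exceptional sets. The link
  to \<open>dv\<close> is made separately in \<open>ac_dv_ae\<close> and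
  \<open>ac_dv_eq\<close>.\<close>

definition ac :: "real \<Rightarrow> cfun \<Rightarrow> cfun \<Rightarrow> bool" where
  "ac L f g \<longleftrightarrow> L2 L g \<and> (\<forall>x\<in>{0..L}. integral {0..x} g = f x - f 0)"

lemma H1_iff_ac: "H1 L f \<longleftrightarrow> (\<exists>g. ac L f g)"
  unfolding H1_def ac_def by (metis add.commute add_diff_cancel_left' diff_add_cancel)

lemma ac_L2: "ac L f g \<Longrightarrow> L2 L g"
  by (simp add: ac_def)

lemma L2_integrable_sub: "L2 L g \<Longrightarrow> 0 \<le> x \<Longrightarrow> y \<le> L \<Longrightarrow> g integrable_on {x..y}"
  using L2_integrable integrable_on_subinterval by (metis atLeastatMost_subset_iff)

lemma ac_increment:
  assumes "ac L f g" "0 \<le> x" "x \<le> y" "y \<le> L"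
  shows "(g has_integral (f y - f x)) {x..y}"
proof -
  have i: "g integrable_on {0..y}" "g integrable_on {x..y}"
    using assms by (auto intro!: L2_integrable_sub ac_L2[OF assms(1)])
  have "integral {0..x} g + integral {x..y} g = integral {0..y} g"
    by (rule Henstock_Kurzweil_Integration.integral_combine) (use assms i in auto)
  moreover have "integral {0..y} g = f y - f 0" "integral {0..x} g = f x - f 0"
    using assms by (auto simp: ac_def)
  ultimately have "integral {x..y} g = f y - f x"
    by (simp add: algebra_simps)
  with i show ?thesis
    by (metis integrable_integral)
qed

lemma ac_continuous: assumes "ac L f g" shows "continuous_on {0..L} f"
proof -
  have "continuous_on {0..L} (\<lambda>x. f 0 + integral {0..x} g)"
    by (intro continuous_intros indefinite_integral_continuous_1 L2_integrable ac_L2[OF assms])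
  then show ?thesis
    using assms by (subst continuous_on_cong[OF refl]) (auto simp: ac_def)
qed

lemma ac_spike:
  assumes "ac L f g" "negligible N" "\<And>x. x \<in> {0..L} - N \<Longrightarrow> h x = g x"
  shows "ac L f h"
proof -
  have "integral {0..x} h = integral {0..x} g" if "x \<in> {0..L}" for x
    by (rule integral_spike[OF assms(2)]) (use assms(3) that in auto)
  moreover have "L2 L h"
    using L2_spike assms ac_L2 by blast
  ultimately show ?thesis
    using assms(1) by (simp add: ac_def)
qed

lemma ac_cong:
  assumes "ac L f g" "\<And>x. x \<in> {0..L} \<Longrightarrow> f' x = f x" "\<And>x. x \<in> {0..L} \<Longrightarrow> g' x = g x"
  shows "ac L f' g'"
proof (cases "0 \<le> L")
  case True
  then have "ac L f g'"
    using ac_spike[OF assms(1), of "{}" g'] assms(3) by auto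
  then show ?thesis
    using True assms(2) by (simp add: ac_def)
next
  case False
  then show ?thesis
    using assms(1) by (simp add: ac_def L2_def integrable_on_empty)
qed

lemma ac_add:
  assumes "ac L f g" "ac L f' g'"
  shows "ac L (\<lambda>x. f x + f' x) (\<lambda>x. g x + g' x)"
proof -
  have "integral {0..x} (\<lambda>x. g x + g' x) = integral {0..x} g + integral {0..x} g'" if "x \<in> {0..L}" for x
    by (rule integral_add) (use assms that in \<open>auto intro!: L2_integrable_sub ac_L2\<close>)
  then show ?thesis
    using assms by (auto simp: ac_def intro!: L2_add)
qed

lemma ac_cmult:
  assumes "ac L f g"
  shows "ac L (\<lambda>x. c * f x) (\<lambda>x. c * g x)"
  using assms by (auto simp: ac_def right_diff_distrib intro!: L2_cmult)

lemma ac_cnj: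
  assumes "ac L f g"
  shows "ac L (\<lambda>x. cnj (f x)) (\<lambda>x. cnj (g x))"
proof -
  have "integral {0..x} (\<lambda>x. cnj (g x)) = cnj (integral {0..x} g)" for x
    by (simp add: integral_cnj)
  then show ?thesis
    using assms by (auto simp: ac_def intro!: L2_cnj)
qed

lemma ac_deriv_continuous:
  assumes "\<And>x. x \<in> {0..L} \<Longrightarrow> (f has_vector_derivative g x) (at x within {0..L})" "continuous_on {0..L} g"
  shows "ac L f g"
  unfolding ac_def
proof (intro conjI ballI L2_continuous assms(2))
  fix x assume x: "x \<in> {0..L}"
  have "(g has_integral f x - f 0) {0..x}"
    by (rule fundamental_theorem_of_calculus)
      (use x in \<open>auto intro!: has_vector_derivative_within_subset[OF assms(1)]\<close>)
  then show "integral {0..x} g = f x - f 0"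
    by (simp add: integral_unique)
qed

lemma ac_continuous_deriv:
  assumes "ac L f g" "continuous_on {0..L} g" "x \<in> {0..L}"
  shows "(f has_vector_derivative g x) (at x within {0..L})"
proof -
  have "((\<lambda>u. f 0 + integral {0..u} g) has_vector_derivative 0 + g x) (at x within {0..L})"
    by (intro has_vector_derivative_add has_vector_derivative_const integral_has_vector_derivative assms)
  then show ?thesis
    using has_vector_derivative_transform[OF assms(3), of f "\<lambda>u. f 0 + integral {0..u} g" "g x"] assms(1)
    by (simp add: ac_def)
qed

text \<open>Chaining in steps of length \<open>\<delta>/2\<close>: the increments of
  \<open>F\<close> add up by the triangle inequality, those of \<open>\<mu>\<close>
  telescope.\<close>

lemma increment_bound_of_local:
  fixes F :: "real \<Rightarrow> 'a::real_normed_vector"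
  assumes "\<delta> > 0" and local: "\<And>x y. 0 \<le> x \<Longrightarrow> x \<le> y \<Longrightarrow> y \<le> L \<Longrightarrow> y - x < \<delta> \<Longrightarrow> norm (F y - F x) \<le> \<mu> y - \<mu> x"
    and x: "x \<in> {0..L}"
  shows "norm (F x - F 0) \<le> \<mu> x - \<mu> 0"
proof -
  have "\<forall>x\<in>{0..L}. x \<le> real n * (\<delta>/2) \<longrightarrow> norm (F x - F 0) \<le> \<mu> x - \<mu> 0" for n
  proof (induction n)
    case 0
    show ?case by auto
  next
    case (Suc n)
    show ?case
    proof (intro ballI impI)
      fix x assume x: "x \<in> {0..L}" "x \<le> real (Suc n) * (\<delta>/2)"
      show "norm (F x - F 0) \<le> \<mu> x - \<mu> 0"
      proof (cases "x \<le> real n * (\<delta>/2)")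
        case True
        then show ?thesis using Suc x by auto
      next
        case False
        define z where "z = real n * (\<delta>/2)"
        have z: "z \<in> {0..L}" "z \<le> x" "x - z < \<delta>"
          using x False \<open>\<delta> > 0\<close> by (auto simp: z_def field_simps)
        have "norm (F z - F 0) \<le> \<mu> z - \<mu> 0"
          using Suc z by (auto simp: z_def)
        moreover have "norm (F x - F z) \<le> \<mu> x - \<mu> z"
          using z x by (intro local) auto
        ultimately show ?thesis
          using norm_triangle_ineq[of "F x - F z" "F z - F 0"] by simp
      qed
    qed
  qed
  moreover obtain n where "x / (\<delta>/2) \<le> real n"
    using real_arch_simple by blast
  then have "x \<le> real n * (\<delta>/2)"
    using \<open>\<delta> > 0\<close> by (simp add: field_simps)
  ultimately show ?thesis
    using x by blast
qed

text \<open>The product rule without pointwise derivatives. On a short interval from x to y the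
  product grows by the integral of \<open>g1 s * f2 y + f1 x * g2 s\<close>, and uniform continuity
  makes this integrand differ from \<open>g s\<close> by at most e (|g1| + |g2|). Summing over a
  subdivision bounds the total defect by e times a fixed integral.\<close>

lemma ac_mult:
  assumes 1: "ac L f1 g1" and 2: "ac L f2 g2"
  shows "ac L (\<lambda>x. f1 x * f2 x) (\<lambda>x. g1 x * f2 x + f1 x * g2 x)"
proof -
  note c1 = ac_continuous[OF 1] and c2 = ac_continuous[OF 2]
  define g where "g = (\<lambda>x. g1 x * f2 x + f1 x * g2 x)"
  have Lg: "L2 L g"
    unfolding g_def using L2_cont_mult[OF ac_L2[OF 1] c2] L2_cont_mult[OF ac_L2[OF 2] c1]
    by (intro L2_add) (simp_all add: mult.commute)
  define F where "F x = f1 x * f2 x - integral {0..x} g" for x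
  define \<mu> where "\<mu> x = integral {0..x} (\<lambda>s. cmod (g1 s) + cmod (g2 s))" for x
  have ni: "(\<lambda>s. cmod (g1 s) + cmod (g2 s)) integrable_on {0..L}"
    by (intro integrable_add L2_norm_integrable ac_L2[OF 1] ac_L2[OF 2])
  have small: "norm (F x - F 0) \<le> e * \<mu> x - e * \<mu> 0" if e: "e > 0" and x: "x \<in> {0..L}" for e x
  proof -
    have "uniformly_continuous_on {0..L} f1" "uniformly_continuous_on {0..L} f2"
      using c1 c2 compact_uniformly_continuous compact_Icc by blast+
    then obtain d1 d2 where d: "d1 > 0" "d2 > 0"
      and d1: "\<And>s t. s \<in> {0..L} \<Longrightarrow> t \<in> {0..L} \<Longrightarrow> dist t s < d1 \<Longrightarrow> dist (f1 t) (f1 s) < e"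
      and d2: "\<And>s t. s \<in> {0..L} \<Longrightarrow> t \<in> {0..L} \<Longrightarrow> dist t s < d2 \<Longrightarrow> dist (f2 t) (f2 s) < e"
      unfolding uniformly_continuous_on_def using e by metis
    show ?thesis
    proof (rule increment_bound_of_local[where \<delta> = "min d1 d2" and \<mu> = "\<lambda>x. e * \<mu> x"])
      fix x y assume xy: "0 \<le> x" "x \<le> y" "y \<le> L" "y - x < min d1 d2"
      have ig: "(g has_integral integral {x..y} g) {x..y}"
        using L2_integrable_sub[OF Lg xy(1,3)] by (rule integrable_integral)
      have i1: "((\<lambda>s. g1 s * f2 y) has_integral (f1 y - f1 x) * f2 y) {x..y}"
        by (intro has_integral_mult_left ac_increment[OF 1] xy)
      have i2: "((\<lambda>s. f1 x * g2 s) has_integral f1 x * (f2 y - f2 x)) {x..y}"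
        by (intro has_integral_mult_right ac_increment[OF 2] xy)
      have "integral {0..x} g + integral {x..y} g = integral {0..y} g"
        by (rule Henstock_Kurzweil_Integration.integral_combine) (use xy L2_integrable_sub[OF Lg] in auto)
      then have "F y - F x = (f1 y - f1 x) * f2 y + f1 x * (f2 y - f2 x) - integral {x..y} g"
        unfolding F_def by (simp add: algebra_simps)
      with has_integral_diff[OF has_integral_add[OF i1 i2] ig]
      have I: "((\<lambda>s. g1 s * f2 y + f1 x * g2 s - g s) has_integral F y - F x) {x..y}"
        by simp
      have "integral {0..x} (\<lambda>s. cmod (g1 s) + cmod (g2 s)) + integral {x..y} (\<lambda>s. cmod (g1 s) + cmod (g2 s))
          = integral {0..y} (\<lambda>s. cmod (g1 s) + cmod (g2 s))"
        by (rule Henstock_Kurzweil_Integration.integral_combine)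
          (use xy integrable_on_subinterval[OF ni] in auto)
      moreover have "(\<lambda>s. cmod (g1 s) + cmod (g2 s)) integrable_on {x..y}"
        using integrable_on_subinterval[OF ni] xy by auto
      ultimately have \<mu>: "((\<lambda>s. cmod (g1 s) + cmod (g2 s)) has_integral \<mu> y - \<mu> x) {x..y}"
        unfolding \<mu>_def by (simp add: has_integral_iff algebra_simps)
      have M: "((\<lambda>s. e * (cmod (g1 s) + cmod (g2 s))) has_integral e * (\<mu> y - \<mu> x)) {x..y}"
        by (rule has_integral_mult_right[OF \<mu>])
      have "norm (F y - F x) \<le> e * (\<mu> y - \<mu> x)"
        unfolding integral_unique[OF I, symmetric] integral_unique[OF M, symmetric]
      proof (rule integral_norm_bound_integral)
        fix s assume s: "s \<in> {x..y}"
        have "dist (f2 y) (f2 s) < e" "dist (f1 x) (f1 s) < e"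
          using d1[of s x] d2[of s y] xy s by (auto simp: dist_real_def)
        then have *: "cmod (f2 y - f2 s) \<le> e" "cmod (f1 x - f1 s) \<le> e"
          by (auto simp: dist_norm)
        have "cmod (g1 s * f2 y + f1 x * g2 s - g s) = cmod (g1 s * (f2 y - f2 s) + (f1 x - f1 s) * g2 s)"
          by (simp add: g_def algebra_simps)
        also have "\<dots> \<le> cmod (g1 s) * cmod (f2 y - f2 s) + cmod (f1 x - f1 s) * cmod (g2 s)"
          by (metis norm_triangle_ineq norm_mult)
        also have "\<dots> \<le> cmod (g1 s) * e + e * cmod (g2 s)"
          by (intro add_mono mult_left_mono mult_right_mono *) auto
        finally show "cmod (g1 s * f2 y + f1 x * g2 s - g s) \<le> e * (cmod (g1 s) + cmod (g2 s))"
          by (simp add: algebra_simps)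
      qed (use I M in auto)
      then show "norm (F y - F x) \<le> e * \<mu> y - e * \<mu> x"
        by (simp add: algebra_simps)
    qed (use d x in auto)
  qed
  have "F x - F 0 = 0" if x: "x \<in> {0..L}" for x
  proof -
    have "norm (F x - F 0) \<le> 0 + e" if "e > 0" for e
    proof -
      \<comment> \<open>The small parameter is rescaled so that the total defect stays below
        \<open>e\<close>; the added 1 avoids division by zero.\<close>
      have "norm (F x - F 0) \<le> e / (1 + \<bar>\<mu> x - \<mu> 0\<bar>) * (\<mu> x - \<mu> 0)"
        using small[of "e / (1 + \<bar>\<mu> x - \<mu> 0\<bar>)" x] that x by (simp add: right_diff_distrib)
      also have "\<dots> \<le> e"
      proof -
        have "\<mu> x - \<mu> 0 \<le> 1 + \<bar>\<mu> x - \<mu> 0\<bar>" by simp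
        then show ?thesis
          using that by (simp add: divide_simps)
      qed
      finally show ?thesis by simp
    qed
    then have "norm (F x - F 0) \<le> 0"
      by (rule field_le_epsilon)
    then show ?thesis by simp
  qed
  note F = this
  have "integral {0..x} g = f1 x * f2 x - f1 0 * f2 0" if "x \<in> {0..L}" for x
    using F[OF that] unfolding F_def by (simp add: algebra_simps)
  then show ?thesis
    using Lg unfolding ac_def g_def[symmetric] by blast
qed

lemma has_vector_derivative_dv:
  assumes "L > 0" "x \<in> {0..L}" "(f has_vector_derivative D) (at x within {0..L})"
  shows "dv L f x = D"
  using assms vector_derivative_within_closed_interval[of 0 L x f D] by (simp add: dv_def)

text \<open>Lebesgue differentiation. The averages used are over intervals to the right of a point,
  so the derivative from the left comes from the same theorem applied to the reflected function
  \<open>k (- x)\<close>.\<close>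

lemma ac_dv_ae:
  assumes "L > 0" "ac L f g"
  obtains N where "negligible N" "\<And>x. x \<in> {0..L} - N \<Longrightarrow> dv L f x = g x"
proof -
  \<comment> \<open>Extension by zero gives averages a meaning across the ends of the
    interval.\<close>
  define k where "k x = (if x \<in> {0..L} then g x else 0)" for x
  have kU: "k integrable_on UNIV"
    unfolding k_def using L2_integrable[OF ac_L2[OF assms(2)]] by (subst integrable_restrict_UNIV)
  have ki: "k integrable_on cbox a b" for a b
    by (rule integrable_on_subcbox[OF kU]) auto
  have ki': "(\<lambda>x. k (- x)) integrable_on cbox a b" for a b
    using ki[of "-b" "-a"] Henstock_Kurzweil_Integration.integrable_reflect_real[where f = k and a = "-b" and b = "-a"] by simp
  obtain N1 where N1: "negligible N1"
    and k1: "\<And>x e. x \<notin> N1 \<Longrightarrow> 0 < e \<Longrightarrow> \<exists>d>0. \<forall>h. 0 < h \<and> h < d \<longrightarrow>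
        norm (integral {x..x + h} k /\<^sub>R h - k x) < e"
    using integrable_ccontinuous_explicit[OF ki] by (auto simp: cbox_interval)
  obtain N2 where N2: "negligible N2"
    and k2: "\<And>x e. x \<notin> N2 \<Longrightarrow> 0 < e \<Longrightarrow> \<exists>d>0. \<forall>h. 0 < h \<and> h < d \<longrightarrow>
        norm (integral {x..x + h} (\<lambda>x. k (- x)) /\<^sub>R h - k (- x)) < e"
    using integrable_ccontinuous_explicit[OF ki'] by (auto simp: cbox_interval)
  show thesis
  proof
    show "negligible (N1 \<union> (\<lambda>x. - x) ` N2)"
      by (intro negligible_Un N1 negligible_differentiable_image_negligible N2 order_refl differentiable_on_minus differentiable_on_ident)
    fix x assume x: "x \<in> {0..L} - (N1 \<union> (\<lambda>x. - x) ` N2)"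
    then have x1: "x \<notin> N1" and x2: "- x \<notin> N2" and xL: "0 \<le> x" "x \<le> L"
      by force+
    have fk: "integral {s..t} k = f t - f s" if "0 \<le> s" "s \<le> t" "t \<le> L" for s t
    proof -
      have "integral {s..t} k = integral {s..t} g"
        by (rule integral_cong) (use that in \<open>auto simp: k_def\<close>)
      then show ?thesis
        using integral_unique[OF ac_increment[OF assms(2) that]] by simp
    qed
    have "(f has_vector_derivative g x) (at x within {0..L})"
      unfolding has_vector_derivative_def has_derivative_within_alt
    proof (intro conjI allI impI)
      show "bounded_linear (\<lambda>y. y *\<^sub>R g x)"
        by (rule bounded_linear_scaleR_left)
      fix e :: real assume "e > 0"
      obtain d1 where d1: "d1 > 0" "\<And>h. 0 < h \<Longrightarrow> h < d1 \<Longrightarrow> norm (integral {x..x + h} k /\<^sub>R h - k x) < e"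
        using k1[OF x1 \<open>e > 0\<close>] by blast
      obtain d2 where d2: "d2 > 0" "\<And>h. 0 < h \<Longrightarrow> h < d2 \<Longrightarrow>
          norm (integral {- x..- x + h} (\<lambda>x. k (- x)) /\<^sub>R h - k (- (- x))) < e"
        using k2[OF x2 \<open>e > 0\<close>] by blast
      have kx: "k x = g x" using xL by (simp add: k_def)
      show "\<exists>d>0. \<forall>y\<in>{0..L}. norm (y - x) < d \<longrightarrow> norm (f y - f x - (y - x) *\<^sub>R g x) \<le> e * norm (y - x)"
      proof (intro exI[of _ "min d1 d2"] conjI ballI impI)
        fix y assume y: "y \<in> {0..L}" "norm (y - x) < min d1 d2"
        consider "y = x" | "y > x" | "y < x" by linarith
        then show "norm (f y - f x - (y - x) *\<^sub>R g x) \<le> e * norm (y - x)"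
        proof cases
          case 2
          have "norm (integral {x..x + (y - x)} k /\<^sub>R (y - x) - k x) < e"
            using y 2 by (intro d1) auto
          then have *: "norm ((f y - f x) /\<^sub>R (y - x) - g x) < e"
            using fk[of x y] xL y 2 kx by simp
          have "f y - f x - (y - x) *\<^sub>R g x = (y - x) *\<^sub>R ((f y - f x) /\<^sub>R (y - x) - g x)"
            using 2 by (simp add: scaleR_diff_right)
          then have "norm (f y - f x - (y - x) *\<^sub>R g x) = (y - x) * norm ((f y - f x) /\<^sub>R (y - x) - g x)"
            using 2 by simp
          also have "\<dots> \<le> (y - x) * e"
            using * 2 by (intro mult_left_mono) auto
          finally show ?thesis using 2 by (simp add: mult.commute)
        next
          case 3
          have "norm (integral {- x..- x + (x - y)} (\<lambda>x. k (- x)) /\<^sub>R (x - y) - k (- (- x))) < e"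
            using y 3 by (intro d2) auto
          then have *: "norm ((f x - f y) /\<^sub>R (x - y) - g x) < e"
            using fk[of y x] xL y 3 kx Henstock_Kurzweil_Integration.integral_reflect_real[of x y k] by simp
          have "f y - f x - (y - x) *\<^sub>R g x = - ((x - y) *\<^sub>R ((f x - f y) /\<^sub>R (x - y) - g x))"
            using 3 by (simp add: scaleR_diff_right scaleR_diff_left)
          then have "norm (f y - f x - (y - x) *\<^sub>R g x) = (x - y) * norm ((f x - f y) /\<^sub>R (x - y) - g x)"
            using 3 by (simp only: norm_minus_cancel norm_scaleR)
          also have "\<dots> \<le> (x - y) * e"
            using * 3 by (intro mult_left_mono) auto
          finally show ?thesis using 3 by (simp add: mult.commute)
        qed auto
      qed (use d1 d2 in auto)
    qed
    then show "dv L f x = g x"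
      using assms(1) xL by (intro has_vector_derivative_dv) auto
  qed
qed

lemma ac_dv:
  assumes "L > 0" "H1 L f"
  shows "ac L f (dv L f)"
proof -
  obtain g where g: "ac L f g"
    using assms by (auto simp: H1_iff_ac)
  obtain N where "negligible N" "\<And>x. x \<in> {0..L} - N \<Longrightarrow> dv L f x = g x"
    using ac_dv_ae[OF assms(1) g] by blast
  then show ?thesis
    using ac_spike[OF g] by blast
qed

lemma ac_imp_H1: "ac L f g \<Longrightarrow> H1 L f"
  by (auto simp: H1_iff_ac)

lemma ac_dv_eq:
  assumes "L > 0" "ac L f g" "continuous_on {0..L} g" "x \<in> {0..L}"
  shows "dv L f x = g x"
  using has_vector_derivative_dv[OF assms(1,4) ac_continuous_deriv[OF assms(2-4)]] .

lemma H1_L2: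
  assumes "H1 L f"
  shows "L2 L f"
  using assms ac_continuous L2_continuous by (auto simp: H1_iff_ac)

lemma ac_inverse:
  assumes "ac L f g" "continuous_on {0..L} g" "\<And>x. x \<in> {0..L} \<Longrightarrow> f x \<noteq> 0"
  shows "ac L (\<lambda>x. inverse (f x)) (\<lambda>x. - g x * inverse ((f x)\<^sup>2))"
proof (rule ac_deriv_continuous)
  show "continuous_on {0..L} (\<lambda>x. - g x * inverse ((f x)\<^sup>2))"
    by (intro continuous_intros assms(2) ac_continuous[OF assms(1)]) (use assms(3) in auto)
  fix x assume x: "x \<in> {0..L}"
  have "(inverse has_field_derivative - (inverse (f x) * inverse (f x))) (at (f x) within f ` {0..L})"
    using DERIV_inverse'[OF DERIV_ident assms(3)[OF x]] by simp
  from field_vector_diff_chain_within[OF ac_continuous_deriv[OF assms(1,2) x] this]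
  show "((\<lambda>x. inverse (f x)) has_vector_derivative - g x * inverse ((f x)\<^sup>2)) (at x within {0..L})"
    by (simp add: o_def power2_eq_square)
qed

subsection \<open>The state space\<close>

text \<open>The scalar \<open>of_real 1\<close> is kept so that the right-hand side has the shape
  \<open>st_add x (st_scale c y)\<close>, in which linearity of the semigroup and of the forms is
  stated.\<close>

lemma st_diff_self_add: "a = st_add b (st_scale (of_real 1) (st_diff a b))"
  by (cases a; cases b) (simp add: st_diff_def st_add_def st_scale_def)

lemma st_diff_trans: "st_diff a c = st_add (st_diff a b) (st_scale (of_real 1) (st_diff b c))"
  by (cases a; cases b; cases c) (simp add: st_diff_def st_add_def st_scale_def)

lemma st_diff_scale_distrib:
  "st_scale c (st_diff a b) = st_diff (st_scale c a) (st_scale c b)"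
  by (cases a; cases b) (simp add: st_diff_def st_add_def st_scale_def algebra_simps)

lemma st_scale_scale: "st_scale c (st_scale d a) = st_scale (c * d) a"
  by (cases a) (simp add: st_scale_def mult.assoc)

lemma st_scale_1: "st_scale 1 a = a"
  by (cases a) (simp add: st_scale_def)

lemma st_diff_diff: "st_diff (st_diff a b) (st_diff c d) = st_diff (st_diff a c) (st_diff b d)"
  by (cases a; cases b; cases c; cases d) (simp add: st_diff_def st_add_def st_scale_def algebra_simps)

lemma H1_add: "H1 L f \<Longrightarrow> H1 L g \<Longrightarrow> H1 L (\<lambda>x. f x + g x)"
  using ac_add unfolding H1_iff_ac by blast

lemma H1_mult: "H1 L f \<Longrightarrow> H1 L g \<Longrightarrow> H1 L (\<lambda>x. f x * g x)"
  using ac_mult unfolding H1_iff_ac by blast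

lemma H1_cmult: "H1 L f \<Longrightarrow> H1 L (\<lambda>x. c * f x)"
  using ac_cmult unfolding H1_iff_ac by blast

lemma H1_continuous: "H1 L f \<Longrightarrow> continuous_on {0..L} f"
  using ac_continuous unfolding H1_iff_ac by blast

lemma H1_cong: "H1 L f \<Longrightarrow> (\<And>x. x \<in> {0..L} \<Longrightarrow> f' x = f x) \<Longrightarrow> H1 L f'"
  unfolding H1_iff_ac using ac_cong by blast

lemma H2_continuous_dv: "H2 L f \<Longrightarrow> continuous_on {0..L} (dv L f)"
  by (simp add: H2_def H1_continuous)

lemma H2_ac: "L > 0 \<Longrightarrow> H2 L f \<Longrightarrow> ac L f (dv L f)"
  by (simp add: H2_def ac_dv)

lemma H2_ac_dv: "L > 0 \<Longrightarrow> H2 L f \<Longrightarrow> ac L (dv L f) (dv L (dv L f))"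
  by (simp add: H2_def ac_dv)

text \<open>A continuous weak derivative is the pointwise one, so \<open>dv L f\<close> inherits the
  regularity of \<open>g\<close> on the interval.\<close>

lemma H2_I:
  assumes "L > 0" "ac L f g" "H1 L g"
  shows "H2 L f"
  unfolding H2_def
  using assms ac_imp_H1 H1_cong[OF assms(3), of "dv L f"] ac_dv_eq[OF assms(1,2) H1_continuous[OF assms(3)]]
  by blast

lemma dv_add:
  assumes "L > 0" "H2 L f" "H2 L g" "x \<in> {0..L}"
  shows "dv L (\<lambda>x. f x + g x) x = dv L f x + dv L g x"
  by (rule ac_dv_eq[OF assms(1) ac_add[OF H2_ac[OF assms(1,2)] H2_ac[OF assms(1,3)]] _ assms(4)])
    (intro continuous_intros H2_continuous_dv assms)

lemma dv_cmult:
  assumes "L > 0" "H2 L f" "x \<in> {0..L}"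
  shows "dv L (\<lambda>x. c * f x) x = c * dv L f x"
  by (rule ac_dv_eq[OF assms(1) ac_cmult[OF H2_ac[OF assms(1,2)]] _ assms(3)])
    (intro continuous_intros H2_continuous_dv assms)

lemma H2_add: "L > 0 \<Longrightarrow> H2 L f \<Longrightarrow> H2 L g \<Longrightarrow> H2 L (\<lambda>x. f x + g x)"
  by (rule H2_I[OF _ ac_add[OF H2_ac H2_ac] H1_add]) (auto simp: H2_def)

lemma H2_cmult: "L > 0 \<Longrightarrow> H2 L f \<Longrightarrow> H2 L (\<lambda>x. c * f x)"
  by (rule H2_I[OF _ ac_cmult[OF H2_ac] H1_cmult]) (auto simp: H2_def)

lemma HH_add: "L > 0 \<Longrightarrow> HH L a \<Longrightarrow> HH L b \<Longrightarrow> HH L (st_add a b)"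
  by (cases a; cases b) (auto simp: HH_def st_add_def H1_add H2_add)

lemma HH_scale: "L > 0 \<Longrightarrow> HH L a \<Longrightarrow> HH L (st_scale c a)"
  by (cases a) (auto simp: HH_def st_scale_def H1_cmult H2_cmult)

lemma HH_diff: "L > 0 \<Longrightarrow> HH L a \<Longrightarrow> HH L b \<Longrightarrow> HH L (st_diff a b)"
  by (simp add: st_diff_def HH_add HH_scale)

subsection \<open>One-sided continuity and differentiability\<close>

text \<open>A right-continuous curve is continuous at the intersection of a suitable sequence of nested intervals.\<close>

lemma right_continuous_imp_left_continuous_somewhere:
  fixes \<rho> :: "real \<Rightarrow> real \<Rightarrow> real"
  assumes nonneg: "\<And>s t. \<rho> s t \<ge> 0"
    and sym: "\<And>s t. 0 \<le> s \<Longrightarrow> 0 \<le> t \<Longrightarrow> \<rho> s t = \<rho> t s"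
    and tri: "\<And>s t u. 0 \<le> s \<Longrightarrow> 0 \<le> t \<Longrightarrow> 0 \<le> u \<Longrightarrow> \<rho> s u \<le> \<rho> s t + \<rho> t u"
    and right: "\<And>t. 0 \<le> t \<Longrightarrow> ((\<lambda>h. \<rho> (t + h) t) \<longlongrightarrow> 0) (at_right 0)"
    and "\<delta> > 0"
  obtains \<tau> where "0 < \<tau>" "\<tau> < \<delta>" "((\<lambda>h. \<rho> (\<tau> - h) \<tau>) \<longlongrightarrow> 0) (at_right 0)"
proof -
  \<comment> \<open>Right continuity at the midpoint \<open>c\<close> makes the curve nearly
    constant just to the right of \<open>c\<close>; the new interval is taken there.\<close>
  have step: "\<exists>a' b'. a < a' \<and> a' < b' \<and> b' < b \<and> (\<forall>s\<in>{a'..b'}. \<forall>t\<in>{a'..b'}. \<rho> s t \<le> 1 / real (Suc n))"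
    if ab: "0 \<le> a" "a < b" for a b and n :: nat
  proof -
    define c where "c = (a + b) / 2"
    have c: "0 \<le> c" "a < c" "c < b" using ab by (auto simp: c_def)
    have "\<forall>\<^sub>F h in at_right 0. \<rho> (c + h) c < 1 / real (Suc n) / 2"
      by (rule order_tendstoD(2)[OF right[OF c(1)]]) simp
    then obtain d where d: "d > 0" "\<And>h. 0 < h \<Longrightarrow> h < d \<Longrightarrow> \<rho> (c + h) c < 1 / real (Suc n) / 2"
      unfolding eventually_at_right_field by auto
    define e where "e = min d (b - c)"
    have e: "e > 0" "e \<le> d" "e \<le> b - c" using d c by (auto simp: e_def)
    have "\<rho> s t \<le> 1 / real (Suc n)" if "s \<in> {c + e/3..c + e/2}" "t \<in> {c + e/3..c + e/2}" for s t
    proof -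
      have s: "\<rho> s c < 1 / real (Suc n) / 2" and t: "\<rho> t c < 1 / real (Suc n) / 2"
        using d(2)[of "s - c"] d(2)[of "t - c"] that e by auto
      have "\<rho> s t \<le> \<rho> s c + \<rho> t c"
        using tri[of s c t] sym[of c t] that e c by auto
      also have "\<dots> \<le> 1 / real (Suc n)"
        using s t by linarith
      finally show ?thesis .
    qed
    then show ?thesis
      using c e by (intro exI[of _ "c + e/3"] exI[of _ "c + e/2"]) auto
  qed
  \<comment> \<open>The inclusions of the end points are strict, so the common point is interior to
    every interval and can be approached from the left.\<close>
  define Q where "Q n p q \<longleftrightarrow> fst p < fst q \<and> fst q < snd q \<and> snd q < snd p \<and>
      (\<forall>s\<in>{fst q..snd q}. \<forall>t\<in>{fst q..snd q}. \<rho> s t \<le> 1 / real (Suc n))" for n and p q :: "real \<times> real"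
  have "\<exists>f. f 0 = (0, \<delta>) \<and> (\<forall>n. Q n (f n) (f (Suc n)))"
  proof -
    have "\<exists>f. \<forall>n. (0 \<le> fst (f n) \<and> fst (f n) < snd (f n) \<and> (n = 0 \<longrightarrow> f n = (0, \<delta>))) \<and> Q n (f n) (f (Suc n))"
    proof (rule dependent_nat_choice)
      show "\<exists>x. 0 \<le> fst x \<and> fst x < snd x \<and> (0 = (0::nat) \<longrightarrow> x = (0, \<delta>))"
        using \<open>\<delta> > 0\<close> by (intro exI[of _ "(0, \<delta>)"]) auto
      fix p :: "real \<times> real" and n :: nat
      assume p: "0 \<le> fst p \<and> fst p < snd p \<and> (n = 0 \<longrightarrow> p = (0, \<delta>))"
      then obtain a' b' where "fst p < a' \<and> a' < b' \<and> b' < snd p \<and> (\<forall>s\<in>{a'..b'}. \<forall>t\<in>{a'..b'}. \<rho> s t \<le> 1 / real (Suc n))"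
        using step by blast
      then show "\<exists>q. (0 \<le> fst q \<and> fst q < snd q \<and> (Suc n = 0 \<longrightarrow> q = (0, \<delta>))) \<and> Q n p q"
        using p by (intro exI[of _ "(a', b')"]) (auto simp: Q_def)
    qed
    then show ?thesis by blast
  qed
  then obtain f where f0: "f 0 = (0, \<delta>)" and Q: "\<And>n. Q n (f n) (f (Suc n))"
    by blast
  have mono: "{fst (f n)..snd (f n)} \<subseteq> {fst (f k)..snd (f k)}" if "k \<le> n" for k n
    by (rule lift_Suc_antimono_le[OF _ that]) (use Q in \<open>auto simp: Q_def less_imp_le intro: order_trans\<close>)
  have "{fst (f n)..snd (f n)} \<noteq> {}" for n
  proof (cases n)
    case 0 then show ?thesis using f0 \<open>\<delta> > 0\<close> by auto
  next
    case (Suc k) then show ?thesis using Q[of k] by (auto simp: Q_def)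
  qed
  then have "(\<Inter>n. {fst (f n)..snd (f n)}) \<noteq> {}"
    using mono by (intro compact_nest) auto
  then obtain \<tau> where "\<And>n. \<tau> \<in> {fst (f n)..snd (f n)}"
    by blast
  then have \<tau>: "fst (f n) < \<tau>" "\<tau> < snd (f n)" for n
    using Q[of n] by (force simp: Q_def)+
  have "((\<lambda>h. \<rho> (\<tau> - h) \<tau>) \<longlongrightarrow> 0) (at_right 0)"
  proof (rule order_tendstoI)
    fix e :: real assume "e < 0"
    then show "\<forall>\<^sub>F h in at_right 0. e < \<rho> (\<tau> - h) \<tau>"
      using nonneg by (auto intro: always_eventually less_le_trans)
  next
    fix e :: real assume "0 < e"
    then obtain n where n: "1 / real (Suc n) < e"
      using nat_approx_posE by blast
    have "\<rho> (\<tau> - h) \<tau> < e" if "0 < h" "h < \<tau> - fst (f (Suc n))" for h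
    proof -
      have "\<rho> (\<tau> - h) \<tau> \<le> 1 / real (Suc n)"
        using Q[of n] that \<tau>[of "Suc n"] by (auto simp: Q_def)
      with n show ?thesis by linarith
    qed
    then show "\<forall>\<^sub>F h in at_right 0. \<rho> (\<tau> - h) \<tau> < e"
      unfolding eventually_at_right_field using \<tau>[of "Suc n"]
      by (intro exI[of _ "\<tau> - fst (f (Suc n))"]) auto
  qed
  then show thesis
    using that \<tau>[of 0] f0 by auto
qed

text \<open>The function \<open>exp (\<kappa> * s) * f s\<close> has nonpositive right derivative. A
  maximal initial interval on which it grows with slope at most \<open>\<epsilon>\<close> contains
  its supremum by left continuity and can be prolonged by the right derivative, so it is the whole
  of \<open>{0..t}\<close>.\<close>

lemma decay_of_right_derivative:
  fixes f d :: "real \<Rightarrow> real"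
  assumes left: "\<And>t. t > 0 \<Longrightarrow> ((\<lambda>h. f (t - h)) \<longlongrightarrow> f t) (at_right 0)"
    and right: "\<And>t. t \<ge> 0 \<Longrightarrow> ((\<lambda>h. (f (t + h) - f t) / h) \<longlongrightarrow> d t) (at_right 0)"
    and d: "\<And>t. t \<ge> 0 \<Longrightarrow> d t \<le> - \<kappa> * f t"
    and "t \<ge> 0"
  shows "f t \<le> exp (- \<kappa> * t) * f 0"
proof -
  define g where "g s = exp (\<kappa> * s) * f s" for s
  have gl: "((\<lambda>h. g (s - h)) \<longlongrightarrow> g s) (at_right 0)" if "s > 0" for s
  proof -
    have "((\<lambda>h. exp (\<kappa> * (s - h)) * f (s - h)) \<longlongrightarrow> exp (\<kappa> * (s - 0)) * f s) (at_right 0)"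
      by (intro tendsto_intros left that)
    then show ?thesis by (simp add: g_def)
  qed
  have gr: "((\<lambda>h. (g (s + h) - g s) / h) \<longlongrightarrow> exp (\<kappa> * s) * (d s + \<kappa> * f s)) (at_right 0)" if "s \<ge> 0" for s
  proof -
    have "((\<lambda>h. (exp (\<kappa> * (s + h)) - exp (\<kappa> * s)) / h) \<longlongrightarrow> exp (\<kappa> * s) * \<kappa>) (at 0)"
    proof -
      have "((\<lambda>x. exp (\<kappa> * x)) has_field_derivative exp (\<kappa> * s) * \<kappa>) (at s)"
        by (auto intro!: derivative_eq_intros)
      then show ?thesis
        by (simp add: DERIV_def)
    qed
    then have e: "((\<lambda>h. (exp (\<kappa> * (s + h)) - exp (\<kappa> * s)) / h) \<longlongrightarrow> exp (\<kappa> * s) * \<kappa>) (at_right 0)"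
      by (rule tendsto_within_subset) auto
    have "((\<lambda>h. exp (\<kappa> * (s + h)) * ((f (s + h) - f s) / h) + (exp (\<kappa> * (s + h)) - exp (\<kappa> * s)) / h * f s)
        \<longlongrightarrow> exp (\<kappa> * (s + 0)) * d s + exp (\<kappa> * s) * \<kappa> * f s) (at_right 0)"
      by (intro tendsto_intros right that e)
    then show ?thesis
      by (rule tendsto_cong[THEN iffD1, rotated, THEN tendsto_eq_rhs])
        (auto simp: g_def field_simps eventually_at_filter)
  qed
  have "g t \<le> g 0 + e" if "e > 0" for e
  proof -
    define \<epsilon> where "\<epsilon> = e / (1 + t)"
    have \<epsilon>: "\<epsilon> > 0" using that \<open>t \<ge> 0\<close> by (simp add: \<epsilon>_def)
    define S where "S = {s \<in> {0..t}. \<forall>r\<in>{0..s}. g r \<le> g 0 + \<epsilon> * r}"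
    have S0: "0 \<in> S" using \<open>t \<ge> 0\<close> by (simp add: S_def)
    have bdd: "bdd_above S" by (rule bdd_aboveI[of _ t]) (auto simp: S_def)
    define \<tau> where "\<tau> = Sup S"
    have \<tau>0: "0 \<le> \<tau>" using S0 bdd by (simp add: \<tau>_def cSup_upper)
    have \<tau>t: "\<tau> \<le> t" unfolding \<tau>_def by (rule cSup_least) (use S0 in \<open>auto simp: S_def\<close>)
    have below: "g r \<le> g 0 + \<epsilon> * r" if "0 \<le> r" "r < \<tau>" for r
    proof -
      obtain s where "s \<in> S" "r < s"
        using \<open>r < \<tau>\<close> S0 unfolding \<tau>_def by (metis empty_iff less_cSup_iff bdd)
      then show ?thesis using that by (auto simp: S_def)
    qed
    have g\<tau>: "g \<tau> \<le> g 0 + \<epsilon> * \<tau>"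
    proof (cases "\<tau> = 0")
      case False
      then have "\<tau> > 0" using \<tau>0 by simp
      have "((\<lambda>h. g 0 + \<epsilon> * (\<tau> - h)) \<longlongrightarrow> g 0 + \<epsilon> * (\<tau> - 0)) (at_right 0)"
        by (intro tendsto_intros)
      moreover have "\<forall>\<^sub>F h in at_right 0. g (\<tau> - h) \<le> g 0 + \<epsilon> * (\<tau> - h)"
        unfolding eventually_at_right_field using \<open>\<tau> > 0\<close> below by (intro exI[of _ \<tau>]) auto
      ultimately show ?thesis
        using tendsto_le[OF trivial_limit_at_right_real _ gl[OF \<open>\<tau> > 0\<close>]] by simp
    qed simp
    have "\<tau> = t"
    proof (rule ccontr)
      assume "\<tau> \<noteq> t"
      then have "\<tau> < t" using \<tau>t by simp
      have "exp (\<kappa> * \<tau>) * (d \<tau> + \<kappa> * f \<tau>) < \<epsilon>"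
        using d[OF \<tau>0] \<epsilon> mult_nonneg_nonpos[of "exp (\<kappa> * \<tau>)" "d \<tau> + \<kappa> * f \<tau>"] by simp
      then have "\<forall>\<^sub>F h in at_right 0. (g (\<tau> + h) - g \<tau>) / h < \<epsilon>"
        by (rule order_tendstoD(2)[OF gr[OF \<tau>0]])
      then obtain b where b: "b > 0" "\<And>h. 0 < h \<Longrightarrow> h < b \<Longrightarrow> (g (\<tau> + h) - g \<tau>) / h < \<epsilon>"
        unfolding eventually_at_right_field by auto
      define s where "s = \<tau> + min (b/2) (t - \<tau>)"
      have "g r \<le> g 0 + \<epsilon> * r" if "0 \<le> r" "r \<le> s" for r
      proof -
        consider "r < \<tau>" | "r = \<tau>" | "r > \<tau>" by linarith
        then show ?thesis
        proof cases
          case 3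
          have "(g (\<tau> + (r - \<tau>)) - g \<tau>) / (r - \<tau>) < \<epsilon>"
            using 3 that b by (intro b(2)) (auto simp: s_def)
          then have "g r - g \<tau> \<le> \<epsilon> * (r - \<tau>)"
            using 3 by (simp add: field_simps)
          then show ?thesis using g\<tau> by (simp add: algebra_simps)
        qed (use below g\<tau> that in auto)
      qed
      then have "s \<in> S" using \<tau>0 \<open>\<tau> < t\<close> b by (auto simp: S_def s_def)
      then have "s \<le> \<tau>" unfolding \<tau>_def by (rule cSup_upper[OF _ bdd])
      then show False using \<open>\<tau> < t\<close> b by (auto simp: s_def)
    qed
    then have "g t \<le> g 0 + \<epsilon> * t" using g\<tau> by simp
    also have "\<epsilon> * t \<le> e" using that \<open>t \<ge> 0\<close> by (simp add: \<epsilon>_def field_simps)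
    finally show ?thesis by simp
  qed
  then have "g t \<le> g 0" by (rule field_le_epsilon)
  then show ?thesis
    by (simp add: g_def exp_minus field_simps)
qed

subsection \<open>Semigroups dissipating a quadratic form\<close>

text \<open>The part of the argument that is independent of the wave equation. \<open>B\<close> is
  the polar form of the quadratic form \<open>V\<close>, so \<open>2 * B x (A x)\<close> is the
  derivative of \<open>V\<close> along the flow. The scalars are real because they are time
  steps.\<close>

locale dissipative_semigroup =
  fixes L :: real and A :: "state \<Rightarrow> state" and D :: "state set" and T :: "real \<Rightarrow> state \<Rightarrow> state"
    and V :: "state \<Rightarrow> real" and B :: "state \<Rightarrow> state \<Rightarrow> real" and m M \<kappa> :: real
  assumes L: "L > 0" and gen: "generates L A D T"
    and V_add: "\<And>x y r. HH L x \<Longrightarrow> HH L y \<Longrightarrow>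
        V (st_add x (st_scale (of_real r) y)) = V x + 2 * r * B x y + r\<^sup>2 * V y"
    and V_scale: "\<And>x r. HH L x \<Longrightarrow> V (st_scale (of_real r) x) = r\<^sup>2 * V x"
    and B_add: "\<And>x y z r. HH L x \<Longrightarrow> HH L y \<Longrightarrow> HH L z \<Longrightarrow>
        B x (st_add y (st_scale (of_real r) z)) = B x y + r * B x z"
    and m: "m > 0" and V_lower: "\<And>x. HH L x \<Longrightarrow> m * (stnorm L x)\<^sup>2 \<le> V x"
    and V_upper: "\<And>x. HH L x \<Longrightarrow> V x \<le> M * (stnorm L x)\<^sup>2"
    and diss: "\<And>x. x \<in> D \<Longrightarrow> 2 * B x (A x) \<le> - \<kappa> * V x"
    and surj: "\<And>x. HH L x \<Longrightarrow> \<exists>y\<in>D. A y = x"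
begin

lemma V_nonneg: "HH L x \<Longrightarrow> V x \<ge> 0"
  using V_lower[of x] m by (meson mult_nonneg_nonneg less_imp_le order_trans zero_le_power2)

lemma B_bound: assumes "HH L x" "HH L y" shows "\<bar>B x y\<bar> \<le> sqrt (V x) * sqrt (V y)"
proof -
  have q: "0 \<le> V x + 2 * r * B x y + r\<^sup>2 * V y" for r
    using V_add[OF assms] V_nonneg HH_add HH_scale L assms by metis
  have "(B x y)\<^sup>2 \<le> V x * V y"
  proof (cases "V y = 0")
    case True
    have "B x y = 0"
    proof (rule ccontr)
      assume "B x y \<noteq> 0"
      \<comment> \<open>At this value of \<open>r\<close> the affine function
        \<open>V x + 2 * r * B x y\<close> equals -1.\<close>
      then show False
        using q[of "- (V x + 1) / (2 * B x y)"] True by (simp add: field_simps)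
    qed
    then show ?thesis using True by simp
  next
    case False
    then have y: "V y > 0" using V_nonneg[OF assms(2)] by simp
    \<comment> \<open>The quadratic polynomial in \<open>r\<close> is evaluated at its
      minimiser.\<close>
    have "0 \<le> V x - (B x y)\<^sup>2 / V y"
      using q[of "- B x y / V y"] y by (simp add: power2_eq_square field_simps)
    then show ?thesis using y by (simp add: field_simps)
  qed
  then show ?thesis
    by (metis real_sqrt_abs real_sqrt_le_iff real_sqrt_mult)
qed

text \<open>An equivalent norm whose triangle inequality follows from \<open>B_bound\<close>. All
  limits are taken in \<open>nrm\<close> and carried over by \<open>tendsto_nrm_iff\<close>, so the
  triangle inequality is never asked of \<open>stnorm\<close>.\<close>

definition nrm :: "state \<Rightarrow> real" where "nrm x = sqrt (V x)"

lemma nrm_nonneg: "HH L x \<Longrightarrow> nrm x \<ge> 0"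
  by (simp add: nrm_def V_nonneg)

lemma V_nrm: "HH L x \<Longrightarrow> V x = (nrm x)\<^sup>2"
  by (simp add: nrm_def V_nonneg)

lemma nrm_add: assumes "HH L x" "HH L y" shows "nrm (st_add x (st_scale (of_real 1) y)) \<le> nrm x + nrm y"
proof -
  have "V (st_add x (st_scale (of_real 1) y)) \<le> (nrm x + nrm y)\<^sup>2"
    using B_bound[OF assms] V_add[OF assms, of 1] V_nrm[OF assms(1)] V_nrm[OF assms(2)]
    unfolding nrm_def[symmetric] power2_sum by simp
  then show ?thesis
    unfolding nrm_def[of "st_add _ _"] using nrm_nonneg assms by (simp add: real_le_lsqrt)
qed

lemma nrm_scale: "HH L x \<Longrightarrow> nrm (st_scale (of_real r) x) = \<bar>r\<bar> * nrm x"
  by (simp add: nrm_def V_scale real_sqrt_mult)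

lemma nrm_diff_triangle:
  assumes "HH L a" "HH L b" "HH L c"
  shows "nrm (st_diff a c) \<le> nrm (st_diff a b) + nrm (st_diff b c)"
  using nrm_add[of "st_diff a b" "st_diff b c"] HH_diff[OF L] assms
  by (metis st_diff_trans)

lemma st_diff_swap: "st_diff b a = st_scale (of_real (-1)) (st_diff a b)"
  by (cases a; cases b) (simp add: st_diff_def st_add_def st_scale_def)

lemma nrm_diff_sym: "HH L a \<Longrightarrow> HH L b \<Longrightarrow> nrm (st_diff a b) = nrm (st_diff b a)"
  using st_diff_swap[of a b] nrm_scale[of "st_diff b a" "-1"] HH_diff[OF L, of b a]
  by (metis abs_minus_cancel abs_one mult_1 st_diff_swap)

lemma nrm_le_add_diff: "HH L a \<Longrightarrow> HH L b \<Longrightarrow> nrm a \<le> nrm b + nrm (st_diff a b)"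
  using nrm_add[of b "st_diff a b"] HH_diff[OF L] by (metis st_diff_self_add)

lemma nrm_diff_bound:
  assumes "HH L a" "HH L b" shows "\<bar>nrm a - nrm b\<bar> \<le> nrm (st_diff a b)"
  using nrm_le_add_diff[OF assms] nrm_le_add_diff[OF assms(2,1)] nrm_diff_sym[OF assms] by linarith

lemma nrm_le_stnorm: assumes "HH L x" shows "nrm x \<le> sqrt \<bar>M\<bar> * \<bar>stnorm L x\<bar>"
proof -
  have "V x \<le> \<bar>M\<bar> * (stnorm L x)\<^sup>2"
    using V_upper[OF assms] by (smt (verit) mult_right_mono zero_le_power2)
  then show ?thesis
    unfolding nrm_def by (metis real_sqrt_abs real_sqrt_le_iff real_sqrt_mult)
qed

lemma stnorm_le_nrm: assumes "HH L x" shows "sqrt m * \<bar>stnorm L x\<bar> \<le> nrm x"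
  unfolding nrm_def using V_lower[OF assms] by (metis real_sqrt_abs real_sqrt_le_iff real_sqrt_mult)

lemma tendsto_nrm_iff:
  fixes f :: "real \<Rightarrow> state"
  assumes "\<And>h. h > 0 \<Longrightarrow> HH L (f h)"
  shows "((\<lambda>h. nrm (f h)) \<longlongrightarrow> 0) (at_right 0) \<longleftrightarrow> ((\<lambda>h. stnorm L (f h)) \<longlongrightarrow> 0) (at_right 0)"
proof
  have pos: "\<forall>\<^sub>F h in at_right 0. h > (0::real)"
    by (rule eventually_at_right_less)
  show "((\<lambda>h. stnorm L (f h)) \<longlongrightarrow> 0) (at_right 0)" if l: "((\<lambda>h. nrm (f h)) \<longlongrightarrow> 0) (at_right 0)"
  proof (rule Lim_null_comparison)
    show "((\<lambda>h. nrm (f h) / sqrt m) \<longlongrightarrow> 0) (at_right 0)"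
      using tendsto_divide[OF l tendsto_const[of "sqrt m"]] m by simp
    show "\<forall>\<^sub>F h in at_right 0. norm (stnorm L (f h)) \<le> nrm (f h) / sqrt m"
      using pos by eventually_elim (use stnorm_le_nrm assms m in \<open>auto simp: field_simps\<close>)
  qed
  show "((\<lambda>h. nrm (f h)) \<longlongrightarrow> 0) (at_right 0)" if l: "((\<lambda>h. stnorm L (f h)) \<longlongrightarrow> 0) (at_right 0)"
  proof (rule Lim_null_comparison)
    show "((\<lambda>h. sqrt \<bar>M\<bar> * \<bar>stnorm L (f h)\<bar>) \<longlongrightarrow> 0) (at_right 0)"
      using tendsto_mult[OF tendsto_const[of "sqrt \<bar>M\<bar>"] tendsto_rabs_zero[OF l]] by simp
    show "\<forall>\<^sub>F h in at_right 0. norm (nrm (f h)) \<le> sqrt \<bar>M\<bar> * \<bar>stnorm L (f h)\<bar>"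
      using pos by eventually_elim (use nrm_le_stnorm nrm_nonneg assms in auto)
  qed
qed

section \<open>Consequences of the semigroup axioms\<close>

lemma c0: "c0_semigroup L T"
  using gen by (simp add: generates_def)

lemmas c0_rules = c0[unfolded c0_semigroup_def, THEN conjunct2] c0[unfolded c0_semigroup_def, THEN conjunct1]

lemma T_HH: "t \<ge> 0 \<Longrightarrow> HH L x \<Longrightarrow> HH L (T t x)"
  using c0_rules(2) by blast

lemma T_add: "s \<ge> 0 \<Longrightarrow> t \<ge> 0 \<Longrightarrow> HH L x \<Longrightarrow> T (s + t) x = T s (T t x)"
  using c0_rules(1)[THEN conjunct2, THEN conjunct2, THEN conjunct2, THEN conjunct1] by blast

lemma T_strong: "HH L x \<Longrightarrow> ((\<lambda>h. stnorm L (st_diff (T h x) x)) \<longlongrightarrow> 0) (at_right 0)"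
  using c0_rules(1)[THEN conjunct2, THEN conjunct2, THEN conjunct2, THEN conjunct2] by blast

lemma T_0: "HH L x \<Longrightarrow> T 0 x = x"
  using c0_rules(1)[THEN conjunct2, THEN conjunct2, THEN conjunct1] by blast

lemma T_lin: "t \<ge> 0 \<Longrightarrow> HH L x \<Longrightarrow> HH L y \<Longrightarrow> T t (st_add x (st_scale c y)) = st_add (T t x) (st_scale c (T t y))"
  using c0_rules(1)[THEN conjunct1] by blast

lemma T_diff: "t \<ge> 0 \<Longrightarrow> HH L x \<Longrightarrow> HH L y \<Longrightarrow> T t (st_diff x y) = st_diff (T t x) (T t y)"
  by (simp add: st_diff_def T_lin)

text \<open>The linearity axiom speaks of sums x + c y, so c x is written as x + (c - 1) x.\<close>

lemma T_scale:
  assumes "t \<ge> 0" "HH L x"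
  shows "T t (st_scale c x) = st_scale c (T t x)"
proof -
  have e: "st_add z (st_scale (c - 1) z) = st_scale c z" for z
    by (cases z) (simp add: st_add_def st_scale_def algebra_simps)
  show ?thesis
    using T_lin[OF assms(1) assms(2) assms(2), of "c - 1"] by (simp add: e)
qed

lemma T_bounded:
  assumes "t \<ge> 0"
  obtains C where "C \<ge> 0" "\<And>x. HH L x \<Longrightarrow> nrm (T t x) \<le> C * nrm x"
proof -
  obtain C where C: "\<And>x. HH L x \<Longrightarrow> stnorm L (T t x) \<le> C * stnorm L x"
    using c0_rules(1)[THEN conjunct2, THEN conjunct1] assms by blast
  show thesis
  proof
    fix x assume x: "HH L x"
    have s0: "stnorm L y \<ge> 0" if "HH L y" for y
      using that by (cases y) (simp add: stnorm_def)
    have "nrm (T t x) \<le> sqrt \<bar>M\<bar> * \<bar>stnorm L (T t x)\<bar>"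
      by (rule nrm_le_stnorm[OF T_HH[OF assms x]])
    also have "\<dots> \<le> sqrt \<bar>M\<bar> * (\<bar>C\<bar> * (nrm x / sqrt m))"
    proof (rule mult_left_mono)
      have "\<bar>stnorm L (T t x)\<bar> \<le> \<bar>C\<bar> * \<bar>stnorm L x\<bar>"
        using C[OF x] s0[OF x] s0[OF T_HH[OF assms x]]
        by (smt (verit) mult_right_mono)
      also have "\<dots> \<le> \<bar>C\<bar> * (nrm x / sqrt m)"
        using stnorm_le_nrm[OF x] m by (intro mult_left_mono) (auto simp: field_simps)
      finally show "\<bar>stnorm L (T t x)\<bar> \<le> \<bar>C\<bar> * (nrm x / sqrt m)" .
    qed simp
    finally show "nrm (T t x) \<le> (sqrt \<bar>M\<bar> * \<bar>C\<bar> / sqrt m) * nrm x"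
      by (simp add: field_simps)
  qed (use m in simp)
qed

lemma T_right_continuous:
  assumes "t \<ge> 0" "HH L x"
  shows "((\<lambda>h. nrm (st_diff (T (t + h) x) (T t x))) \<longlongrightarrow> 0) (at_right 0)"
proof -
  have "((\<lambda>h. stnorm L (st_diff (T h (T t x)) (T t x))) \<longlongrightarrow> 0) (at_right 0)"
    using T_strong[OF T_HH[OF assms]] .
  then have "((\<lambda>h. nrm (st_diff (T h (T t x)) (T t x))) \<longlongrightarrow> 0) (at_right 0)"
    by (subst tendsto_nrm_iff) (auto intro!: HH_diff L T_HH assms)
  then show ?thesis
  proof (rule tendsto_cong[THEN iffD1, rotated])
    show "\<forall>\<^sub>F h in at_right 0. nrm (st_diff (T h (T t x)) (T t x)) = nrm (st_diff (T (t + h) x) (T t x))"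
      using eventually_at_right_less[of 0]
      by eventually_elim (use assms T_add in \<open>simp add: add.commute\<close>)
  qed
qed

text \<open>Boundedness of each single operator propagates left continuity from one time to all later times;
  no bound that is locally uniform in time, hence no completeness of the state space, is needed.\<close>

lemma T_left_continuous:
  assumes "t > 0" "HH L x"
  shows "((\<lambda>h. nrm (st_diff (T (t - h) x) (T t x))) \<longlongrightarrow> 0) (at_right 0)"
proof -
  \<comment> \<open>Cut off to 0 at negative times, because nonnegativity is demanded for all real
    arguments.\<close>
  define \<rho> where "\<rho> s t = (if s \<ge> 0 \<and> t \<ge> 0 then nrm (st_diff (T s x) (T t x)) else 0)" for s t
  obtain \<tau> where \<tau>: "0 < \<tau>" "\<tau> < t" "((\<lambda>h. \<rho> (\<tau> - h) \<tau>) \<longlongrightarrow> 0) (at_right 0)"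
  proof (rule right_continuous_imp_left_continuous_somewhere[of \<rho> t])
    show "\<rho> s t \<ge> 0" for s t
      by (auto simp: \<rho>_def intro!: nrm_nonneg HH_diff L T_HH assms)
    show "\<rho> s t = \<rho> t s" for s t
      by (auto simp: \<rho>_def intro!: nrm_diff_sym T_HH assms)
    show "\<rho> s u \<le> \<rho> s t + \<rho> t u" if "0 \<le> s" "0 \<le> t" "0 \<le> u" for s t u
      using that by (auto simp: \<rho>_def intro!: nrm_diff_triangle T_HH assms)
    show "((\<lambda>h. \<rho> (t + h) t) \<longlongrightarrow> 0) (at_right 0)" if "0 \<le> t" for t
    proof (rule tendsto_cong[THEN iffD1, OF _ T_right_continuous[OF that assms(2)]])
      show "\<forall>\<^sub>F h in at_right 0. nrm (st_diff (T (t + h) x) (T t x)) = \<rho> (t + h) t"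
        using eventually_at_right_less[of 0] by eventually_elim (use that in \<open>simp add: \<rho>_def\<close>)
    qed
  qed (use assms in auto)
  obtain C where C: "C \<ge> 0" "\<And>y. HH L y \<Longrightarrow> nrm (T (t - \<tau>) y) \<le> C * nrm y"
    using T_bounded[of "t - \<tau>"] \<tau> by auto
  show ?thesis
  proof (rule Lim_null_comparison)
    show "((\<lambda>h. C * \<rho> (\<tau> - h) \<tau>) \<longlongrightarrow> 0) (at_right 0)"
      using tendsto_mult[OF tendsto_const[of C] \<tau>(3)] by simp
    have "norm (nrm (st_diff (T (t - h) x) (T t x))) \<le> C * \<rho> (\<tau> - h) \<tau>" if h: "0 < h" "h < \<tau>" for h
    proof -
      have "T (t - h) x = T (t - \<tau>) (T (\<tau> - h) x)" "T t x = T (t - \<tau>) (T \<tau> x)"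
        using T_add[of "t - \<tau>" "\<tau> - h" x] T_add[of "t - \<tau>" \<tau> x] \<tau> h assms by auto
      then have "st_diff (T (t - h) x) (T t x) = T (t - \<tau>) (st_diff (T (\<tau> - h) x) (T \<tau> x))"
        using T_diff[of "t - \<tau>"] \<tau> h assms T_HH by simp
      moreover have "HH L (st_diff (T (\<tau> - h) x) (T \<tau> x))"
        using \<tau> h assms by (intro HH_diff L T_HH) auto
      ultimately show ?thesis
        using C(2) nrm_nonneg T_HH[of "t - \<tau>"] \<tau> h by (simp add: \<rho>_def)
    qed
    then show "\<forall>\<^sub>F h in at_right 0. norm (nrm (st_diff (T (t - h) x) (T t x))) \<le> C * \<rho> (\<tau> - h) \<tau>"
      unfolding eventually_at_right_field using \<tau> by (intro exI[of _ \<tau>]) auto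
  qed
qed

section \<open>Difference quotients and the domain of the generator\<close>

definition quot :: "real \<Rightarrow> state \<Rightarrow> state" where
  "quot h x = st_scale (complex_of_real (1 / h)) (st_diff (T h x) x)"

lemma HH_quot: "h > 0 \<Longrightarrow> HH L x \<Longrightarrow> HH L (quot h x)"
  unfolding quot_def by (intro HH_scale HH_diff L T_HH) auto

lemma D_iff: "x \<in> D \<longleftrightarrow> HH L x \<and> (\<exists>y. HH L y \<and> ((\<lambda>h. nrm (st_diff (quot h x) y)) \<longlongrightarrow> 0) (at_right 0))"
proof -
  have "((\<lambda>h. nrm (st_diff (quot h x) y)) \<longlongrightarrow> 0) (at_right 0) \<longleftrightarrow>
      ((\<lambda>h. stnorm L (st_diff (quot h x) y)) \<longlongrightarrow> 0) (at_right 0)" if "HH L x" "HH L y" for y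
    by (rule tendsto_nrm_iff) (intro HH_diff L HH_quot that)
  then show ?thesis
    using gen unfolding generates_def quot_def by blast
qed

lemma D_HH: "x \<in> D \<Longrightarrow> HH L x"
  by (simp add: D_iff)

lemma A_HH: "x \<in> D \<Longrightarrow> HH L (A x)"
  using gen by (simp add: generates_def)

lemma D_limit: assumes "x \<in> D" shows "((\<lambda>h. nrm (st_diff (quot h x) (A x))) \<longlongrightarrow> 0) (at_right 0)"
proof -
  have "((\<lambda>h. stnorm L (st_diff (quot h x) (A x))) \<longlongrightarrow> 0) (at_right 0)"
    using gen assms by (simp add: generates_def quot_def)
  then show ?thesis
    using tendsto_nrm_iff[of "\<lambda>h. st_diff (quot h x) (A x)"] HH_diff[OF L HH_quot[OF _ D_HH[OF assms]] A_HH[OF assms]]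
    by blast
qed

text \<open>\<open>T t\<close> commutes with \<open>quot h\<close> and is bounded, so the difference
  quotients at \<open>T t x\<close> converge, with limit \<open>T t (A x)\<close>.\<close>

lemma T_D:
  assumes "t \<ge> 0" "x \<in> D"
  shows "T t x \<in> D"
  unfolding D_iff
proof (intro conjI exI)
  note x = D_HH[OF assms(2)] and Ax = A_HH[OF assms(2)]
  show "HH L (T t x)" "HH L (T t (A x))"
    using assms x Ax by (auto intro: T_HH)
  obtain C where C: "C \<ge> 0" "\<And>y. HH L y \<Longrightarrow> nrm (T t y) \<le> C * nrm y"
    using T_bounded[OF assms(1)] by blast
  show "((\<lambda>h. nrm (st_diff (quot h (T t x)) (T t (A x)))) \<longlongrightarrow> 0) (at_right 0)"
  proof (rule Lim_null_comparison)
    show "((\<lambda>h. C * nrm (st_diff (quot h x) (A x))) \<longlongrightarrow> 0) (at_right 0)"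
      using tendsto_mult[OF tendsto_const[of C] D_limit[OF assms(2)]] by simp
    have "norm (nrm (st_diff (quot h (T t x)) (T t (A x)))) \<le> C * nrm (st_diff (quot h x) (A x))" if h: "h > 0" for h
    proof -
      have "T h (T t x) = T t (T h x)"
        using T_add[of h t x] T_add[of t h x] h assms x by (simp add: add.commute)
      then have "quot h (T t x) = T t (quot h x)"
        unfolding quot_def using T_scale[OF assms(1) HH_diff[OF L T_HH[of h x] x]] T_diff[OF assms(1) T_HH[of h x] x] h x by simp
      then have e: "st_diff (quot h (T t x)) (T t (A x)) = T t (st_diff (quot h x) (A x))"
        using T_diff[OF assms(1) HH_quot[OF h x] Ax] by simp
      have "HH L (st_diff (quot h x) (A x))"
        by (intro HH_diff L HH_quot x Ax h)
      then show ?thesis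
        unfolding e using C(2) nrm_nonneg T_HH[OF assms(1)] by simp
    qed
    then show "\<forall>\<^sub>F h in at_right 0. norm (nrm (st_diff (quot h (T t x)) (T t (A x)))) \<le> C * nrm (st_diff (quot h x) (A x))"
      using eventually_at_right_less[of 0] by (auto elim: eventually_mono)
  qed
qed

text \<open>Applied to \<open>T h y\<close> and \<open>y\<close> with factor 1/h, this keeps the
  difference quotients of a domain element inside the domain, which is what the density argument in
  \<open>decay\<close> approximates with.\<close>

lemma D_scale_diff:
  assumes "x \<in> D" "y \<in> D"
  shows "st_scale (of_real r) (st_diff x y) \<in> D"
  unfolding D_iff
proof (intro conjI exI)
  note x = D_HH[OF assms(1)] A_HH[OF assms(1)] and y = D_HH[OF assms(2)] A_HH[OF assms(2)]
  show "HH L (st_scale (of_real r) (st_diff x y))" "HH L (st_scale (of_real r) (st_diff (A x) (A y)))"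
    by (intro HH_scale HH_diff L x y)+
  let ?e = "\<lambda>h. st_diff (quot h (st_scale (of_real r) (st_diff x y))) (st_scale (of_real r) (st_diff (A x) (A y)))"
  show "((\<lambda>h. nrm (?e h)) \<longlongrightarrow> 0) (at_right 0)"
  proof (rule Lim_null_comparison)
    show "((\<lambda>h. \<bar>r\<bar> * (nrm (st_diff (quot h x) (A x)) + nrm (st_diff (quot h y) (A y)))) \<longlongrightarrow> 0) (at_right 0)"
      using tendsto_mult[OF tendsto_const[of "\<bar>r\<bar>"] tendsto_add[OF D_limit[OF assms(1)] D_limit[OF assms(2)]]] by simp
    have "norm (nrm (?e h)) \<le> \<bar>r\<bar> * (nrm (st_diff (quot h x) (A x)) + nrm (st_diff (quot h y) (A y)))" if h: "h > 0" for h
    proof -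
      let ?a = "st_diff (quot h x) (A x)" and ?b = "st_diff (quot h y) (A y)"
      have a: "HH L ?a" and b: "HH L ?b"
        using x y h by (auto intro!: HH_diff L HH_quot)
      have "quot h (st_scale (of_real r) (st_diff x y)) = st_scale (of_real r) (st_diff (quot h x) (quot h y))"
        unfolding quot_def using h x y
        by (simp add: T_scale T_diff HH_diff L T_HH st_diff_scale_distrib[symmetric] st_scale_scale st_diff_diff mult.commute)
      then have "?e h = st_scale (of_real r) (st_diff ?a ?b)"
        by (simp add: st_diff_scale_distrib[symmetric] st_diff_diff[of _ _ "A x"])
      also have "nrm \<dots> = \<bar>r\<bar> * nrm (st_diff ?a ?b)"
        by (intro nrm_scale HH_diff L a b)
      also have "nrm (st_diff ?a ?b) \<le> nrm ?a + nrm ?b"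
        using nrm_add[OF a HH_scale[OF L b, of "-1"]] nrm_scale[OF b, of "-1"]
        by (simp add: st_diff_def st_scale_scale st_scale_1)
      finally have "nrm (?e h) \<le> \<bar>r\<bar> * (nrm ?a + nrm ?b)"
        by (simp add: mult_left_mono)
      moreover have "HH L (?e h)"
        using x y h by (intro HH_diff L HH_quot HH_scale)
      ultimately show ?thesis
        using nrm_nonneg by simp
    qed
    then show "\<forall>\<^sub>F h in at_right 0. norm (nrm (?e h)) \<le> \<bar>r\<bar> * (nrm (st_diff (quot h x) (A x)) + nrm (st_diff (quot h y) (A y)))"
      using eventually_at_right_less[of 0] by (auto elim: eventually_mono)
  qed
qed

text \<open>Write \<open>T h x\<close> as x + h (A x + e h) with an error \<open>e h\<close> that
  tends to 0, and expand the quadratic form; \<open>B_bound\<close> makes the error terms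
  vanish.\<close>

lemma V_right_derivative:
  assumes "x \<in> D"
  shows "((\<lambda>h. (V (T h x) - V x) / h) \<longlongrightarrow> 2 * B x (A x)) (at_right 0)"
proof -
  note x = D_HH[OF assms] and Ax = A_HH[OF assms]
  define e where "e h = st_diff (quot h x) (A x)" for h
  have e0: "((\<lambda>h. nrm (e h)) \<longlongrightarrow> 0) (at_right 0)"
    using D_limit[OF assms] by (simp add: e_def)
  have He: "HH L (e h)" if "h > 0" for h
    unfolding e_def by (intro HH_diff L HH_quot x Ax that)
  have Be: "((\<lambda>h. B z (e h)) \<longlongrightarrow> 0) (at_right 0)" if z: "HH L z" for z
  proof (rule Lim_null_comparison)
    show "((\<lambda>h. nrm z * nrm (e h)) \<longlongrightarrow> 0) (at_right 0)"
      using tendsto_mult[OF tendsto_const[of "nrm z"] e0] by simp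
    show "\<forall>\<^sub>F h in at_right 0. norm (B z (e h)) \<le> nrm z * nrm (e h)"
      using eventually_at_right_less[of 0]
      by eventually_elim (use B_bound[OF z He] in \<open>simp add: nrm_def\<close>)
  qed
  have Ve: "((\<lambda>h. (nrm (e h))\<^sup>2) \<longlongrightarrow> 0) (at_right 0)"
    using tendsto_power[OF e0, of 2] by simp
  have id: "((\<lambda>h. h) \<longlongrightarrow> (0::real)) (at_right 0)"
    by (rule tendsto_ident_at)
  have "((\<lambda>h. 2 * (B x (A x) + B x (e h)) + h * (V (A x) + 2 * B (A x) (e h) + (nrm (e h))\<^sup>2))
      \<longlongrightarrow> 2 * (B x (A x) + 0) + 0 * (V (A x) + 2 * 0 + 0)) (at_right 0)"
    by (intro tendsto_intros Be x Ax Ve id)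
  then have lim: "((\<lambda>h. 2 * (B x (A x) + B x (e h)) + h * (V (A x) + 2 * B (A x) (e h) + (nrm (e h))\<^sup>2))
      \<longlongrightarrow> 2 * B x (A x)) (at_right 0)" by simp
  have "2 * (B x (A x) + B x (e h)) + h * (V (A x) + 2 * B (A x) (e h) + (nrm (e h))\<^sup>2) = (V (T h x) - V x) / h"
    if h: "h > 0" for h
  proof -
    have q: "quot h x = st_add (A x) (st_scale (of_real 1) (e h))"
      unfolding e_def by (rule st_diff_self_add)
    have "T h x = st_add x (st_scale (of_real 1) (st_diff (T h x) x))"
      by (rule st_diff_self_add)
    also have "st_scale (of_real 1) (st_diff (T h x) x) = st_scale (of_real h) (quot h x)"
      using h by (simp add: quot_def st_scale_scale st_scale_1)
    finally have "V (T h x) = V x + 2 * h * B x (quot h x) + h\<^sup>2 * V (quot h x)"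
      using V_add[OF x HH_quot[OF h x], of h] by simp
    moreover have "B x (quot h x) = B x (A x) + B x (e h)"
      unfolding q using B_add[OF x Ax He[OF h], of 1] by simp
    moreover have "V (quot h x) = V (A x) + 2 * B (A x) (e h) + (nrm (e h))\<^sup>2"
      unfolding q using V_add[OF Ax He[OF h], of 1] V_nrm[OF He[OF h]] by simp
    ultimately show ?thesis
      using h by (simp add: field_simps power2_eq_square)
  qed
  then show ?thesis
    by (intro tendsto_cong[THEN iffD1, OF _ lim])
      (use eventually_at_right_less[of 0] in \<open>auto elim: eventually_mono\<close>)
qed

lemma decay_D:
  assumes "x \<in> D" "t \<ge> 0"
  shows "V (T t x) \<le> exp (- \<kappa> * t) * V x"
proof -
  note x = D_HH[OF assms(1)]
  have "V (T t x) \<le> exp (- \<kappa> * t) * V (T 0 x)"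
  proof (rule decay_of_right_derivative[where d = "\<lambda>t. 2 * B (T t x) (A (T t x))"])
    show "2 * B (T t x) (A (T t x)) \<le> - \<kappa> * V (T t x)" if "t \<ge> 0" for t
      by (intro diss T_D that assms)
    show "((\<lambda>h. (V (T (t + h) x) - V (T t x)) / h) \<longlongrightarrow> 2 * B (T t x) (A (T t x))) (at_right 0)" if "t \<ge> 0" for t
    proof (rule tendsto_cong[THEN iffD1, OF _ V_right_derivative[OF T_D[OF that assms(1)]]])
      show "\<forall>\<^sub>F h in at_right 0. (V (T h (T t x)) - V (T t x)) / h = (V (T (t + h) x) - V (T t x)) / h"
        using eventually_at_right_less[of 0]
        by eventually_elim (use that x T_add in \<open>simp add: add.commute\<close>)
    qed
    show "((\<lambda>h. V (T (t - h) x)) \<longlongrightarrow> V (T t x)) (at_right 0)" if "t > 0" for t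
    proof -
      have "((\<lambda>h. nrm (T (t - h) x) - nrm (T t x)) \<longlongrightarrow> 0) (at_right 0)"
      proof (rule Lim_null_comparison[OF _ T_left_continuous[OF that x]])
        show "\<forall>\<^sub>F h in at_right 0. norm (nrm (T (t - h) x) - nrm (T t x)) \<le> nrm (st_diff (T (t - h) x) (T t x))"
          unfolding eventually_at_right_field using that x
          by (intro exI[of _ t]) (auto intro!: nrm_diff_bound T_HH)
      qed
      then have "((\<lambda>h. (nrm (T (t - h) x))\<^sup>2) \<longlongrightarrow> (nrm (T t x))\<^sup>2) (at_right 0)"
        by (intro tendsto_power) (rule LIM_zero_cancel)
      then show ?thesis
      proof (rule tendsto_cong[THEN iffD1, rotated, THEN tendsto_eq_rhs])
        show "\<forall>\<^sub>F h in at_right 0. (nrm (T (t - h) x))\<^sup>2 = V (T (t - h) x)"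
          unfolding eventually_at_right_field using that x
          by (intro exI[of _ t]) (auto simp: V_nrm T_HH)
        show "(nrm (T t x))\<^sup>2 = V (T t x)"
          using that x by (simp add: V_nrm T_HH)
      qed
    qed
  qed (use assms in auto)
  then show ?thesis by (simp add: T_0 x)
qed

text \<open>The domain is dense because every state is of the form \<open>A y\<close>, a limit of difference quotients of \<open>y\<close>.\<close>

theorem decay:
  assumes "HH L x" "t \<ge> 0"
  shows "V (T t x) \<le> exp (- \<kappa> * t) * V x"
proof -
  obtain y where y: "y \<in> D" "A y = x" using surj[OF assms(1)] by blast
  obtain C where C: "C \<ge> 0" "\<And>y. HH L y \<Longrightarrow> nrm (T t y) \<le> C * nrm y"
    using T_bounded[OF assms(2)] by blast
  define E where "E = sqrt (exp (- \<kappa> * t))"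
  have lim: "((\<lambda>h. nrm (st_diff (quot h y) x)) \<longlongrightarrow> 0) (at_right 0)"
    using D_limit[OF y(1)] y(2) by simp
  \<comment> \<open>\<open>quot h y\<close> lies in the domain and decays with factor
    \<open>E\<close>; the bound \<open>C\<close> of the single operator \<open>T t\<close> meets
    only the approximation error, which vanishes as \<open>h\<close> tends to 0.\<close>
  have "nrm (T t x) \<le> E * (nrm x + nrm (st_diff (quot h y) x)) + C * nrm (st_diff (quot h y) x)" if h: "h > 0" for h
  proof -
    have qD: "quot h y \<in> D"
      unfolding quot_def using h by (intro D_scale_diff T_D y) auto
    note q = D_HH[OF qD]
    have "nrm (T t x) \<le> nrm (T t (quot h y)) + nrm (st_diff (T t x) (T t (quot h y)))"
      by (intro nrm_le_add_diff T_HH assms q)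
    also have "nrm (st_diff (T t x) (T t (quot h y))) = nrm (T t (st_diff (quot h y) x))"
      using T_diff[OF assms(2) q assms(1)] nrm_diff_sym T_HH assms q by simp
    also have "\<dots> \<le> C * nrm (st_diff (quot h y) x)"
      by (intro C HH_diff L q assms)
    also have "nrm (T t (quot h y)) \<le> E * nrm (quot h y)"
      unfolding nrm_def E_def real_sqrt_mult[symmetric] by (rule real_sqrt_le_mono[OF decay_D[OF qD assms(2)]])
    also have "E * nrm (quot h y) \<le> E * (nrm x + nrm (st_diff (quot h y) x))"
      by (intro mult_left_mono nrm_le_add_diff q assms) (simp add: E_def)
    finally show ?thesis by simp
  qed
  then have ev: "\<forall>\<^sub>F h in at_right 0. nrm (T t x) \<le> E * (nrm x + nrm (st_diff (quot h y) x)) + C * nrm (st_diff (quot h y) x)"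
    using eventually_at_right_less[of 0] by (auto elim: eventually_mono)
  have "((\<lambda>h. E * (nrm x + nrm (st_diff (quot h y) x)) + C * nrm (st_diff (quot h y) x)) \<longlongrightarrow> E * (nrm x + 0) + C * 0) (at_right 0)"
    by (intro tendsto_intros lim)
  from tendsto_lowerbound[OF this ev] have "nrm (T t x) \<le> E * nrm x"
    by simp
  then show ?thesis
    unfolding nrm_def E_def real_sqrt_mult[symmetric] by simp
qed

end

subsection \<open>Integral inequalities\<close>

lemma complex_inner_mult: "(x::complex) \<bullet> y = Re (x * cnj y)"
  by (simp add: inner_complex_def)

lemma L2_inner_integrable:
  assumes "L2 L g" "L2 L h" "continuous_on {0..L} k"
  shows "(\<lambda>x. (k x :: real) * (g x \<bullet> h x)) integrable_on {0..L}"
proof -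
  have "L2 L (\<lambda>x. of_real (k x) * g x)"
    by (intro L2_cont_mult assms continuous_intros)
  from L2_mult_integrable[OF this L2_cnj[OF assms(2)]]
  have "(\<lambda>x. Re (of_real (k x) * g x * cnj (h x))) integrable_on {0..L}"
    using integrable_linear[OF _ bounded_linear_Re] by (fastforce simp: o_def)
  then show ?thesis
    by (simp add: inner_complex_def algebra_simps)
qed

lemma L2_weighted_sq_integrable:
  assumes "L2 L g" "continuous_on {0..L} k"
  shows "(\<lambda>x. (k x :: real) * (cmod (g x))\<^sup>2) integrable_on {0..L}"
  using L2_inner_integrable[OF assms(1,1,2)] by (simp add: dot_square_norm)

lemma ac_inner:
  assumes "ac L f f'" "ac L g g'" "L \<ge> 0"
  shows "((\<lambda>x. f x \<bullet> g' x + f' x \<bullet> g x) has_integral f L \<bullet> g L - f 0 \<bullet> g 0) {0..L}"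
proof -
  have "((\<lambda>x. f' x * cnj (g x) + f x * cnj (g' x)) has_integral f L * cnj (g L) - f 0 * cnj (g 0)) {0..L}"
    using ac_increment[OF ac_mult[OF assms(1) ac_cnj[OF assms(2)]], of 0 L] assms(3) by simp
  from has_integral_Re[OF this] show ?thesis
    by (simp add: complex_inner_mult add.commute)
qed

lemma ac_weighted_sq:
  assumes "ac L (\<lambda>x. of_real (k x)) (\<lambda>x. of_real (k' x))" "ac L f f'" "L \<ge> 0"
  shows "((\<lambda>x. k x * (2 * (f x \<bullet> f' x)) + k' x * (cmod (f x))\<^sup>2) has_integral
      k L * (cmod (f L))\<^sup>2 - k 0 * (cmod (f 0))\<^sup>2) {0..L}"
proof -
  have "((\<lambda>x. (of_real (k x) * f x) \<bullet> f' x + (of_real (k' x) * f x + of_real (k x) * f' x) \<bullet> f x) has_integral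
      (of_real (k L) * f L) \<bullet> f L - (of_real (k 0) * f 0) \<bullet> f 0) {0..L}"
    by (rule ac_inner[OF ac_mult[OF assms(1,2)] assms(2,3)])
  moreover have "(of_real r * z) \<bullet> y = r * (z \<bullet> y)" for r and z y :: complex
    by (simp add: inner_complex_def algebra_simps)
  ultimately show ?thesis
    by (simp add: inner_add_left dot_square_norm algebra_simps inner_commute[of "f' _"])
qed

text \<open>With \<open>\<mu>\<close> the mean of |g|, the inequality says that the integral of (|g|
  - \<open>\<mu>\<close>)^2 is nonnegative.\<close>

lemma L2_cauchy_schwarz:
  assumes "L > 0" "L2 L g"
  shows "(integral {0..L} (\<lambda>x. cmod (g x)))\<^sup>2 \<le> L * integral {0..L} (\<lambda>x. (cmod (g x))\<^sup>2)"
proof -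
  define \<mu> where "\<mu> = integral {0..L} (\<lambda>x. cmod (g x)) / L"
  have i1: "((\<lambda>x. (cmod (g x))\<^sup>2) has_integral integral {0..L} (\<lambda>x. (cmod (g x))\<^sup>2)) {0..L}"
    using L2_sq_integrable[OF assms(2)] by (rule integrable_integral)
  have i2: "((\<lambda>x. cmod (g x)) has_integral \<mu> * L) {0..L}"
    using integrable_integral[OF L2_norm_integrable[OF assms(2)]] assms(1) by (simp add: \<mu>_def)
  have i3: "((\<lambda>x. \<mu>\<^sup>2) has_integral L * \<mu>\<^sup>2) {0..L}"
    using has_integral_const_real[of "\<mu>\<^sup>2" 0 L] assms(1) by simp
  have "((\<lambda>x. (cmod (g x))\<^sup>2 - (2 * \<mu>) * cmod (g x) + \<mu>\<^sup>2) has_integral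
      integral {0..L} (\<lambda>x. (cmod (g x))\<^sup>2) - (2 * \<mu>) * (\<mu> * L) + L * \<mu>\<^sup>2) {0..L}"
    by (intro has_integral_add has_integral_diff has_integral_mult_right i1 i2 i3)
  then have "0 \<le> integral {0..L} (\<lambda>x. (cmod (g x))\<^sup>2) - (2 * \<mu>) * (\<mu> * L) + L * \<mu>\<^sup>2"
  proof (rule has_integral_nonneg)
    show "0 \<le> (cmod (g x))\<^sup>2 - (2 * \<mu>) * cmod (g x) + \<mu>\<^sup>2" for x
      using zero_le_power2[of "cmod (g x) - \<mu>"] by (simp add: power2_diff algebra_simps)
  qed
  then have "L * (L * \<mu>\<^sup>2) \<le> L * integral {0..L} (\<lambda>x. (cmod (g x))\<^sup>2)"
    using assms(1) by (intro mult_left_mono) (auto simp: power2_eq_square algebra_simps)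
  moreover have "integral {0..L} (\<lambda>x. cmod (g x)) = L * \<mu>"
    using assms(1) by (simp add: \<mu>_def)
  ultimately show ?thesis
    by (simp add: power_mult_distrib power2_eq_square mult.assoc mult.left_commute)
qed

lemma ac_increment_sq_le:
  assumes "L > 0" "ac L f g" "x \<in> {0..L}" "y \<in> {0..L}"
  shows "(cmod (f x - f y))\<^sup>2 \<le> L * integral {0..L} (\<lambda>x. (cmod (g x))\<^sup>2)"
proof -
  have *: "cmod (f t - f s) \<le> integral {0..L} (\<lambda>x. cmod (g x))" if "0 \<le> s" "s \<le> t" "t \<le> L" for s t
  proof -
    note hi = ac_increment[OF assms(2) that]
    have sub: "(\<lambda>x. cmod (g x)) integrable_on {s..t}"
      by (rule integrable_on_subinterval[OF L2_norm_integrable[OF ac_L2[OF assms(2)]]]) (use that in auto)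
    have "cmod (f t - f s) \<le> integral {s..t} (\<lambda>x. cmod (g x))"
      unfolding integral_unique[OF hi, symmetric]
      by (rule integral_norm_bound_integral) (use hi sub in auto)
    also have "\<dots> \<le> integral {0..L} (\<lambda>x. cmod (g x))"
      by (rule integral_subset_le) (use that sub L2_norm_integrable[OF ac_L2[OF assms(2)]] in auto)
    finally show ?thesis .
  qed
  have "cmod (f x - f y) \<le> integral {0..L} (\<lambda>x. cmod (g x))"
    using *[of x y] *[of y x] assms(3,4) by (cases "x \<le> y") (auto simp: norm_minus_commute)
  then have "(cmod (f x - f y))\<^sup>2 \<le> (integral {0..L} (\<lambda>x. cmod (g x)))\<^sup>2"
    by (rule power_mono) simp
  also note L2_cauchy_schwarz[OF assms(1) ac_L2[OF assms(2)]]
  finally show ?thesis .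
qed

lemma ac_pointwise_sq_le:
  assumes "L > 0" "ac L f g" "x \<in> {0..L}" "y \<in> {0..L}"
  shows "(cmod (f x))\<^sup>2 \<le> 2 * (cmod (f y))\<^sup>2 + 2 * (L * integral {0..L} (\<lambda>x. (cmod (g x))\<^sup>2))"
  using cmod_add_sq_le[of "f y" "f x - f y"] ac_increment_sq_le[OF assms] by simp

text \<open>The bound \<open>ac_pointwise_sq_le\<close> is averaged over the reference point
  \<open>y\<close>.\<close>

lemma ac_trace_sq_le:
  assumes "L > 0" "ac L f g" "x \<in> {0..L}"
  shows "(cmod (f x))\<^sup>2 \<le> (2 / L) * integral {0..L} (\<lambda>x. (cmod (f x))\<^sup>2)
      + (2 * L) * integral {0..L} (\<lambda>x. (cmod (g x))\<^sup>2)"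
proof -
  let ?G = "integral {0..L} (\<lambda>x. (cmod (g x))\<^sup>2)" and ?F = "integral {0..L} (\<lambda>x. (cmod (f x))\<^sup>2)"
  have f: "(\<lambda>x. (cmod (f x))\<^sup>2) integrable_on {0..L}"
    by (intro L2_sq_integrable L2_continuous ac_continuous[OF assms(2)])
  have c: "((\<lambda>y. C) has_integral L * C) {0..L}" for C :: real
    using has_integral_const_real[of C 0 L] assms(1) by simp
  have "L * (cmod (f x))\<^sup>2 \<le> 2 * ?F + L * (2 * (L * ?G))"
    by (rule has_integral_le[OF c[of "(cmod (f x))\<^sup>2"]
          has_integral_add[OF has_integral_mult_right[OF integrable_integral[OF f]] c]])
      (use ac_pointwise_sq_le[OF assms] in auto)
  then show ?thesis
    using assms(1) by (simp add: field_simps)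
qed

lemma ac_integral_sq_le:
  assumes "L > 0" "ac L f g" "y \<in> {0..L}"
  shows "integral {0..L} (\<lambda>x. (cmod (f x))\<^sup>2)
      \<le> (2 * L) * (cmod (f y))\<^sup>2 + (2 * L\<^sup>2) * integral {0..L} (\<lambda>x. (cmod (g x))\<^sup>2)"
proof -
  let ?G = "integral {0..L} (\<lambda>x. (cmod (g x))\<^sup>2)"
  have f: "(\<lambda>x. (cmod (f x))\<^sup>2) integrable_on {0..L}"
    by (intro L2_sq_integrable L2_continuous ac_continuous[OF assms(2)])
  have c: "((\<lambda>y. C) has_integral L * C) {0..L}" for C :: real
    using has_integral_const_real[of C 0 L] assms(1) by simp
  have "integral {0..L} (\<lambda>x. (cmod (f x))\<^sup>2) \<le> L * (2 * (cmod (f y))\<^sup>2 + 2 * (L * ?G))"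
    by (rule has_integral_le[OF integrable_integral[OF f] c])
      (use ac_pointwise_sq_le[OF assms(1,2) _ assms(3)] in auto)
  then show ?thesis
    by (simp add: algebra_simps power2_eq_square)
qed

subsection \<open>The energy form of the wave equation\<close>

lemma inner_of_real_mult: "(of_real r * z) \<bullet> y = r * (z \<bullet> (y::complex))" "z \<bullet> (of_real r * y) = r * (z \<bullet> y)"
  by (simp_all add: inner_complex_def algebra_simps)

locale wave_system =
  fixes L P0 a b \<theta>1 \<theta>2 \<theta>3 \<theta>4 :: real and P :: "real \<Rightarrow> real"
  assumes L: "L > 0" and P_H2: "H2 L (\<lambda>x. complex_of_real (P x))"
    and P0: "P0 > 0" and P_ge: "\<forall>x\<in>{0..L}. P x \<ge> P0"
    and a: "a > 0" and b: "b > 0" and ab: "(a + b - 1)\<^sup>2 < 4 * a * b"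
    and \<theta>1: "\<theta>1 = \<theta>3 / b - a" and \<theta>2: "\<theta>2 = \<theta>4 / b" and \<theta>3: "\<theta>3 < 0" and \<theta>4: "\<theta>4 > 0"
begin

definition P' :: "real \<Rightarrow> real" where "P' x = Re (dv L (\<lambda>x. complex_of_real (P x)) x)"

text \<open>\<open>P\<close> equals its own conjugate, hence so does its derivative, which is
  therefore real.\<close>

lemma P_ac: "ac L (\<lambda>x. complex_of_real (P x)) (\<lambda>x. complex_of_real (P' x))"
proof (rule ac_cong[OF H2_ac[OF L P_H2] refl])
  fix x assume x: "x \<in> {0..L}"
  have "ac L (\<lambda>x. complex_of_real (P x)) (\<lambda>x. cnj (dv L (\<lambda>x. complex_of_real (P x)) x))"
    using ac_cnj[OF H2_ac[OF L P_H2]] by simp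
  from ac_dv_eq[OF L this continuous_on_cnj[OF H2_continuous_dv[OF P_H2]] x]
  show "complex_of_real (P' x) = dv L (\<lambda>x. complex_of_real (P x)) x"
    unfolding P'_def by (metis Reals_cnj_iff of_real_Re)
qed

lemma P'_continuous: "continuous_on {0..L} P'"
  unfolding P'_def by (intro continuous_intros H2_continuous_dv P_H2)

lemma P_continuous: "continuous_on {0..L} P"
  using continuous_on_Re[OF ac_continuous[OF P_ac]] by simp

lemma P_pos: "x \<in> {0..L} \<Longrightarrow> P x > 0"
  using P_ge P0 by fastforce

lemma ends: "0 \<in> {0..L}" "L \<in> {0..L}"
  using L by auto

text \<open>Coordinates adapted to the flow: along a solution \<open>Uf\<close> is the acceleration
  v_t, \<open>Gf\<close> is the time derivative of \<open>Wf\<close>, and \<open>et\<close> is the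
  displacement part of the feedback \<open>Fb\<close>.\<close>

definition Wf :: "state \<Rightarrow> cfun" where "Wf s = dv L (fst s)"
definition Uf :: "state \<Rightarrow> cfun" where "Uf s = dv L (\<lambda>x. of_real (P x) * dv L (fst s) x)"
definition Gf :: "state \<Rightarrow> cfun" where "Gf s = dv L (fst (snd s))"
definition vz :: "state \<Rightarrow> complex" where "vz s = fst (snd s) 0"
definition et :: "state \<Rightarrow> complex" where "et s = of_real \<theta>3 * fst s 0 + of_real \<theta>4 * Wf s 0"

lemma HH_D:
  assumes "HH L s"
  shows "H2 L (fst s)" "H1 L (fst (snd s))" "fst (snd (snd s)) = fst (snd s) L" "snd (snd (snd s)) = fst (snd s) 0"
  using assms by (auto simp: HH_def split: prod.splits)

lemma flux_ac: assumes "HH L s" shows "ac L (\<lambda>x. of_real (P x) * Wf s x) (Uf s)"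
  unfolding Uf_def Wf_def
  by (rule ac_dv[OF L ac_imp_H1[OF ac_mult[OF P_ac H2_ac_dv[OF L HH_D(1)[OF assms]]]]])

lemma Wf_ac: "HH L s \<Longrightarrow> ac L (fst s) (Wf s)"
  unfolding Wf_def by (intro H2_ac L HH_D)

lemma dWf_ac: "HH L s \<Longrightarrow> ac L (Wf s) (dv L (Wf s))"
  unfolding Wf_def by (intro H2_ac_dv L HH_D)

lemma Gf_ac: "HH L s \<Longrightarrow> ac L (fst (snd s)) (Gf s)"
  unfolding Gf_def by (intro ac_dv L HH_D)

lemma Wf_continuous: "HH L s \<Longrightarrow> continuous_on {0..L} (Wf s)"
  using dWf_ac ac_continuous by blast

lemma Uf_L2: "HH L s \<Longrightarrow> L2 L (Uf s)" and Gf_L2: "HH L s \<Longrightarrow> L2 L (Gf s)"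
  using flux_ac Gf_ac ac_L2 by blast+

lemma Uf_ae:
  assumes "HH L s"
  obtains N where "negligible N"
    "\<And>x. x \<in> {0..L} - N \<Longrightarrow> Uf s x = of_real (P' x) * Wf s x + of_real (P x) * dv L (Wf s) x"
  using ac_dv_ae[OF L ac_mult[OF P_ac dWf_ac[OF assms]]] unfolding Uf_def Wf_def[symmetric] by blast

lemma fst_st_add_scale:
  "fst (st_add s (st_scale c t)) = (\<lambda>x. fst s x + c * fst t x)"
  "fst (snd (st_add s (st_scale c t))) = (\<lambda>x. fst (snd s) x + c * fst (snd t) x)"
  by (cases s; cases t; simp add: st_add_def st_scale_def)+

lemma Wf_lin:
  assumes "HH L s" "HH L t" "x \<in> {0..L}"
  shows "Wf (st_add s (st_scale c t)) x = Wf s x + c * Wf t x"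
  unfolding Wf_def fst_st_add_scale
  using dv_add[OF L HH_D(1)[OF assms(1)] H2_cmult[OF L HH_D(1)[OF assms(2)]] assms(3)]
    dv_cmult[OF L HH_D(1)[OF assms(2)] assms(3)] by simp

lemma vz_lin: "vz (st_add s (st_scale c t)) = vz s + c * vz t"
  by (simp add: vz_def fst_st_add_scale)

lemma et_lin: "HH L s \<Longrightarrow> HH L t \<Longrightarrow> et (st_add s (st_scale c t)) = et s + c * et t"
  using L by (simp add: et_def fst_st_add_scale Wf_lin algebra_simps)

lemma UG_lin:
  assumes "HH L s" "HH L t"
  obtains N where "negligible N"
    "\<And>x. x \<in> {0..L} - N \<Longrightarrow> Uf (st_add s (st_scale c t)) x = Uf s x + c * Uf t x"
    "\<And>x. x \<in> {0..L} - N \<Longrightarrow> Gf (st_add s (st_scale c t)) x = Gf s x + c * Gf t x"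
proof -
  have "ac L (\<lambda>x. of_real (P x) * Wf (st_add s (st_scale c t)) x) (\<lambda>x. Uf s x + c * Uf t x)"
    by (rule ac_cong[OF ac_add[OF flux_ac[OF assms(1)] ac_cmult[OF flux_ac[OF assms(2)]]]])
      (auto simp: Wf_lin assms algebra_simps)
  from ac_dv_ae[OF L this] obtain N1 where N1: "negligible N1"
    "\<And>x. x \<in> {0..L} - N1 \<Longrightarrow> Uf (st_add s (st_scale c t)) x = Uf s x + c * Uf t x"
    unfolding Uf_def[of "st_add _ _"] Wf_def by blast
  from ac_dv_ae[OF L ac_add[OF Gf_ac[OF assms(1)] ac_cmult[OF Gf_ac[OF assms(2)]]]]
  obtain N2 where N2: "negligible N2"
    "\<And>x. x \<in> {0..L} - N2 \<Longrightarrow> Gf (st_add s (st_scale c t)) x = Gf s x + c * Gf t x"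
    unfolding Gf_def[of "st_add _ _"] fst_st_add_scale by blast
  show thesis
    by (rule that[of "N1 \<union> N2"]) (use N1 N2 in auto)
qed

text \<open>The quotient \<open>P 0 / \<theta>4\<close> turns the boundary flux \<open>P w'\<close> at \<open>0\<close> into \<open>c0 * (et - \<theta>3 * w 0)\<close>.\<close>

definition c0 :: real where "c0 = P 0 / \<theta>4"

lemma c0_pos: "c0 > 0"
  using P_pos[OF ends(1)] \<theta>4 by (simp add: c0_def)

text \<open>In \<open>form\<close>, \<open>N\<close> weights the energy of the time derivative of a solution, \<open>\<phi>\<close> and \<open>K\<close> weight the
  multiplier terms of the Lyapunov functional.\<close>

definition dens :: "real \<Rightarrow> (real \<Rightarrow> real) \<Rightarrow> state \<Rightarrow> state \<Rightarrow> real \<Rightarrow> real" where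
  "dens N \<phi> s t x = N * (Uf s x \<bullet> Uf t x) + (N * P x) * (Gf s x \<bullet> Gf t x)
     + \<phi> x * (Uf s x \<bullet> Gf t x) + \<phi> x * (Gf s x \<bullet> Uf t x)"

definition form :: "real \<Rightarrow> (real \<Rightarrow> real) \<Rightarrow> real \<Rightarrow> state \<Rightarrow> state \<Rightarrow> real" where
  "form N \<phi> K s t = integral {0..L} (dens N \<phi> s t)
     + N * (P L * (Wf s L \<bullet> Wf t L) + c0 * \<bar>\<theta>3\<bar> * (vz s \<bullet> vz t)
            + c0 * b * ((of_real a * vz s - et s) \<bullet> (of_real a * vz t - et t)))
     - K * (Wf s 0 \<bullet> vz t + vz s \<bullet> Wf t 0)"

lemma dens_integrable:
  assumes "HH L s" "HH L t" "continuous_on {0..L} \<phi>"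
  shows "dens N \<phi> s t integrable_on {0..L}"
  unfolding dens_def[abs_def] using assms
  by (intro integrable_add L2_inner_integrable Uf_L2 Gf_L2 continuous_intros P_continuous)

lemma form_sym: "form N \<phi> K s t = form N \<phi> K t s"
  by (simp add: form_def dens_def[abs_def] inner_commute add.commute add.left_commute)

lemma form_lin:
  assumes "HH L s" "HH L t" "HH L u" "continuous_on {0..L} \<phi>"
  shows "form N \<phi> K s (st_add t (st_scale (of_real r) u)) = form N \<phi> K s t + r * form N \<phi> K s u"
proof -
  obtain E where E: "negligible E"
    "\<And>x. x \<in> {0..L} - E \<Longrightarrow> Uf (st_add t (st_scale (of_real r) u)) x = Uf t x + of_real r * Uf u x"
    "\<And>x. x \<in> {0..L} - E \<Longrightarrow> Gf (st_add t (st_scale (of_real r) u)) x = Gf t x + of_real r * Gf u x"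
    using UG_lin[OF assms(2,3)] by blast
  have "integral {0..L} (dens N \<phi> s (st_add t (st_scale (of_real r) u)))
      = integral {0..L} (\<lambda>x. dens N \<phi> s t x + r * dens N \<phi> s u x)"
    by (rule integral_spike[OF E(1)])
      (simp add: dens_def E inner_add_right inner_of_real_mult algebra_simps)
  also have "\<dots> = integral {0..L} (dens N \<phi> s t) + r * integral {0..L} (dens N \<phi> s u)"
    using dens_integrable assms by (simp add: integral_add integrable_on_mult_right)
  finally have i: "integral {0..L} (dens N \<phi> s (st_add t (st_scale (of_real r) u)))
    = integral {0..L} (dens N \<phi> s t) + r * integral {0..L} (dens N \<phi> s u)" .
  have e: "of_real a * vz (st_add t (st_scale (of_real r) u)) - et (st_add t (st_scale (of_real r) u))
     = (of_real a * vz t - et t) + of_real r * (of_real a * vz u - et u)"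
    using assms by (simp add: vz_lin et_lin algebra_simps)
  show ?thesis
    unfolding form_def i e using assms ends
    by (simp add: Wf_lin vz_lin inner_add_right inner_of_real_mult algebra_simps)
qed

text \<open>Isolates the weight \<open>N\<close>, which is fixed last, once the constants of the
  remaining part are known.\<close>

lemma form_split:
  assumes "HH L s" "HH L t" "continuous_on {0..L} \<phi>"
  shows "form N \<phi> K s t = N * form 1 (\<lambda>x. 0) 0 s t + form 0 \<phi> K s t"
proof -
  have "integral {0..L} (dens N \<phi> s t) = integral {0..L} (\<lambda>x. N * dens 1 (\<lambda>x. 0) s t x + dens 0 \<phi> s t x)"
    by (rule integral_cong) (simp add: dens_def algebra_simps)
  also have "\<dots> = N * integral {0..L} (dens 1 (\<lambda>x. 0) s t) + integral {0..L} (dens 0 \<phi> s t)"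
    using dens_integrable assms by (simp add: integral_add integrable_on_mult_right)
  finally show ?thesis
    by (simp add: form_def algebra_simps)
qed

lemma form_square:
  assumes "HH L s" "HH L t" "continuous_on {0..L} \<phi>"
  shows "form N \<phi> K (st_add s (st_scale (of_real r) t)) (st_add s (st_scale (of_real r) t))
     = form N \<phi> K s s + 2 * r * form N \<phi> K s t + r\<^sup>2 * form N \<phi> K t t"
proof -
  let ?z = "st_add s (st_scale (of_real r) t)"
  have z: "HH L ?z" by (intro HH_add HH_scale L assms)
  have "form N \<phi> K ?z ?z = form N \<phi> K s ?z + r * form N \<phi> K t ?z"
    using form_lin[OF z assms(1,2,3)] form_sym by metis
  then show ?thesis
    using form_lin[OF assms(1,1,2,3)] form_lin[OF assms(2,1,2,3)] form_sym[of N \<phi> K t s]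
    by (simp add: algebra_simps power2_eq_square)
qed

lemma form_scale:
  assumes "HH L s" "continuous_on {0..L} \<phi>"
  shows "form N \<phi> K (st_scale (of_real r) s) (st_scale (of_real r) s) = r\<^sup>2 * form N \<phi> K s s"
proof -
  have e: "st_scale (of_real r) s = st_add s (st_scale (of_real (r - 1)) s)"
    by (cases s) (simp add: st_add_def st_scale_def algebra_simps)
  show ?thesis
    unfolding e form_square[OF assms(1,1,2)] by (simp add: algebra_simps power2_eq_square)
qed

text \<open>The energy of the time derivative. Each boundary term meets a flux: the one at
  \<open>L\<close> belongs to the tip mass, the |v(0)|^2 term answers the v(0) part of the flux at
  0, and the last one creates the dissipation.\<close>

definition Z :: "state \<Rightarrow> real" where "Z s = form 1 (\<lambda>x. 0) 0 s s"

definition IU :: "state \<Rightarrow> real" where "IU s = integral {0..L} (\<lambda>x. (cmod (Uf s x))\<^sup>2)"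
definition IG :: "state \<Rightarrow> real" where "IG s = integral {0..L} (\<lambda>x. P x * (cmod (Gf s x))\<^sup>2)"

lemma IU_nonneg: "IU s \<ge> 0"
  unfolding IU_def by (cases "(\<lambda>x. (cmod (Uf s x))\<^sup>2) integrable_on {0..L}")
    (auto intro: integral_nonneg simp: not_integrable_integral)

lemma IG_nonneg: "HH L s \<Longrightarrow> IG s \<ge> 0"
  unfolding IG_def
  by (intro integral_nonneg L2_weighted_sq_integrable Gf_L2 P_continuous) (auto intro!: mult_nonneg_nonneg less_imp_le[OF P_pos])

lemma Z_eq:
  assumes "HH L s"
  shows "Z s = IU s + IG s + P L * (cmod (Wf s L))\<^sup>2 + c0 * \<bar>\<theta>3\<bar> * (cmod (vz s))\<^sup>2
     + c0 * b * (cmod (of_real a * vz s - et s))\<^sup>2"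
proof -
  have "integral {0..L} (dens 1 (\<lambda>x. 0) s s) = integral {0..L} (\<lambda>x. (cmod (Uf s x))\<^sup>2 + P x * (cmod (Gf s x))\<^sup>2)"
    by (simp add: dens_def[abs_def] dot_square_norm)
  also have "\<dots> = IU s + IG s"
    unfolding IU_def IG_def
    by (intro integral_add L2_weighted_sq_integrable L2_sq_integrable Gf_L2 Uf_L2 P_continuous assms)
  finally show ?thesis
    by (simp add: Z_def form_def dot_square_norm)
qed

end

section \<open>Comparison of functionals up to constants\<close>

lemma continuous_bound:
  fixes k :: "real \<Rightarrow> real"
  assumes "continuous_on {0..L} k"
  obtains C where "C > 0" "\<And>x. x \<in> {0..L} \<Longrightarrow> \<bar>k x\<bar> \<le> C"
proof -
  have "compact (k ` {0..L})"
    using assms compact_continuous_image compact_Icc by blast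
  then obtain C where "C > 0" "\<forall>y\<in>k ` {0..L}. norm y \<le> C"
    using compact_imp_bounded bounded_pos by blast
  then show thesis using that by auto
qed

abbreviation sqint :: "real \<Rightarrow> cfun \<Rightarrow> real" where
  "sqint L f \<equiv> integral {0..L} (\<lambda>x. (cmod (f x))\<^sup>2)"

lemma sqint_nonneg: "sqint L f \<ge> 0"
  by (cases "(\<lambda>x. (cmod (f x))\<^sup>2) integrable_on {0..L}")
    (auto intro: integral_nonneg simp: not_integrable_integral)

lemma sqint_le_ae:
  assumes "L2 L f" "L2 L g" "L2 L h" "negligible N" "C1 \<ge> 0" "C2 \<ge> 0"
    and "\<And>x. x \<in> {0..L} - N \<Longrightarrow> (cmod (f x))\<^sup>2 \<le> C1 * (cmod (g x))\<^sup>2 + C2 * (cmod (h x))\<^sup>2"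
  shows "sqint L f \<le> C1 * sqint L g + C2 * sqint L h"
proof -
  define f' where "f' x = (if x \<in> N then 0 else f x)" for x
  have "sqint L f = sqint L f'"
    by (rule integral_spike[OF assms(4)]) (auto simp: f'_def)
  also have "\<dots> \<le> integral {0..L} (\<lambda>x. C1 * (cmod (g x))\<^sup>2 + C2 * (cmod (h x))\<^sup>2)"
  proof (rule integral_le)
    show "(\<lambda>x. (cmod (f' x))\<^sup>2) integrable_on {0..L}"
      by (rule L2_sq_integrable[OF L2_spike[OF assms(1,4)]]) (simp add: f'_def)
    show "(\<lambda>x. C1 * (cmod (g x))\<^sup>2 + C2 * (cmod (h x))\<^sup>2) integrable_on {0..L}"
      by (intro integrable_add integrable_on_mult_right L2_sq_integrable assms)
    show "(cmod (f' x))\<^sup>2 \<le> C1 * (cmod (g x))\<^sup>2 + C2 * (cmod (h x))\<^sup>2" if "x \<in> {0..L}" for x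
      using assms(5,6) assms(7)[of x] that by (auto simp: f'_def)
  qed
  also have "\<dots> = C1 * sqint L g + C2 * sqint L h"
    using assms by (simp add: integral_add integrable_on_mult_right L2_sq_integrable)
  finally show ?thesis .
qed

text \<open>Inequality up to a constant uniform in the state, so that the many constants need not be
  carried along; the constant is nonnegative so that the relation is transitive.\<close>

definition dominated :: "real \<Rightarrow> (state \<Rightarrow> real) \<Rightarrow> (state \<Rightarrow> real) \<Rightarrow> bool" where
  "dominated L f g \<longleftrightarrow> (\<exists>C\<ge>0. \<forall>s. HH L s \<longrightarrow> f s \<le> C * g s)"

lemma dominatedI: "C \<ge> 0 \<Longrightarrow> (\<And>s. HH L s \<Longrightarrow> f s \<le> C * g s) \<Longrightarrow> dominated L f g"
  unfolding dominated_def by blast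

lemma dominated_cancel: "k > 0 \<Longrightarrow> (\<And>s. HH L s \<Longrightarrow> k * f s \<le> g s) \<Longrightarrow> dominated L f g"
  by (rule dominatedI[of "1 / k"]) (auto simp: field_simps)

lemma dominated_add: "dominated L f g \<Longrightarrow> dominated L f' g \<Longrightarrow> dominated L (\<lambda>s. f s + f' s) g"
  unfolding dominated_def
proof (elim exE conjE)
  fix C C' :: real
  assume "C \<ge> 0" "C' \<ge> 0" "\<forall>s. HH L s \<longrightarrow> f s \<le> C * g s" "\<forall>s. HH L s \<longrightarrow> f' s \<le> C' * g s"
  then show "\<exists>C\<ge>0. \<forall>s. HH L s \<longrightarrow> f s + f' s \<le> C * g s"
    by (intro exI[of _ "C + C'"]) (auto simp: distrib_right add_mono)
qed

lemma dominated_scale: "k \<ge> 0 \<Longrightarrow> dominated L f g \<Longrightarrow> dominated L (\<lambda>s. k * f s) g"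
  unfolding dominated_def
proof (elim exE conjE)
  fix C :: real
  assume "k \<ge> 0" "C \<ge> 0" "\<forall>s. HH L s \<longrightarrow> f s \<le> C * g s"
  then show "\<exists>C\<ge>0. \<forall>s. HH L s \<longrightarrow> k * f s \<le> C * g s"
    by (intro exI[of _ "k * C"]) (auto simp: mult_left_mono mult.assoc)
qed

lemma dominated_trans: "dominated L f g \<Longrightarrow> dominated L g h \<Longrightarrow> dominated L f h"
  unfolding dominated_def
proof (elim exE conjE)
  fix C C' :: real
  assume "C \<ge> 0" "C' \<ge> 0" and fg: "\<forall>s. HH L s \<longrightarrow> f s \<le> C * g s" and gh: "\<forall>s. HH L s \<longrightarrow> g s \<le> C' * h s"
  have "f s \<le> (C * C') * h s" if "HH L s" for s
    using fg[rule_format, OF that] mult_left_mono[OF gh[rule_format, OF that] \<open>C \<ge> 0\<close>] by simp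
  then show "\<exists>C\<ge>0. \<forall>s. HH L s \<longrightarrow> f s \<le> C * h s"
    using \<open>C \<ge> 0\<close> \<open>C' \<ge> 0\<close> by (intro exI[of _ "C * C'"]) auto
qed

lemma dominated_le:
  assumes "dominated L f g" "\<And>s. HH L s \<Longrightarrow> f' s \<le> f s"
  shows "dominated L f' g"
  using assms unfolding dominated_def by (meson order_trans)

section \<open>Equivalence of the energy with the squared norm\<close>

context wave_system
begin

lemma stnorm_sq:
  assumes "HH L s"
  shows "(stnorm L s)\<^sup>2 = sqint L (fst s) + sqint L (Wf s) + sqint L (dv L (Wf s))
      + sqint L (fst (snd s)) + sqint L (Gf s) + (cmod (fst (snd s) L))\<^sup>2 + (cmod (vz s))\<^sup>2"
  using HH_D[OF assms]
  by (cases s) (simp add: stnorm_def h1norm_def h2norm_def Wf_def Gf_def vz_def sqint_nonneg add_nonneg_nonneg)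

lemma Z_terms_le:
  assumes "HH L s"
  shows "IU s \<le> Z s" "IG s \<le> Z s" "P L * (cmod (Wf s L))\<^sup>2 \<le> Z s" "c0 * \<bar>\<theta>3\<bar> * (cmod (vz s))\<^sup>2 \<le> Z s"
    "c0 * b * (cmod (of_real a * vz s - et s))\<^sup>2 \<le> Z s"
proof -
  have "P L * (cmod (Wf s L))\<^sup>2 \<ge> 0" "c0 * \<bar>\<theta>3\<bar> * (cmod (vz s))\<^sup>2 \<ge> 0"
    "c0 * b * (cmod (of_real a * vz s - et s))\<^sup>2 \<ge> 0"
    using P_pos[OF ends(2)] c0_pos b by (auto intro!: mult_nonneg_nonneg)
  then show "IU s \<le> Z s" "IG s \<le> Z s" "P L * (cmod (Wf s L))\<^sup>2 \<le> Z s" "c0 * \<bar>\<theta>3\<bar> * (cmod (vz s))\<^sup>2 \<le> Z s"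
    "c0 * b * (cmod (of_real a * vz s - et s))\<^sup>2 \<le> Z s"
    unfolding Z_eq[OF assms] using IU_nonneg[of s] IG_nonneg[OF assms] by linarith+
qed

lemma Z_nonneg: "HH L s \<Longrightarrow> Z s \<ge> 0"
  using Z_terms_le(1) IU_nonneg order_trans by blast

lemma cmod_scaled_sum_sq:
  "(cmod (of_real r * x + of_real q * y))\<^sup>2 \<le> 2 * r\<^sup>2 * (cmod x)\<^sup>2 + 2 * q\<^sup>2 * (cmod y)\<^sup>2"
  using cmod_add_sq_le[of "of_real r * x" "of_real q * y"] by (simp add: norm_mult power_mult_distrib)

lemma stnorm_dominates:
  fixes n :: "state \<Rightarrow> real"
  defines "n \<equiv> \<lambda>s. (stnorm L s)\<^sup>2"
  shows "dominated L (\<lambda>s. sqint L (fst s)) n" "dominated L (\<lambda>s. sqint L (Wf s)) n"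
    "dominated L (\<lambda>s. sqint L (dv L (Wf s))) n" "dominated L (\<lambda>s. sqint L (Gf s)) n"
    "dominated L (\<lambda>s. (cmod (vz s))\<^sup>2) n"
  unfolding n_def
  by (auto intro!: dominatedI[of 1] add_nonneg_nonneg simp: stnorm_sq sqint_nonneg add.assoc add_increasing add_increasing2)

lemma Wf_dominated:
  assumes "x \<in> {0..L}"
  shows "dominated L (\<lambda>s. (cmod (Wf s x))\<^sup>2) (\<lambda>s. (stnorm L s)\<^sup>2)"
  by (rule dominated_le[OF dominated_add[OF dominated_scale[OF _ stnorm_dominates(2)]
          dominated_scale[OF _ stnorm_dominates(3)]] ac_trace_sq_le[OF L dWf_ac assms]])
    (use L in auto)

text \<open>The end-point values in \<open>Z\<close> are traces controlled by the H^2 and H^1 norms,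
  and u = P' w' + P w'' almost everywhere with bounded coefficients.\<close>

lemma Z_dominated: "dominated L Z (\<lambda>s. (stnorm L s)\<^sup>2)"
proof -
  let ?n = "\<lambda>s. (stnorm L s)\<^sup>2"
  note n = stnorm_dominates and W = Wf_dominated
  obtain Pm where Pm: "Pm > 0" "\<And>x. x \<in> {0..L} \<Longrightarrow> \<bar>P x\<bar> \<le> Pm"
    using continuous_bound[OF P_continuous] by blast
  obtain P1 where P1: "P1 > 0" "\<And>x. x \<in> {0..L} \<Longrightarrow> \<bar>P' x\<bar> \<le> P1"
    using continuous_bound[OF P'_continuous] by blast

  have w: "dominated L (\<lambda>s. (cmod (fst s x))\<^sup>2) ?n" if "x \<in> {0..L}" for x
    by (rule dominated_le[OF dominated_add[OF dominated_scale[OF _ n(1)] dominated_scale[OF _ n(2)]] ac_trace_sq_le[OF L Wf_ac that]])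
      (use L in auto)
  have e: "dominated L (\<lambda>s. (cmod (et s))\<^sup>2) ?n"
    unfolding et_def
    by (rule dominated_le[OF dominated_add[OF dominated_scale[OF _ w[OF ends(1)]] dominated_scale[OF _ W[OF ends(1)]]] cmod_scaled_sum_sq]) auto
  have ve: "dominated L (\<lambda>s. (cmod (of_real a * vz s - et s))\<^sup>2) ?n"
    by (rule dominated_le[OF dominated_add[OF dominated_scale[of "2 * a\<^sup>2", OF _ n(5)] dominated_scale[of "2 * (-1)\<^sup>2", OF _ e]]])
      (use cmod_scaled_sum_sq[of a _ "-1"] in auto)
  have U: "dominated L IU ?n"
  proof (rule dominated_le[OF dominated_add[OF dominated_scale[of "2 * P1\<^sup>2", OF _ n(2)] dominated_scale[of "2 * Pm\<^sup>2", OF _ n(3)]]])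
    fix s assume s: "HH L s"
    obtain N where N: "negligible N"
      "\<And>x. x \<in> {0..L} - N \<Longrightarrow> Uf s x = of_real (P' x) * Wf s x + of_real (P x) * dv L (Wf s) x"
      using Uf_ae[OF s] by blast
    show "IU s \<le> 2 * P1\<^sup>2 * sqint L (Wf s) + 2 * Pm\<^sup>2 * sqint L (dv L (Wf s))"
      unfolding IU_def
    proof (rule sqint_le_ae[OF Uf_L2[OF s] L2_continuous[OF Wf_continuous[OF s]] ac_L2[OF dWf_ac[OF s]] N(1)])
      fix x assume x: "x \<in> {0..L} - N"
      have "(P' x)\<^sup>2 \<le> P1\<^sup>2" "(P x)\<^sup>2 \<le> Pm\<^sup>2"
        using P1 Pm x by (auto simp: abs_le_square_iff[symmetric])
      then have "2 * (P' x)\<^sup>2 * (cmod (Wf s x))\<^sup>2 + 2 * (P x)\<^sup>2 * (cmod (dv L (Wf s) x))\<^sup>2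
          \<le> 2 * P1\<^sup>2 * (cmod (Wf s x))\<^sup>2 + 2 * Pm\<^sup>2 * (cmod (dv L (Wf s) x))\<^sup>2"
        by (intro add_mono mult_right_mono) auto
      then show "(cmod (Uf s x))\<^sup>2 \<le> 2 * P1\<^sup>2 * (cmod (Wf s x))\<^sup>2 + 2 * Pm\<^sup>2 * (cmod (dv L (Wf s) x))\<^sup>2"
        unfolding N(2)[OF x] using cmod_scaled_sum_sq order_trans by blast
    qed auto
  qed auto
  have G: "dominated L IG ?n"
  proof (rule dominated_le[OF dominated_scale[of Pm, OF _ n(4)]])
    fix s assume s: "HH L s"
    have "IG s \<le> integral {0..L} (\<lambda>x. Pm * (cmod (Gf s x))\<^sup>2)"
      unfolding IG_def
      by (intro integral_le L2_weighted_sq_integrable Gf_L2 s P_continuous continuous_intros)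
        (use Pm(2) in \<open>auto intro!: mult_right_mono dest: abs_le_D1\<close>)
    then show "IG s \<le> Pm * sqint L (Gf s)" by simp
  qed (use Pm in auto)
  have "dominated L (\<lambda>s. IU s + IG s + P L * (cmod (Wf s L))\<^sup>2 + c0 * \<bar>\<theta>3\<bar> * (cmod (vz s))\<^sup>2
     + c0 * b * (cmod (of_real a * vz s - et s))\<^sup>2) ?n"
    using P_pos[OF ends(2)] c0_pos b by (intro dominated_add dominated_scale U G W ends n ve) auto
  then show ?thesis
    by (rule dominated_le) (simp add: Z_eq)
qed

text \<open>\<open>Z\<close> has no explicit zero-order term in w, so the norm is rebuilt in stages.
  The values w'(L) and u give w' everywhere through the flux P w', and the product rule then gives
  w''. From v(0) and a v(0) - et one gets \<open>et\<close>; since \<theta>3 is nonzero,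
  \<open>et\<close> and w'(0) give w(0), hence w. Finally v follows from v(0) and v'.\<close>

lemma stnorm_dominated: "dominated L (\<lambda>s. (stnorm L s)\<^sup>2) Z"
proof -
  obtain P1 where P1: "P1 > 0" "\<And>x. x \<in> {0..L} \<Longrightarrow> \<bar>P' x\<bar> \<le> P1"
    using continuous_bound[OF P'_continuous] by blast
  have U: "dominated L IU Z"
    by (rule dominatedI[of 1]) (auto simp: Z_terms_le)
  have WL: "dominated L (\<lambda>s. (cmod (Wf s L))\<^sup>2) Z"
    by (rule dominated_cancel[OF P_pos[OF ends(2)] Z_terms_le(3)])
  have v: "dominated L (\<lambda>s. (cmod (vz s))\<^sup>2) Z"
    by (rule dominated_cancel[OF mult_pos_pos Z_terms_le(4)]) (use c0_pos \<theta>3 in auto)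
  have ve: "dominated L (\<lambda>s. (cmod (of_real a * vz s - et s))\<^sup>2) Z"
    by (rule dominated_cancel[OF _ Z_terms_le(5)]) (use c0_pos b in auto)
  have e: "dominated L (\<lambda>s. (cmod (et s))\<^sup>2) Z"
  proof (rule dominated_le[OF dominated_add[OF dominated_scale[of "2 * a\<^sup>2", OF _ v] dominated_scale[of "2 * (-1)\<^sup>2", OF _ ve]]])
    show "(cmod (et s))\<^sup>2 \<le> 2 * a\<^sup>2 * (cmod (vz s))\<^sup>2 + 2 * (-1)\<^sup>2 * (cmod (of_real a * vz s - et s))\<^sup>2" for s
      using cmod_scaled_sum_sq[of a "vz s" "-1" "of_real a * vz s - et s"] by simp
  qed auto
  have flux: "(cmod (of_real (P x) * Wf s x))\<^sup>2 \<le> 2 * ((P L)\<^sup>2 * (cmod (Wf s L))\<^sup>2) + 2 * (L * IU s)"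
    if "HH L s" "x \<in> {0..L}" for s x
    using ac_pointwise_sq_le[OF L flux_ac[OF that(1)] that(2) ends(2)]
    by (simp add: IU_def norm_mult power_mult_distrib)
  have Wx: "(cmod (Wf s x))\<^sup>2 \<le> (1 / P0\<^sup>2) * (2 * ((P L)\<^sup>2 * (cmod (Wf s L))\<^sup>2) + 2 * (L * IU s))"
    if "HH L s" "x \<in> {0..L}" for s x
  proof -
    have "P0\<^sup>2 * (cmod (Wf s x))\<^sup>2 \<le> (P x)\<^sup>2 * (cmod (Wf s x))\<^sup>2"
      using P_ge P0 that by (intro mult_right_mono power_mono) auto
    also note flux[OF that, unfolded norm_mult norm_of_real power_mult_distrib power2_abs]
    finally show ?thesis using P0 by (simp add: field_simps)
  qed
  have Wd: "dominated L (\<lambda>s. (1 / P0\<^sup>2) * (2 * ((P L)\<^sup>2 * (cmod (Wf s L))\<^sup>2) + 2 * (L * IU s))) Z"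
    using L by (intro dominated_scale dominated_add WL U) auto
  have W: "dominated L (\<lambda>s. (cmod (Wf s x))\<^sup>2) Z" if "x \<in> {0..L}" for x
    by (rule dominated_le[OF Wd Wx]) (use that in auto)
  have IW: "dominated L (\<lambda>s. sqint L (Wf s)) Z"
  proof (rule dominated_le[OF dominated_scale[OF _ Wd, of L]])
    fix s assume s: "HH L s"
    let ?C = "(1 / P0\<^sup>2) * (2 * ((P L)\<^sup>2 * (cmod (Wf s L))\<^sup>2) + 2 * (L * IU s))"
    have "((\<lambda>x. ?C) has_integral L * ?C) {0..L}"
      using has_integral_const_real[of ?C 0 L] L by simp
    then show "sqint L (Wf s) \<le> L * ?C"
      by (rule has_integral_le[OF integrable_integral[OF L2_sq_integrable[OF L2_continuous[OF Wf_continuous[OF s]]]]])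
        (rule Wx[OF s])
  qed (use L in auto)
  have IdW: "dominated L (\<lambda>s. sqint L (dv L (Wf s))) Z"
  proof (rule dominated_le[OF dominated_add[OF dominated_scale[of "2 / P0\<^sup>2", OF _ U] dominated_scale[of "2 * P1\<^sup>2 / P0\<^sup>2", OF _ IW]]])
    fix s assume s: "HH L s"
    obtain N where N: "negligible N"
      "\<And>x. x \<in> {0..L} - N \<Longrightarrow> Uf s x = of_real (P' x) * Wf s x + of_real (P x) * dv L (Wf s) x"
      using Uf_ae[OF s] by blast
    show "sqint L (dv L (Wf s)) \<le> 2 / P0\<^sup>2 * IU s + 2 * P1\<^sup>2 / P0\<^sup>2 * sqint L (Wf s)"
      unfolding IU_def
    proof (rule sqint_le_ae[OF ac_L2[OF dWf_ac[OF s]] Uf_L2[OF s] L2_continuous[OF Wf_continuous[OF s]] N(1)])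
      fix x assume x: "x \<in> {0..L} - N"
      have "P0\<^sup>2 * (cmod (dv L (Wf s) x))\<^sup>2 \<le> (P x)\<^sup>2 * (cmod (dv L (Wf s) x))\<^sup>2"
        using P_ge P0 x by (intro mult_right_mono power_mono) auto
      also have "\<dots> = (cmod (of_real 1 * Uf s x + of_real (- P' x) * Wf s x))\<^sup>2"
        unfolding N(2)[OF x] by (simp add: norm_mult power_mult_distrib)
      also have "\<dots> \<le> 2 * 1\<^sup>2 * (cmod (Uf s x))\<^sup>2 + 2 * (- P' x)\<^sup>2 * (cmod (Wf s x))\<^sup>2"
        by (rule cmod_scaled_sum_sq)
      also have "\<dots> \<le> 2 * 1\<^sup>2 * (cmod (Uf s x))\<^sup>2 + 2 * P1\<^sup>2 * (cmod (Wf s x))\<^sup>2"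
        using P1 x by (intro add_mono mult_right_mono mult_left_mono) (auto simp: abs_le_square_iff[symmetric])
      finally show "(cmod (dv L (Wf s) x))\<^sup>2 \<le> 2 / P0\<^sup>2 * (cmod (Uf s x))\<^sup>2 + 2 * P1\<^sup>2 / P0\<^sup>2 * (cmod (Wf s x))\<^sup>2"
        using P0 by (simp add: field_simps)
    qed auto
  qed auto
  have IGf: "dominated L (\<lambda>s. sqint L (Gf s)) Z"
  proof (rule dominated_le[OF dominated_scale[of "1 / P0" L Z]])
    show "dominated L Z Z"
      by (rule dominatedI[of 1]) auto
    fix s assume s: "HH L s"
    have "integral {0..L} (\<lambda>x. P0 * (cmod (Gf s x))\<^sup>2) \<le> IG s"
      unfolding IG_def
      by (intro integral_le L2_weighted_sq_integrable Gf_L2 s P_continuous continuous_intros)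
        (use P_ge in \<open>auto intro!: mult_right_mono\<close>)
    then have "P0 * sqint L (Gf s) \<le> Z s"
      using Z_terms_le(2)[OF s] by simp
    then show "sqint L (Gf s) \<le> 1 / P0 * Z s"
      using P0 by (simp add: field_simps)
  qed (use P0 in auto)
  have w0: "dominated L (\<lambda>s. (cmod (fst s 0))\<^sup>2) Z"
  proof (rule dominated_le[OF dominated_add[OF dominated_scale[of "2 * (1/\<theta>3)\<^sup>2", OF _ e] dominated_scale[of "2 * (- \<theta>4/\<theta>3)\<^sup>2", OF _ W[OF ends(1)]]]])
    fix s
    have "fst s 0 = of_real (1/\<theta>3) * et s + of_real (- \<theta>4/\<theta>3) * Wf s 0"
      using \<theta>3 by (simp add: et_def field_simps)
    then show "(cmod (fst s 0))\<^sup>2 \<le> 2 * (1/\<theta>3)\<^sup>2 * (cmod (et s))\<^sup>2 + 2 * (- \<theta>4/\<theta>3)\<^sup>2 * (cmod (Wf s 0))\<^sup>2"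
      using cmod_scaled_sum_sq by metis
  qed auto
  have Iw: "dominated L (\<lambda>s. sqint L (fst s)) Z"
    by (rule dominated_le[OF dominated_add[OF dominated_scale[OF _ w0] dominated_scale[OF _ IW]] ac_integral_sq_le[OF L Wf_ac ends(1)]])
      (use L in auto)
  have Iv: "dominated L (\<lambda>s. sqint L (fst (snd s))) Z"
    by (rule dominated_le[OF dominated_add[OF dominated_scale[OF _ v] dominated_scale[OF _ IGf]] ac_integral_sq_le[OF L Gf_ac ends(1), folded vz_def]])
      (use L in auto)
  have vL: "dominated L (\<lambda>s. (cmod (fst (snd s) L))\<^sup>2) Z"
    by (rule dominated_le[OF dominated_add[OF dominated_scale[OF _ v, of 2] dominated_scale[OF _ dominated_scale[OF _ IGf, of L], of 2]] ac_pointwise_sq_le[OF L Gf_ac ends(2,1), folded vz_def]])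
      (use L in auto)
  show ?thesis
    by (rule dominated_le[OF dominated_add[OF dominated_add[OF dominated_add[OF dominated_add[OF dominated_add[OF dominated_add[OF Iw IW] IdW] Iv] IGf] vL] v]])
      (simp add: stnorm_sq)
qed

subsection \<open>Surjectivity of the generator\<close>

text \<open>Two explicit integrations: the velocity component of the preimage is prescribed, its
  flux P w' is a primitive of g, and w is a primitive of w'. The two constants of integration are
  fixed by the conditions at \<open>L\<close> and at 0.\<close>

lemma Aop_surj:
  assumes "HH L x"
  shows "\<exists>y\<in>DA L P \<theta>1 \<theta>2 \<theta>3 \<theta>4. Aop L P \<theta>1 \<theta>2 \<theta>3 \<theta>4 y = x"
proof -
  obtain f g \<xi> \<psi> where x: "x = (f, g, \<xi>, \<psi>)" by (cases x) auto
  have f: "H2 L f" and g: "H1 L g" and xi: "\<xi> = g L" and psi: "\<psi> = g 0"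
    and out: "\<And>t. t \<notin> {0..L} \<Longrightarrow> f t = 0" "\<And>t. t \<notin> {0..L} \<Longrightarrow> g t = 0"
    using assms by (auto simp: HH_def x)
  \<comment> \<open>The constant is chosen so that p(L) = - P(L) g(L), that is w'(L) = -
    g(L).\<close>
  define p where "p t = - of_real (P L) * g L - integral {0..L} g + integral {0..t} g" for t
  have p: "ac L p g"
    using H1_L2[OF g] by (simp add: ac_def p_def)
  define Pi where "Pi t = inverse (complex_of_real (P t))" for t
  \<comment> \<open>Zero outside the interval, to agree as a function with \<open>dv L w\<close>,
    whose value there is 0.\<close>
  define W where "W t = (if t \<in> {0..L} then p t * Pi t else 0)" for t
  define W' where "W' t = g t * Pi t + p t * (- of_real (P' t) * inverse ((of_real (P t))\<^sup>2))" for t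
  have Pi: "ac L Pi (\<lambda>t. - of_real (P' t) * inverse ((of_real (P t))\<^sup>2))"
    unfolding Pi_def
    by (rule ac_inverse[OF P_ac]) (use less_imp_neq[OF P_pos] in \<open>force intro!: continuous_intros P'_continuous\<close>)+
  have W: "ac L W W'"
    by (rule ac_cong[OF ac_mult[OF p Pi]]) (auto simp: W_def W'_def)
  \<comment> \<open>The second derivative of \<open>P\<close> enters here: it puts w' = p / P into
    H^2, hence w into H^3.\<close>
  have "H1 L (dv L (\<lambda>x. complex_of_real (P x)))"
    using P_H2 by (simp add: H2_def)
  then have "H1 L (\<lambda>t. complex_of_real (P' t))"
    by (rule H1_cong) (use ac_dv_eq[OF L P_ac] P'_continuous in \<open>auto intro!: continuous_intros\<close>)
  then have "H1 L (\<lambda>t. g t * Pi t + p t * ((-1 * of_real (P' t)) * (Pi t * Pi t)))"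
    by (intro H1_add H1_mult H1_cmult g ac_imp_H1[OF p] ac_imp_H1[OF Pi])
  then have "H1 L W'"
    by (simp add: W'_def[abs_def] Pi_def power2_eq_square)
  then have H2W: "H2 L W"
    by (rule H2_I[OF L W])
  then have H1W: "H1 L W" by (simp add: H2_def)
  \<comment> \<open>The value w(0) for which the feedback \<open>Fb\<close> equals g(0); this
    divides by \<theta>3, which is negative.\<close>
  define w0 where "w0 = (g 0 - of_real \<theta>1 * f 0 - of_real \<theta>2 * dv L f 0 - of_real \<theta>4 * W 0) / of_real \<theta>3"
  define w where "w t = (if t \<in> {0..L} then w0 + integral {0..t} W else 0)" for t
  have w: "ac L w W"
    using H1_L2[OF H1W] L by (auto simp: ac_def w_def)
  have dw: "dv L w = W"
  proof
    show "dv L w t = W t" for t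
      using ac_dv_eq[OF L w H1_continuous[OF H1W], of t] by (cases "t \<in> {0..L}") (auto simp: W_def dv_def)
  qed
  have H2w: "H2 L w" by (rule H2_I[OF L w H1W])
  have "ac L (\<lambda>t. of_real (P t) * dv L w t) g"
    by (rule ac_cong[OF p]) (use P_pos in \<open>fastforce simp: dw W_def Pi_def\<close>)+
  note flux = this
  have dflux: "dv L (\<lambda>t. of_real (P t) * dv L w t) = g"
  proof
    show "dv L (\<lambda>t. of_real (P t) * dv L w t) t = g t" for t
      using ac_dv_eq[OF L flux H1_continuous[OF g], of t] out(2)[of t] by (cases "t \<in> {0..L}") (auto simp: dv_def)
  qed
  have WL: "W L = - g L"
    using L P_pos[OF ends(2)] by (simp add: W_def Pi_def p_def)
  have F: "Fb L \<theta>1 \<theta>2 \<theta>3 \<theta>4 w f = g 0"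
    using L \<theta>3 by (simp add: Fb_def dw w_def w0_def)
  have y: "HH L (w, f, f L, f 0)"
    using H2w f out by (auto simp: HH_def H2_def w_def)
  show ?thesis
  proof (rule bexI)
    show "Aop L P \<theta>1 \<theta>2 \<theta>3 \<theta>4 (w, f, f L, f 0) = x"
      unfolding Aop_def by (simp add: x dflux[unfolded dw] F dw WL xi psi)
    show "(w, f, f L, f 0) \<in> DA L P \<theta>1 \<theta>2 \<theta>3 \<theta>4"
      using y H2w H2W f by (simp add: DA_def H3_def dflux[unfolded dw] F dw WL)
  qed
qed

end

subsection \<open>Dissipation\<close>

lemma young_inner:
  fixes x y :: complex
  assumes "\<epsilon> > 0" "k \<ge> 0"
  shows "k * \<bar>x \<bullet> y\<bar> \<le> \<epsilon> * (cmod x)\<^sup>2 + k\<^sup>2 / (4 * \<epsilon>) * (cmod y)\<^sup>2"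
proof -
  have "k * \<bar>x \<bullet> y\<bar> \<le> k * (cmod x * cmod y)"
    using assms by (intro mult_left_mono Cauchy_Schwarz_ineq2) auto
  also have "\<dots> \<le> \<epsilon> * (cmod x)\<^sup>2 + k\<^sup>2 / (4 * \<epsilon>) * (cmod y)\<^sup>2"
  proof -
    have "0 \<le> (2 * \<epsilon> * cmod x - k * cmod y)\<^sup>2 / (4 * \<epsilon>)"
      using assms by simp
    also have "\<dots> = \<epsilon> * (cmod x)\<^sup>2 + k\<^sup>2 / (4 * \<epsilon>) * (cmod y)\<^sup>2 - k * (cmod x * cmod y)"
      using assms by (simp add: power2_diff power_mult_distrib field_simps power2_eq_square)
    finally show ?thesis by simp
  qed
  finally show ?thesis .
qed

text \<open>\<open>\<delta>\<close> is chosen so that (1 - \<delta>) (p - \<delta>) = k^2 / 4 +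
  \<delta>^2. Subtracting \<open>\<delta>\<close> times the identity therefore leaves a nonnegative
  form.\<close>

lemma binary_form_pos:
  fixes k p :: real and x y :: complex
  assumes "k\<^sup>2 < 4 * p" "p > 0"
  defines "\<delta> \<equiv> (p - k\<^sup>2 / 4) / (1 + p)"
  shows "\<delta> > 0" "\<delta> * ((cmod x)\<^sup>2 + (cmod y)\<^sup>2) \<le> (cmod x)\<^sup>2 + p * (cmod y)\<^sup>2 - k * (x \<bullet> y)"
proof -
  show "\<delta> > 0" using assms by (simp add: \<delta>_def)
  have d1: "1 - \<delta> > 0" using assms by (simp add: \<delta>_def field_simps) (smt (verit) zero_le_power2)
  have "\<delta> * (1 + p) = p - k\<^sup>2 / 4" using assms by (simp add: \<delta>_def)
  then have *: "k\<^sup>2 / 4 \<le> (1 - \<delta>) * (p - \<delta>)"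
    using zero_le_power2[of \<delta>] by (simp add: algebra_simps power2_eq_square)
  have "k * (x \<bullet> y) \<le> \<bar>k\<bar> * \<bar>x \<bullet> y\<bar>"
    by (metis abs_ge_self abs_mult)
  also have "\<dots> \<le> (1 - \<delta>) * (cmod x)\<^sup>2 + \<bar>k\<bar>\<^sup>2 / (4 * (1 - \<delta>)) * (cmod y)\<^sup>2"
    by (rule young_inner) (use d1 in auto)
  also have "\<bar>k\<bar>\<^sup>2 / (4 * (1 - \<delta>)) \<le> p - \<delta>"
    using * d1 by (simp add: field_simps)
  finally show "\<delta> * ((cmod x)\<^sup>2 + (cmod y)\<^sup>2) \<le> (cmod x)\<^sup>2 + p * (cmod y)\<^sup>2 - k * (x \<bullet> y)"
    by (simp add: mult_right_mono algebra_simps)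
qed

context wave_system
begin

abbreviation AA :: "state \<Rightarrow> state" where "AA \<equiv> Aop L P \<theta>1 \<theta>2 \<theta>3 \<theta>4"
abbreviation DD :: "state set" where "DD \<equiv> DA L P \<theta>1 \<theta>2 \<theta>3 \<theta>4"

text \<open>Applying \<open>AA\<close> is differentiation in time; the last two identities are the
  boundary conditions contained in the domain.\<close>

lemma Aop_coords:
  assumes "s \<in> DD"
  shows "Wf (AA s) = Gf s" "Uf (AA s) = dv L (\<lambda>x. of_real (P x) * Gf s x)" "Gf (AA s) = dv L (Uf s)"
    "vz (AA s) = Uf s 0" "et (AA s) = of_real \<theta>3 * vz s + of_real \<theta>4 * Gf s 0"
    "Uf s L = - Wf s L" "Uf s 0 = of_real \<theta>1 * vz s + of_real \<theta>2 * Gf s 0 + et s"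
  using assms
  by (cases s; simp add: DA_def Aop_def Wf_def Uf_def Gf_def vz_def et_def Fb_def)+

text \<open>This is where the conditions on \<open>\<theta>1\<close> and \<open>\<theta>2\<close> enter.\<close>

lemma boundary_relation:
  assumes "s \<in> DD"
  shows "of_real b * (of_real a * vz s - et s) = et (AA s) - of_real b * vz (AA s)"
proof -
  have eq: "b * \<theta>1 = \<theta>3 - a * b" "b * \<theta>2 = \<theta>4"
    using b by (simp_all add: \<theta>1 \<theta>2 field_simps)
  have "of_real b * Uf s 0 = of_real (b * \<theta>1) * vz s + of_real (b * \<theta>2) * Gf s 0 + of_real b * et s"
    by (simp add: Aop_coords(7)[OF assms] algebra_simps)
  from this[unfolded eq] show ?thesis
    by (simp add: Aop_coords(4,5)[OF assms] algebra_simps)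
qed

lemma P_0: "P 0 = c0 * \<theta>4"
  using \<theta>4 by (simp add: c0_def)

lemma boundary_flux:
  assumes "s \<in> DD"
  shows "of_real (P 0) * Gf s 0 = of_real c0 * (et (AA s) + of_real \<bar>\<theta>3\<bar> * vz s)"
  using \<theta>3 by (simp add: Aop_coords[OF assms] P_0 algebra_simps)

lemma ac_AA:
  assumes "s \<in> DD" "HH L (AA s)"
  shows "ac L (Uf s) (Gf (AA s))" "ac L (\<lambda>x. of_real (P x) * Gf s x) (Uf (AA s))"
  using Gf_ac[OF assms(2)] flux_ac[OF assms(2)] Aop_coords(1)[OF assms(1)]
  by (simp_all add: Uf_def Aop_def split: prod.splits)

text \<open>Integration by parts leaves only end-point terms. At \<open>L\<close> the flux cancels
  against the tip-mass term because u(L) = - w'(L); at 0 its v(0) part cancels against the |v(0)|^2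
  term, and - c0 u(0) . e remains.\<close>

lemma Z_dissipation:
  assumes "s \<in> DD" "HH L (AA s)"
  shows "form 1 (\<lambda>x. 0) 0 s (AA s)
    = - c0 * ((cmod (et (AA s)))\<^sup>2 + a * b * (cmod (vz (AA s)))\<^sup>2 - (a + b - 1) * (et (AA s) \<bullet> vz (AA s)))"
proof -
  note co = Aop_coords[OF assms(1)]
  let ?e = "et (AA s)" and ?u = "vz (AA s)"
  have "((\<lambda>x. Uf s x \<bullet> Uf (AA s) x + Gf (AA s) x \<bullet> (of_real (P x) * Gf s x)) has_integral
      Uf s L \<bullet> (of_real (P L) * Gf s L) - Uf s 0 \<bullet> (of_real (P 0) * Gf s 0)) {0..L}"
    by (rule ac_inner[OF ac_AA[OF assms]]) (use L in auto)
  then have "integral {0..L} (dens 1 (\<lambda>x. 0) s (AA s)) = - P L * (Wf s L \<bullet> Gf s L) - ?u \<bullet> (of_real (P 0) * Gf s 0)"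
    by (simp add: dens_def[abs_def] co inner_of_real_mult inner_commute[of "dv L (Uf s) _"] integral_unique)
  also have "?u \<bullet> (of_real (P 0) * Gf s 0) = c0 * (?u \<bullet> ?e + \<bar>\<theta>3\<bar> * (?u \<bullet> vz s))"
    by (simp add: boundary_flux[OF assms(1)] inner_of_real_mult inner_add_right)
  finally have i: "integral {0..L} (dens 1 (\<lambda>x. 0) s (AA s))
      = - P L * (Wf s L \<bullet> Gf s L) - c0 * (?u \<bullet> ?e + \<bar>\<theta>3\<bar> * (?u \<bullet> vz s))" .
  \<comment> \<open>Expanding the right-hand side gives the mixed coefficient a + b; the remaining
    flux - c0 u(0) . e turns it into a + b - 1.\<close>
  have j: "b * ((of_real a * vz s - et s) \<bullet> (of_real a * ?u - ?e)) = (?e - of_real b * ?u) \<bullet> (of_real a * ?u - ?e)"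
    unfolding boundary_relation[OF assms(1), symmetric] by (simp add: inner_of_real_mult)
  have "form 1 (\<lambda>x. 0) 0 s (AA s) = - c0 * (?u \<bullet> ?e) + c0 * (b * ((of_real a * vz s - et s) \<bullet> (of_real a * ?u - ?e)))"
    by (simp add: form_def i co(1) inner_commute[of "vz s" ?u] algebra_simps)
  also have "\<dots> = - c0 * (?e \<bullet> ?e + a * b * (?u \<bullet> ?u) - (a + b - 1) * (?e \<bullet> ?u))"
    unfolding j by (simp add: inner_diff_left inner_diff_right inner_of_real_mult inner_commute[of ?u ?e] algebra_simps)
  finally show ?thesis
    by (simp add: dot_square_norm)
qed

text \<open>The multiplier \<open>\<psi>\<close> is negative at both ends and increases so fast that both \<open>\<psi>\<close> and \<open>\<psi> P\<close> have
  derivatives bounded below; at \<open>L\<close> it even controls the kinetic energy of the tip mass.\<close>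

lemma multiplier_estimate:
  obtains \<psi> E where "continuous_on {0..L} \<psi>" "E > 0"
    "\<And>s. s \<in> DD \<Longrightarrow> HH L s \<Longrightarrow> HH L (AA s) \<Longrightarrow>
      2 * integral {0..L} (dens 0 (\<lambda>x. \<psi> x * P x) s (AA s)) \<le> - (IU s + IG s) - P L * (cmod (Wf s L))\<^sup>2
        + E * (P 0 * (cmod (vz (AA s)))\<^sup>2 + (cmod (of_real (P 0) * Gf s 0))\<^sup>2)"
proof -
  obtain P1 where P1: "P1 > 0" "\<And>x. x \<in> {0..L} \<Longrightarrow> \<bar>P' x\<bar> \<le> P1"
    using continuous_bound[OF P'_continuous] by blast
  \<comment> \<open>With this rate both \<mu> P - P' and \<mu> P are at least 1, which bounds the
    derivative of \<psi> P and the product \<psi>' P below by 1.\<close>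
  define \<mu> where "\<mu> = (1 + P1) / P0"
  have \<mu>: "\<mu> > 0" "\<mu> * P0 = 1 + P1" using P1 P0 by (simp_all add: \<mu>_def)
  define \<psi> where "\<psi> x = - exp (\<mu> * (L - x))" for x
  define \<psi>' where "\<psi>' x = \<mu> * exp (\<mu> * (L - x))" for x
  have \<psi>_cont: "continuous_on {0..L} \<psi>" and \<psi>'_cont: "continuous_on {0..L} \<psi>'"
    unfolding \<psi>_def \<psi>'_def by (intro continuous_intros)+
  have \<psi>: "ac L (\<lambda>x. of_real (\<psi> x)) (\<lambda>x. of_real (\<psi>' x))"
  proof (rule ac_deriv_continuous)
    fix x
    have "(\<psi> has_real_derivative \<psi>' x) (at x within {0..L})"
      unfolding \<psi>_def[abs_def] \<psi>'_def by (auto intro!: derivative_eq_intros)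
    then show "((\<lambda>x. complex_of_real (\<psi> x)) has_vector_derivative of_real (\<psi>' x)) (at x within {0..L})"
      by (intro has_vector_derivative_of_real) (simp add: has_real_derivative_iff_has_vector_derivative)
  qed (intro continuous_intros \<psi>'_cont)
  define m' where "m' x = \<psi>' x * P x + \<psi> x * P' x" for x
  have \<psi>P: "ac L (\<lambda>x. of_real (\<psi> x * P x)) (\<lambda>x. of_real (m' x))"
    using ac_mult[OF \<psi> P_ac] by (simp add: m'_def)
  have low: "1 \<le> m' x" "1 \<le> \<psi>' x * P x" if x: "x \<in> {0..L}" for x
  proof -
    have e: "exp (\<mu> * (L - x)) \<ge> 1" using x \<mu> by simp
    have "\<mu> * P x \<ge> 1 + P1" using \<mu> P_ge x by (metis mult_left_mono less_imp_le)
    then have "1 \<le> \<mu> * P x - P' x" "1 \<le> \<mu> * P x" using P1 x by force+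
    then have "1 * 1 \<le> exp (\<mu> * (L - x)) * (\<mu> * P x - P' x)" "1 * 1 \<le> exp (\<mu> * (L - x)) * (\<mu> * P x)"
      using e by (intro mult_mono; simp)+
    then show "1 \<le> m' x" "1 \<le> \<psi>' x * P x"
      by (simp_all add: m'_def \<psi>'_def \<psi>_def algebra_simps)
  qed
  show thesis
  proof (rule that[OF \<psi>_cont, of "exp (\<mu> * L)"])
    fix s assume s: "s \<in> DD" "HH L s" "HH L (AA s)"
    note co = Aop_coords[OF s(1)]
    define q where "q x = of_real (P x) * Gf s x" for x
    let ?u = "Uf s" and ?u' = "Gf (AA s)" and ?q' = "Uf (AA s)"
    have u: "ac L ?u ?u'" and q: "ac L q ?q'"
      unfolding q_def using ac_AA[OF s(1,3)] by auto
    let ?d = "dens 0 (\<lambda>x. \<psi> x * P x) s (AA s)"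
    \<comment> \<open>Two integrations by parts, with weight \<psi> P for |u|^2 and weight \<psi>
      for |q|^2; since q = P v', the mixed parts add up to twice the density.\<close>
    have "((\<lambda>x. (\<psi> x * P x) * (2 * (?u x \<bullet> ?u' x)) + m' x * (cmod (?u x))\<^sup>2
          + (\<psi> x * (2 * (q x \<bullet> ?q' x)) + \<psi>' x * (cmod (q x))\<^sup>2)) has_integral
        (\<psi> L * P L) * (cmod (?u L))\<^sup>2 - (\<psi> 0 * P 0) * (cmod (?u 0))\<^sup>2
          + (\<psi> L * (cmod (q L))\<^sup>2 - \<psi> 0 * (cmod (q 0))\<^sup>2)) {0..L}"
      using L by (intro has_integral_add ac_weighted_sq \<psi>P \<psi> u q) auto
    moreover have "(\<lambda>x. (\<psi> x * P x) * (2 * (?u x \<bullet> ?u' x)) + m' x * (cmod (?u x))\<^sup>2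
          + (\<psi> x * (2 * (q x \<bullet> ?q' x)) + \<psi>' x * (cmod (q x))\<^sup>2))
       = (\<lambda>x. 2 * ?d x + (m' x * (cmod (?u x))\<^sup>2 + \<psi>' x * (cmod (q x))\<^sup>2))"
      by (simp add: fun_eq_iff dens_def q_def inner_of_real_mult algebra_simps)
    ultimately have I: "((\<lambda>x. 2 * ?d x + (m' x * (cmod (?u x))\<^sup>2 + \<psi>' x * (cmod (q x))\<^sup>2)) has_integral
        (\<psi> L * P L) * (cmod (?u L))\<^sup>2 - (\<psi> 0 * P 0) * (cmod (?u 0))\<^sup>2
          + (\<psi> L * (cmod (q L))\<^sup>2 - \<psi> 0 * (cmod (q 0))\<^sup>2)) {0..L}" by simp
    have d: "?d integrable_on {0..L}"
      by (intro dens_integrable s continuous_intros \<psi>_cont P_continuous)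
    have J: "((\<lambda>x. 2 * ?d x + ((cmod (?u x))\<^sup>2 + P x * (cmod (Gf s x))\<^sup>2)) has_integral
        2 * integral {0..L} ?d + (IU s + IG s)) {0..L}"
      unfolding IU_def IG_def
      by (intro has_integral_add has_integral_mult_right integrable_integral d
          L2_sq_integrable L2_weighted_sq_integrable Uf_L2 Gf_L2 s P_continuous)
    have "2 * integral {0..L} ?d + (IU s + IG s) \<le> (\<psi> L * P L) * (cmod (?u L))\<^sup>2 - (\<psi> 0 * P 0) * (cmod (?u 0))\<^sup>2
          + (\<psi> L * (cmod (q L))\<^sup>2 - \<psi> 0 * (cmod (q 0))\<^sup>2)"
    proof (rule has_integral_le[OF J I])
      fix x assume x: "x \<in> {0..L}"
      have "1 * (cmod (?u x))\<^sup>2 \<le> m' x * (cmod (?u x))\<^sup>2"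
        using low[OF x] by (intro mult_right_mono) auto
      moreover have "1 * (P x * (cmod (Gf s x))\<^sup>2) \<le> (\<psi>' x * P x) * (P x * (cmod (Gf s x))\<^sup>2)"
        using low[OF x] P_pos[OF x] by (intro mult_right_mono) auto
      moreover have "(\<psi>' x * P x) * (P x * (cmod (Gf s x))\<^sup>2) = \<psi>' x * (cmod (q x))\<^sup>2"
        by (simp add: q_def norm_mult power_mult_distrib power2_eq_square)
      ultimately show "2 * ?d x + ((cmod (?u x))\<^sup>2 + P x * (cmod (Gf s x))\<^sup>2)
          \<le> 2 * ?d x + (m' x * (cmod (?u x))\<^sup>2 + \<psi>' x * (cmod (q x))\<^sup>2)"
        by simp
    qed
    \<comment> \<open>At \<open>L\<close> the weight is -1 and |u(L)| = |w'(L)|, which yields the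
      tip-mass term; the q(L) term has a favourable sign and is dropped. The unfavourable terms all
      sit at 0.\<close>
    moreover have "\<psi> L = -1" "\<psi> 0 = - exp (\<mu> * L)" by (simp_all add: \<psi>_def)
    ultimately have "2 * integral {0..L} ?d + (IU s + IG s) \<le> - P L * (cmod (Wf s L))\<^sup>2 - (cmod (q L))\<^sup>2
        + exp (\<mu> * L) * (P 0 * (cmod (vz (AA s)))\<^sup>2 + (cmod (of_real (P 0) * Gf s 0))\<^sup>2)"
      by (simp add: co q_def[symmetric] algebra_simps)
    moreover have "(cmod (q L))\<^sup>2 \<ge> 0" by simp
    ultimately show "2 * integral {0..L} ?d \<le> - (IU s + IG s) - P L * (cmod (Wf s L))\<^sup>2
        + exp (\<mu> * L) * (P 0 * (cmod (vz (AA s)))\<^sup>2 + (cmod (of_real (P 0) * Gf s 0))\<^sup>2)"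
      by linarith
  qed simp
qed

text \<open>The multiplier estimate pays with |P v'|^2 at 0, which contains |v(0)|^2 and is not
  covered by the dissipation of \<open>Z\<close>. The cross term weighted by \<open>K\<close> gives
  a larger negative multiple of |v(0)|^2; the products of indefinite sign that it brings along are
  split by Young's inequality.\<close>

lemma lower_order_estimate:
  obtains \<phi> K \<gamma> C where "continuous_on {0..L} \<phi>" "\<gamma> > 0" "C \<ge> 0"
    "\<And>s. s \<in> DD \<Longrightarrow> HH L s \<Longrightarrow> HH L (AA s) \<Longrightarrow>
      form 0 \<phi> K s (AA s) \<le> - (1/4) * (IU s + IG s + P L * (cmod (Wf s L))\<^sup>2)
        - \<gamma> * (c0 * \<bar>\<theta>3\<bar> * (cmod (vz s))\<^sup>2) + C * ((cmod (et (AA s)))\<^sup>2 + (cmod (vz (AA s)))\<^sup>2)"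
proof (rule multiplier_estimate)
  fix \<psi> :: "real \<Rightarrow> real" and E :: real
  assume \<psi>: "continuous_on {0..L} \<psi>" and E: "E > 0"
    and est: "\<And>s. s \<in> DD \<Longrightarrow> HH L s \<Longrightarrow> HH L (AA s) \<Longrightarrow>
      2 * integral {0..L} (dens 0 (\<lambda>x. \<psi> x * P x) s (AA s)) \<le> - (IU s + IG s) - P L * (cmod (Wf s L))\<^sup>2
        + E * (P 0 * (cmod (vz (AA s)))\<^sup>2 + (cmod (of_real (P 0) * Gf s 0))\<^sup>2)"
  define h where "h = \<bar>\<theta>3\<bar>"
  have h: "h > 0" using \<theta>3 by (simp add: h_def)
  \<comment> \<open>The flux at 0 costs E (c0 h)^2 |v(0)|^2, which for this \<open>k\<close> is half
    of the gain k c0 h |v(0)|^2; Young's inequality in \<open>t2\<close> uses a further quarter, so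
    a quarter is left.\<close>
  define k where "k = 2 * E * c0 * h"
  have k: "k > 0" using E c0_pos h by (simp add: k_def)
  \<comment> \<open>Small enough that \<epsilon> |P(0) w'(0)|^2 costs at most a quarter of the
    tip-mass term plus a quarter of \<open>IU\<close>, as shown in \<open>y2\<close>.\<close>
  define \<epsilon> where "\<epsilon> = 1 / (8 * (P L + L))"
  have PL: "P L > 0" by (rule P_pos[OF ends(2)])
  have \<epsilon>: "\<epsilon> > 0" "\<epsilon> * (2 * P L) \<le> 1/4" "\<epsilon> * (2 * L) \<le> 1/4"
    using PL L by (simp_all add: \<epsilon>_def field_simps)
  define C where "C = E * P 0 / 2 + E * c0\<^sup>2 + k * c0 / h + k\<^sup>2 / (4 * \<epsilon>)"
  have C: "C \<ge> E * c0\<^sup>2 + k * c0 / h" "C \<ge> E * P 0 / 2 + k\<^sup>2 / (4 * \<epsilon>)"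
    using E c0_pos k h \<epsilon> P_pos[OF ends(1)] by (simp_all add: C_def)
  show thesis
  \<comment> \<open>The factor \<open>P 0\<close> in the weight \<open>K\<close> turns w'(0) and
    v'(0) in the cross term into the fluxes \<open>?y\<close> and \<open>?q\<close>.\<close>
  proof (rule that[of "\<lambda>x. \<psi> x * P x" "k / 4" C "k * P 0"])
    show "continuous_on {0..L} (\<lambda>x. \<psi> x * P x)"
      by (intro continuous_intros \<psi> P_continuous)
    show "k / 4 > 0" using k by simp
    show "C \<ge> 0" using E c0_pos k h \<epsilon> P_pos[OF ends(1)] by (simp add: C_def)
    fix s assume s: "s \<in> DD" "HH L s" "HH L (AA s)"
    let ?e = "et (AA s)" and ?u = "vz (AA s)" and ?v = "vz s" and ?q = "of_real (P 0) * Gf s 0"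
      and ?y = "of_real (P 0) * Wf s 0" and ?w = "P L * (cmod (Wf s L))\<^sup>2"
    have q: "?q = of_real c0 * ?e + of_real (c0 * h) * ?v"
      unfolding boundary_flux[OF s(1)] h_def by (simp add: algebra_simps)
    have q2: "(cmod ?q)\<^sup>2 \<le> 2 * c0\<^sup>2 * (cmod ?e)\<^sup>2 + 2 * (c0 * h)\<^sup>2 * (cmod ?v)\<^sup>2"
      unfolding q by (rule cmod_scaled_sum_sq)
    have y2: "\<epsilon> * (cmod ?y)\<^sup>2 \<le> ?w / 4 + IU s / 4"
    proof -
      have "(cmod ?y)\<^sup>2 \<le> 2 * (P L * ?w) + 2 * (L * IU s)"
        using ac_pointwise_sq_le[OF L flux_ac[OF s(2)] ends] PL
        by (simp add: IU_def norm_mult power_mult_distrib power2_eq_square mult.assoc mult.left_commute)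
      then have "\<epsilon> * (cmod ?y)\<^sup>2 \<le> \<epsilon> * (2 * (P L * ?w) + 2 * (L * IU s))"
        using \<epsilon>(1) by (intro mult_left_mono) auto
      also have "\<dots> = (\<epsilon> * (2 * P L)) * ?w + (\<epsilon> * (2 * L)) * IU s"
        by (simp add: algebra_simps)
      also have "\<dots> \<le> 1/4 * ?w + 1/4 * IU s"
        using \<epsilon> PL IU_nonneg by (intro add_mono mult_right_mono) auto
      finally show ?thesis by simp
    qed
    have t1: "k * \<bar>?y \<bullet> ?u\<bar> \<le> \<epsilon> * (cmod ?y)\<^sup>2 + k\<^sup>2 / (4 * \<epsilon>) * (cmod ?u)\<^sup>2"
      by (rule young_inner) (use \<epsilon> k in auto)
    have t2: "(k * c0) * \<bar>?v \<bullet> ?e\<bar> \<le> (k * c0 * h / 4) * (cmod ?v)\<^sup>2 + (k * c0 / h) * (cmod ?e)\<^sup>2"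
    proof -
      have "(k * c0)\<^sup>2 / (4 * (k * c0 * h / 4)) = k * c0 / h"
        using k c0_pos h by (simp add: field_simps power2_eq_square)
      then show ?thesis
        using young_inner[of "k * c0 * h / 4" "k * c0" ?v ?e] k c0_pos h by simp
    qed
    have vq: "?v \<bullet> ?q = c0 * (?v \<bullet> ?e) + c0 * h * (cmod ?v)\<^sup>2"
      unfolding q inner_add_right inner_of_real_mult dot_square_norm ..
    have "form 0 (\<lambda>x. \<psi> x * P x) (k * P 0) s (AA s)
        = integral {0..L} (dens 0 (\<lambda>x. \<psi> x * P x) s (AA s)) - k * (?y \<bullet> ?u) - k * (?v \<bullet> ?q)"
      by (simp add: form_def Aop_coords(1)[OF s(1)] inner_of_real_mult algebra_simps)
    also have "\<dots> \<le> - ((IU s + IG s) + ?w) / 2 + E * P 0 / 2 * (cmod ?u)\<^sup>2 + E / 2 * (cmod ?q)\<^sup>2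
        + k * \<bar>?y \<bullet> ?u\<bar> + (k * c0) * \<bar>?v \<bullet> ?e\<bar> - k * (c0 * h * (cmod ?v)\<^sup>2)"
    proof -
      have "- (k * (?y \<bullet> ?u)) \<le> k * \<bar>?y \<bullet> ?u\<bar>" "- (k * c0 * (?v \<bullet> ?e)) \<le> (k * c0) * \<bar>?v \<bullet> ?e\<bar>"
        using mult_left_mono[OF abs_ge_minus_self[of "?y \<bullet> ?u"], of k]
          mult_left_mono[OF abs_ge_minus_self[of "?v \<bullet> ?e"], of "k * c0"] k c0_pos by simp_all
      then show ?thesis
        using est[OF s] unfolding vq by (simp add: algebra_simps add_divide_distrib diff_divide_distrib)
    qed
    also have "\<dots> \<le> - ((IU s + IG s) + ?w) / 2 + E * P 0 / 2 * (cmod ?u)\<^sup>2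
        + E / 2 * (2 * c0\<^sup>2 * (cmod ?e)\<^sup>2 + 2 * (c0 * h)\<^sup>2 * (cmod ?v)\<^sup>2)
        + ((?w / 4 + IU s / 4) + k\<^sup>2 / (4 * \<epsilon>) * (cmod ?u)\<^sup>2)
        + ((k * c0 * h / 4) * (cmod ?v)\<^sup>2 + (k * c0 / h) * (cmod ?e)\<^sup>2) - k * (c0 * h * (cmod ?v)\<^sup>2)"
      using mult_left_mono[OF q2, of "E/2"] E y2 t1 t2 by linarith
    also have "E / 2 * (2 * c0\<^sup>2 * (cmod ?e)\<^sup>2 + 2 * (c0 * h)\<^sup>2 * (cmod ?v)\<^sup>2)
        = E * c0\<^sup>2 * (cmod ?e)\<^sup>2 + k * c0 * h / 2 * (cmod ?v)\<^sup>2"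
      by (simp add: k_def power2_eq_square algebra_simps)
    also have "- ((IU s + IG s) + ?w) / 2 + E * P 0 / 2 * (cmod ?u)\<^sup>2
        + (E * c0\<^sup>2 * (cmod ?e)\<^sup>2 + k * c0 * h / 2 * (cmod ?v)\<^sup>2)
        + ((?w / 4 + IU s / 4) + k\<^sup>2 / (4 * \<epsilon>) * (cmod ?u)\<^sup>2)
        + ((k * c0 * h / 4) * (cmod ?v)\<^sup>2 + (k * c0 / h) * (cmod ?e)\<^sup>2) - k * (c0 * h * (cmod ?v)\<^sup>2)
      = - (1/4) * (IU s + IG s + ?w) - IG s / 4 - k / 4 * (c0 * h * (cmod ?v)\<^sup>2)
        + (E * c0\<^sup>2 + k * c0 / h) * (cmod ?e)\<^sup>2 + (E * P 0 / 2 + k\<^sup>2 / (4 * \<epsilon>)) * (cmod ?u)\<^sup>2"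
      by (simp add: algebra_simps add_divide_distrib diff_divide_distrib)
    also have "\<dots> \<le> - (1/4) * (IU s + IG s + ?w) - 0 - k / 4 * (c0 * h * (cmod ?v)\<^sup>2) + C * (cmod ?e)\<^sup>2 + C * (cmod ?u)\<^sup>2"
      using IG_nonneg[OF s(2)] C by (intro add_mono diff_mono mult_right_mono order_refl) auto
    finally show "form 0 (\<lambda>x. \<psi> x * P x) (k * P 0) s (AA s) \<le> - (1/4) * (IU s + IG s + ?w)
        - k / 4 * (c0 * \<bar>\<theta>3\<bar> * (cmod ?v)\<^sup>2) + C * ((cmod ?e)\<^sup>2 + (cmod ?u)\<^sup>2)"
      by (simp add: h_def algebra_simps)
  qed
qed

text \<open>The correction terms are bounded by the energy, so a large weight on \<open>Z\<close>
  preserves coercivity.\<close>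

lemma form_dominated:
  assumes "continuous_on {0..L} \<phi>"
  shows "dominated L (\<lambda>s. \<bar>form 0 \<phi> K s s\<bar>) Z"
proof (rule dominated_trans[OF _ stnorm_dominated])
  obtain F where F: "F > 0" "\<And>x. x \<in> {0..L} \<Longrightarrow> \<bar>\<phi> x\<bar> \<le> F"
    using continuous_bound[OF assms] by blast
  have d: "dominated L (\<lambda>s. F * IU s + F * sqint L (Gf s) + \<bar>K\<bar> * ((cmod (Wf s 0))\<^sup>2 + (cmod (vz s))\<^sup>2)) (\<lambda>s. (stnorm L s)\<^sup>2)"
  proof (intro dominated_add dominated_scale stnorm_dominates Wf_dominated ends)
    show "dominated L IU (\<lambda>s. (stnorm L s)\<^sup>2)"
      by (rule dominated_le[OF Z_dominated Z_terms_le(1)])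
  qed (use F in auto)
  have two: "2 * \<bar>x \<bullet> y\<bar> \<le> (cmod x)\<^sup>2 + (cmod y)\<^sup>2" for x y :: complex
    using young_inner[of 1 2 x y] by simp
  show "dominated L (\<lambda>s. \<bar>form 0 \<phi> K s s\<bar>) (\<lambda>s. (stnorm L s)\<^sup>2)"
  proof (rule dominated_le[OF d])
    fix s assume s: "HH L s"
    have "norm (integral {0..L} (dens 0 \<phi> s s)) \<le> integral {0..L} (\<lambda>x. F * (cmod (Uf s x))\<^sup>2 + F * (cmod (Gf s x))\<^sup>2)"
    proof (rule integral_norm_bound_integral)
      show "(\<lambda>x. F * (cmod (Uf s x))\<^sup>2 + F * (cmod (Gf s x))\<^sup>2) integrable_on {0..L}"
        by (intro integrable_add integrable_on_mult_right L2_sq_integrable Uf_L2 Gf_L2 s)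
      fix x assume x: "x \<in> {0..L}"
      have "norm (dens 0 \<phi> s s x) = \<bar>\<phi> x\<bar> * (2 * \<bar>Uf s x \<bullet> Gf s x\<bar>)"
        by (simp add: dens_def inner_commute[of "Gf s x" "Uf s x"] abs_mult flip: mult_2)
      also have "\<dots> \<le> F * ((cmod (Uf s x))\<^sup>2 + (cmod (Gf s x))\<^sup>2)"
        using F x two by (intro mult_mono) auto
      finally show "norm (dens 0 \<phi> s s x) \<le> F * (cmod (Uf s x))\<^sup>2 + F * (cmod (Gf s x))\<^sup>2"
        by (simp add: distrib_left)
    qed (intro dens_integrable s assms)
    also have "\<dots> = F * IU s + F * sqint L (Gf s)"
      unfolding IU_def using s by (simp add: integral_add integrable_on_mult_right L2_sq_integrable Uf_L2 Gf_L2)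
    finally have 1: "\<bar>integral {0..L} (dens 0 \<phi> s s)\<bar> \<le> F * IU s + F * sqint L (Gf s)" by simp
    have "\<bar>K * (Wf s 0 \<bullet> vz s + vz s \<bullet> Wf s 0)\<bar> = \<bar>K\<bar> * (2 * \<bar>Wf s 0 \<bullet> vz s\<bar>)"
      by (simp add: inner_commute[of "vz s" "Wf s 0"] abs_mult flip: mult_2)
    also have "\<dots> \<le> \<bar>K\<bar> * ((cmod (Wf s 0))\<^sup>2 + (cmod (vz s))\<^sup>2)"
      by (intro mult_left_mono two) simp
    finally show "\<bar>form 0 \<phi> K s s\<bar> \<le> F * IU s + F * sqint L (Gf s) + \<bar>K\<bar> * ((cmod (Wf s 0))\<^sup>2 + (cmod (vz s))\<^sup>2)"
      using 1 unfolding form_def by simp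
  qed
qed

lemma lyapunov_form:
  obtains N \<phi> K C \<kappa> where "continuous_on {0..L} \<phi>" "C > 0" "\<kappa> > 0"
    "\<And>s. HH L s \<Longrightarrow> Z s \<le> form N \<phi> K s s" "\<And>s. HH L s \<Longrightarrow> form N \<phi> K s s \<le> C * Z s"
    "\<And>s. s \<in> DD \<Longrightarrow> HH L s \<Longrightarrow> HH L (AA s) \<Longrightarrow> form N \<phi> K s (AA s) \<le> - \<kappa> * Z s"
proof -
  obtain \<phi> K \<gamma> C1 where \<phi>: "continuous_on {0..L} \<phi>" and \<gamma>: "\<gamma> > 0" and C1: "C1 \<ge> 0"
    and R: "\<And>s. s \<in> DD \<Longrightarrow> HH L s \<Longrightarrow> HH L (AA s) \<Longrightarrow>
      form 0 \<phi> K s (AA s) \<le> - (1/4) * (IU s + IG s + P L * (cmod (Wf s L))\<^sup>2)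
        - \<gamma> * (c0 * \<bar>\<theta>3\<bar> * (cmod (vz s))\<^sup>2) + C1 * ((cmod (et (AA s)))\<^sup>2 + (cmod (vz (AA s)))\<^sup>2)"
    by (rule lower_order_estimate) (rule that; blast)
  obtain C2 where C2: "C2 \<ge> 0" "\<And>s. HH L s \<Longrightarrow> \<bar>form 0 \<phi> K s s\<bar> \<le> C2 * Z s"
    using form_dominated[OF \<phi>, of K] unfolding dominated_def by blast
  define \<delta> where "\<delta> = (a * b - (a + b - 1)\<^sup>2 / 4) / (1 + a * b)"
  have abp: "a * b > 0" using a b by simp
  have \<delta>: "\<delta> > 0" and form_pos: "\<And>x y. \<delta> * ((cmod x)\<^sup>2 + (cmod y)\<^sup>2) \<le> (cmod x)\<^sup>2 + a * b * (cmod y)\<^sup>2 - (a + b - 1) * (x \<bullet> y)"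
    unfolding \<delta>_def using binary_form_pos[of "a + b - 1" "a * b"] ab abp by (auto simp: mult.assoc)
  \<comment> \<open>The first entry leaves at least |e|^2 + |u(0)|^2 of dissipation after the
    remainder with \<open>C1\<close> is absorbed; the second keeps the form above \<open>Z\<close>.
    Weighting \<open>Z\<close> heavily takes the place of making the corrections small.\<close>
  define N where "N = max ((C1 + 1) / (c0 * \<delta>)) (C2 + 1)"
  have N: "N * (c0 * \<delta>) \<ge> C1 + 1" "N \<ge> C2 + 1" "N > 0"
  proof -
    have "N \<ge> (C1 + 1) / (c0 * \<delta>)" by (simp add: N_def)
    then show "N * (c0 * \<delta>) \<ge> C1 + 1" using c0_pos \<delta> by (simp add: pos_divide_le_eq)
    show "N \<ge> C2 + 1" by (simp add: N_def)
    then show "N > 0" using C2 by simp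
  qed
  \<comment> \<open>The term of \<open>Z\<close> with |a v(0) - et|^2 has no negative counterpart in
    \<open>R\<close>; \<open>boundary_relation\<close> bounds it by \<open>C3\<close> times the
    leftover |e|^2 + |u(0)|^2.\<close>
  define C3 where "C3 = 2 * c0 / b + 2 * c0 * b"
  have C3: "C3 > 0" using c0_pos b by (simp add: C3_def add_pos_pos)
  define \<kappa> where "\<kappa> = min (1/4) (min \<gamma> (1 / C3))"
  have \<kappa>: "\<kappa> > 0" "\<kappa> \<le> 1/4" "\<kappa> \<le> \<gamma>" "\<kappa> * C3 \<le> 1"
  proof -
    show "\<kappa> > 0" "\<kappa> \<le> 1/4" "\<kappa> \<le> \<gamma>" using \<gamma> C3 by (auto simp: \<kappa>_def)
    have "\<kappa> \<le> 1 / C3" by (simp add: \<kappa>_def)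
    then show "\<kappa> * C3 \<le> 1" using C3 by (simp add: field_simps)
  qed
  have split: "form N \<phi> K s s = N * Z s + form 0 \<phi> K s s" if "HH L s" for s
    unfolding Z_def by (rule form_split[OF that that \<phi>])
  show thesis
  proof (rule that[OF \<phi>, of "N + C2" \<kappa> N K])
    show "N + C2 > 0" using N C2 by simp
    fix s assume s: "HH L s"
    show "form N \<phi> K s s \<le> (N + C2) * Z s"
      using C2(2)[OF s] by (simp add: split[OF s] algebra_simps)
    have "(C2 + 1) * Z s \<le> N * Z s"
      using N(2) Z_nonneg[OF s] by (rule mult_right_mono)
    then show "Z s \<le> form N \<phi> K s s"
      using C2(2)[OF s] by (simp add: split[OF s] algebra_simps)
  next
    fix s assume s: "s \<in> DD" "HH L s" "HH L (AA s)"
    let ?e = "et (AA s)" and ?u = "vz (AA s)"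
    let ?S = "(cmod ?e)\<^sup>2 + (cmod ?u)\<^sup>2" and ?X = "IU s + IG s + P L * (cmod (Wf s L))\<^sup>2"
      and ?V = "c0 * \<bar>\<theta>3\<bar> * (cmod (vz s))\<^sup>2" and ?Y = "c0 * b * (cmod (of_real a * vz s - et s))\<^sup>2"
    have "(N * c0) * (\<delta> * ?S) \<le> (N * c0) * ((cmod ?e)\<^sup>2 + a * b * (cmod ?u)\<^sup>2 - (a + b - 1) * (?e \<bullet> ?u))"
      using N(3) c0_pos by (intro mult_left_mono form_pos) auto
    moreover have "(C1 + 1) * ?S \<le> (N * (c0 * \<delta>)) * ?S"
      using N(1) by (intro mult_right_mono) auto
    ultimately have "N * form 1 (\<lambda>x. 0) 0 s (AA s) \<le> - ((C1 + 1) * ?S)"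
      unfolding Z_dissipation[OF s(1,3)] by (simp add: algebra_simps)
    then have B: "form N \<phi> K s (AA s) \<le> - (1/4) * ?X - \<gamma> * ?V - ?S"
      using R[OF s] form_split[OF s(2,3) \<phi>, of N K] by (simp add: algebra_simps)
    have "?Y \<le> C3 * ?S"
    proof -
      have "b * cmod (of_real a * vz s - et s) = cmod (of_real 1 * ?e + of_real (- b) * ?u)"
        using arg_cong[OF boundary_relation[OF s(1)], of cmod] b by (simp add: norm_mult)
      then have "b\<^sup>2 * (cmod (of_real a * vz s - et s))\<^sup>2 \<le> 2 * 1\<^sup>2 * (cmod ?e)\<^sup>2 + 2 * (- b)\<^sup>2 * (cmod ?u)\<^sup>2"
        by (metis cmod_scaled_sum_sq power_mult_distrib)
      then have "(c0 / b) * (b\<^sup>2 * (cmod (of_real a * vz s - et s))\<^sup>2) \<le> (c0 / b) * (2 * (cmod ?e)\<^sup>2 + 2 * b\<^sup>2 * (cmod ?u)\<^sup>2)"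
        using c0_pos b by (intro mult_left_mono) auto
      then have "?Y \<le> (2 * c0 / b) * (cmod ?e)\<^sup>2 + (2 * c0 * b) * (cmod ?u)\<^sup>2"
        using b by (simp add: power2_eq_square field_simps)
      also have "\<dots> \<le> C3 * (cmod ?e)\<^sup>2 + C3 * (cmod ?u)\<^sup>2"
        using c0_pos b by (intro add_mono mult_right_mono) (auto simp: C3_def)
      finally show ?thesis by (simp add: distrib_left)
    qed
    then have "\<kappa> * ?Y \<le> (\<kappa> * C3) * ?S"
      using \<kappa>(1) by (simp add: mult.assoc mult_left_mono)
    also have "\<dots> \<le> 1 * ?S"
      using \<kappa>(4) by (intro mult_right_mono) auto
    finally have y: "\<kappa> * ?Y \<le> ?S" by simp
    have "\<kappa> * ?X \<le> 1/4 * ?X"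
      using \<kappa>(2) IU_nonneg IG_nonneg[OF s(2)] P_pos[OF ends(2)]
      by (intro mult_right_mono) (auto intro!: add_nonneg_nonneg mult_nonneg_nonneg)
    moreover have "\<kappa> * ?V \<le> \<gamma> * ?V"
      using \<kappa>(3) c0_pos by (intro mult_right_mono) auto
    ultimately show "form N \<phi> K s (AA s) \<le> - \<kappa> * Z s"
      using B y unfolding Z_eq[OF s(2)] by (simp add: distrib_left)
  qed (rule \<kappa>(1))
qed

end

theorem theorem4p3:
  fixes L P0 a b \<theta>1 \<theta>2 \<theta>3 \<theta>4 :: real
    and P :: "real \<Rightarrow> real"
    and T :: "real \<Rightarrow> state \<Rightarrow> state"
  assumes "L > 0"
    and "H2 L (\<lambda>x. complex_of_real (P x))"
    and "P0 > 0" and "\<forall>x\<in>{0..L}. P x \<ge> P0"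
    and "a > 0" and "b > 0" and "(a + b - 1)\<^sup>2 < 4 * a * b"
    and "\<theta>1 = \<theta>3 / b - a" and "\<theta>2 = \<theta>4 / b"
    and "\<theta>1 < 0" and "\<theta>3 < 0" and "\<theta>2 > 0" and "\<theta>4 > 0"
    and "generates L (Aop L P \<theta>1 \<theta>2 \<theta>3 \<theta>4) (DA L P \<theta>1 \<theta>2 \<theta>3 \<theta>4) T"
  shows "\<exists>M \<ge> 1. \<exists>\<omega> > 0. \<forall>t \<ge> 0. \<forall>x. HH L x \<longrightarrow>
           stnorm L (T t x) \<le> M * exp (- \<omega> * t) * stnorm L x"
proof -
  interpret wave_system L P0 a b \<theta>1 \<theta>2 \<theta>3 \<theta>4 P
    by standard (use assms in auto)
  obtain N \<phi> K C \<kappa> where \<phi>: "continuous_on {0..L} \<phi>" and C: "C > 0" and \<kappa>: "\<kappa> > 0"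
    and low: "\<And>s. HH L s \<Longrightarrow> Z s \<le> form N \<phi> K s s" and up: "\<And>s. HH L s \<Longrightarrow> form N \<phi> K s s \<le> C * Z s"
    and diss: "\<And>s. s \<in> DD \<Longrightarrow> HH L s \<Longrightarrow> HH L (AA s) \<Longrightarrow> form N \<phi> K s (AA s) \<le> - \<kappa> * Z s"
    by (rule lyapunov_form) (rule that; blast)
  obtain Cu where Cu: "Cu \<ge> 0" "\<And>s. HH L s \<Longrightarrow> Z s \<le> Cu * (stnorm L s)\<^sup>2"
    using Z_dominated unfolding dominated_def by blast
  obtain Cl where Cl: "Cl \<ge> 0" "\<And>s. HH L s \<Longrightarrow> (stnorm L s)\<^sup>2 \<le> Cl * Z s"
    using stnorm_dominated unfolding dominated_def by blast
  \<comment> \<open>The added 1 keeps the denominator positive when \<open>Cl\<close> is 0.\<close>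
  define m where "m = 1 / (Cl + 1)"
  have m: "m > 0" using Cl by (simp add: m_def)
  define B where "B = form N \<phi> K"
  \<comment> \<open>Since V \<le> C Z, the bound - \<kappa> Z is at most - (\<kappa> / C) V; the
    factor 2 comes from V' = 2 B.\<close>
  interpret dissipative_semigroup L AA DD T "\<lambda>s. B s s" B m "C * Cu" "2 * \<kappa> / C"
  proof
    show "L > 0" "generates L AA DD T" "m > 0"
      using assms m by auto
    fix x y :: state and r :: real assume x: "HH L x" and y: "HH L y"
    show "B (st_add x (st_scale (of_real r) y)) (st_add x (st_scale (of_real r) y)) = B x x + 2 * r * B x y + r\<^sup>2 * B y y"
      unfolding B_def by (rule form_square[OF x y \<phi>])
    show "B (st_scale (of_real r) x) (st_scale (of_real r) x) = r\<^sup>2 * B x x"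
      unfolding B_def by (rule form_scale[OF x \<phi>])
    show "B x (st_add y (st_scale (of_real r) z)) = B x y + r * B x z" if "HH L z" for z
      unfolding B_def by (rule form_lin[OF x y that \<phi>])
    show "m * (stnorm L x)\<^sup>2 \<le> B x x"
    proof -
      have "(stnorm L x)\<^sup>2 \<le> (Cl + 1) * Z x"
        using Cl(2)[OF x] Z_nonneg[OF x] by (simp add: distrib_right)
      also have "\<dots> \<le> (Cl + 1) * B x x"
        unfolding B_def using Cl(1) by (intro mult_left_mono low x) auto
      finally show ?thesis
        using Cl(1) by (simp add: m_def field_simps)
    qed
    have "C * Z x \<le> C * (Cu * (stnorm L x)\<^sup>2)"
      using Cu(2)[OF x] C by (intro mult_left_mono) auto
    then show "B x x \<le> C * Cu * (stnorm L x)\<^sup>2"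
      unfolding B_def using up[OF x] by simp
    show "\<exists>z\<in>DD. AA z = x"
      by (rule Aop_surj[OF x])
  next
    fix x assume x: "x \<in> DD"
    have hx: "HH L x" "HH L (AA x)"
      using assms(14) x by (auto simp: generates_def DA_def)
    have "(\<kappa> / C) * B x x \<le> (\<kappa> / C) * (C * Z x)"
      unfolding B_def using \<kappa> C by (intro mult_left_mono up hx) auto
    then show "2 * B x (AA x) \<le> - (2 * \<kappa> / C) * B x x"
      using diss[OF x hx] C by (simp add: B_def)
  qed
  \<comment> \<open>V is quadratic in the norm: the equivalence constants enter through a root, and
    the rate is half that of V.\<close>
  define M where "M = sqrt (C * Cu / m)"
  define \<omega> where "\<omega> = \<kappa> / C"
  have est: "stnorm L (T t x) \<le> M * exp (- \<omega> * t) * stnorm L x" if t: "t \<ge> 0" and x: "HH L x" for t x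
  proof -
    have s0: "stnorm L x \<ge> 0"
      by (cases x) (simp add: stnorm_def)
    have "m * (stnorm L (T t x))\<^sup>2 \<le> B (T t x) (T t x)"
      by (rule V_lower[OF T_HH[OF t x]])
    also have "\<dots> \<le> exp (- (2 * \<kappa> / C) * t) * B x x"
      by (rule decay[OF x t])
    also have "\<dots> \<le> exp (- (2 * \<kappa> / C) * t) * (C * Cu * (stnorm L x)\<^sup>2)"
      by (intro mult_left_mono V_upper x) auto
    also have "exp (- (2 * \<kappa> / C) * t) = (exp (- \<omega> * t))\<^sup>2"
      by (simp add: \<omega>_def power2_eq_square flip: exp_add)
    finally have "(stnorm L (T t x))\<^sup>2 \<le> (C * Cu / m) * (exp (- \<omega> * t) * stnorm L x)\<^sup>2"
      using m by (simp add: field_simps power_mult_distrib)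
    also have "\<dots> = (M * (exp (- \<omega> * t) * stnorm L x))\<^sup>2"
      using C Cu(1) m by (simp add: M_def power_mult_distrib)
    finally have "stnorm L (T t x) \<le> M * (exp (- \<omega> * t) * stnorm L x)"
      by (rule power2_le_imp_le) (use s0 C Cu(1) m in \<open>auto simp: M_def\<close>)
    then show ?thesis by simp
  qed
  have "stnorm L (T t x) \<le> max 1 M * exp (- \<omega> * t) * stnorm L x" if "t \<ge> 0" "HH L x" for t x
  proof -
    have "stnorm L x \<ge> 0"
      by (cases x) (simp add: stnorm_def)
    then have "M * exp (- \<omega> * t) * stnorm L x \<le> max 1 M * exp (- \<omega> * t) * stnorm L x"
      by (intro mult_right_mono) auto
    then show ?thesis using est[OF that] by linarith
  qed
  moreover have "\<omega> > 0" using \<kappa> C by (simp add: \<omega>_def)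
  ultimately show ?thesis
    by (intro exI[of _ "max 1 M"] conjI exI[of _ \<omega>]) auto
qed

end
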